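(* Let $M$ be a smooth submanifold of $\mathbb{R}^n$ of codimension $p$, with local defining functions $\rho_1,\dots,\rho_p$ such that $n_j=d\rho_j$ are orthonormal on $M$, and $F_j=dn_j^{\#}$. The curvature tensor $R$ on $M$ is given by the symmetric $(2,2)$-form $$R=\tfrac12\sum_jF_j\wedge F_j,$$ in the sense that, if $a$ is a form of bidegree $(1,0)$ on $M_s$, then $$(D^{\#})^2a=a\rfloor\Big(\tfrac12\sum_jF_j\wedge F_j\Big)$$ as forms on $M_s$ (i.e. the two sides agree after wedging with $[M]_s$).
   Context: Superforms: let $x=(x_1,\dots,x_n)$ be orthonormal coordinates on $\mathbb{R}^n$ and $\xi=(\xi_1,\dots,\xi_n)$ coordinates on a second copy of $\mathbb{R}^n$. A superform is a differential form $a=\sum a_{I,J}(x)\,dx_I\wedge d\xi_J$ on $\mathbb{R}^n_s=\mathbb{R}^n\oplus\mathbb{R}^n$ whose coefficients do not depend on $\xi$; it has bidegree $(p,q)$ if $|I|=p$, $|J|=q$. $J$ is the multiplicative operator on forms with $J(dx_i)=d\xi_i$, $J(d\xi_i)=-dx_i$; for $a$ of bidegree $(p,0)$ write $a^{\#}=J(a)$. A superform is symmetric if it is $J$-invariant. Put $da=\sum \frac{\partial a_{I,J}}{\partial x_k}dx_k\wedge dx_I\wedge d\xi_J$ and $d^{\#}a=\sum \frac{\partial a_{I,J}}{\partial x_k}d\xi_k\wedge dx_I\wedge d\xi_J$. The forms $dx_i,d\xi_i$ are taken orthonormal, and for a 1-form $v$ the contraction $v\rfloor$ is the adjoint of $v\wedge$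 (so $dx_i\rfloor(dx_i\wedge d\xi_j)=d\xi_j$). Supercurrents are superforms with distribution coefficients. The supercurrent $[M]_s$: let $n=n_1\wedge\dots\wedge n_p$, $c_p=(-1)^{p(p-1)/2}$. Then $[M]_s=c_p\,n\wedge n^{\#}*dS_M$, where $dS_M$ is surface measure on $M$ and, for a measure $\mu$, $*\mu$ is the bidegree $(0,0)$ supercurrent with $*\mu.(\alpha_0\,dx_1\wedge d\xi_1\wedge\dots\wedge dx_n\wedge d\xi_n)=\int\alpha_0\,d\mu$. A superform $a$ on the ambient space vanishes on $M_s$ if $a\wedge[M]_s=0$; forms on $M_s$ are superforms near $M$ modulo those vanishing on $M_s$. Every form on $M_s$ has locally a canonical extension, i.e. a representative $a$ with $n_j\rfloor a=n_j^{\#}\rfloor a=0$ for $j=1,\dots,p$; contraction $a\rfloor$ with a $(1,0)$-form $a$ on $M_s$ is understood with $a$ represented by its canonical extension. The operator $D^{\#}$: $D^{\#}=d^{\#}+\mathcal F^{\#}$, where $\mathcal F^{\#}b=\sum_jF_j\wedge(n_j\rfloor b)$. One has $D^{\#}[M]_s=0$, $D^{\#}$ is an antiderivation, and it is well defined on forms on $M_s$; on $(p,0)$-forms it represents the Levi-Civita connection of $M$: the covariant derivative of $a$ in the direction of a tangent vector $V=\sum V_j\partial/\partial x_j$ is $V^{\#}\rfloor D^{\#}a$, $V^{\#}=\sum V_j\partial/\partial\xi_j$. *)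

theory Defs
  imports "HOL-Analysis.Analysis"
begin

section \<open>Smooth functions\<close>

definition partial :: "'n::finite \<Rightarrow> (real^'n \<Rightarrow> 'b::real_normed_vector) \<Rightarrow> real^'n \<Rightarrow> 'b" where
  "partial k f = (\<lambda>x. frechet_derivative f (at x) (axis k 1))"

text \<open>\<open>C\<^sup>\<infinity>\<close> on an open set: all iterated partial derivatives exist and are (totally) differentiable.\<close>

definition smooth_on :: "(real^'n::finite) set \<Rightarrow> (real^'n \<Rightarrow> 'b::real_normed_vector) \<Rightarrow> bool" where
  "smooth_on U f \<longleftrightarrow> (\<forall>ks. \<forall>x\<in>U. foldr partial ks f differentiable (at x))"


section \<open>The exterior algebra of two copies of Euclidean space\<close>

text \<open>
  The coordinate \<open>(I, J)\<close> of a covector is the coefficient of \<open>dx\<^sub>I \<and> d\<xi>\<^sub>J\<close>, the factors of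
  \<open>dx\<^sub>I\<close> and \<open>d\<xi>\<^sub>J\<close> being taken in increasing order. The inner product of \<open>real ^ _\<close> is the one
  for which these monomials are orthonormal.
\<close>

type_synonym 'n scovector = "real ^ ('n set \<times> 'n set)"

definition inversions :: "'n::linorder set \<Rightarrow> 'n set \<Rightarrow> nat" where
  "inversions I K = card {(i, k). i \<in> I \<and> k \<in> K \<and> k < i}"

text \<open>
  For \<open>I \<inter> K = {}\<close> and \<open>J \<inter> L = {}\<close>:
  \<open>dx\<^sub>I \<and> d\<xi>\<^sub>J \<and> dx\<^sub>K \<and> d\<xi>\<^sub>L = swap_sign I J K L \<cdot> dx\<^bsub>I \<union> K\<^esub> \<and> d\<xi>\<^bsub>J \<union> L\<^esub>\<close>.
\<close>

definition swap_sign :: "'n::linorder set \<Rightarrow> 'n set \<Rightarrow> 'n set \<Rightarrow> 'n set \<Rightarrow> real" where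
  "swap_sign I J K L = (-1) ^ (card J * card K + inversions I K + inversions J L)"

definition wedge :: "'n::{finite,linorder} scovector \<Rightarrow> 'n scovector \<Rightarrow> 'n scovector"
    (infixr "\<and>\<^sub>s" 75) where
  "a \<and>\<^sub>s b = (\<chi> P. \<Sum>I\<in>Pow (fst P). \<Sum>J\<in>Pow (snd P).
     swap_sign I J (fst P - I) (snd P - J) * a $ (I, J) * b $ (fst P - I, snd P - J))"

definition scalar :: "real \<Rightarrow> 'n::finite scovector" where
  "scalar c = axis ({}, {}) c"

definition dx :: "'n::finite \<Rightarrow> 'n scovector" where
  "dx i = axis ({i}, {}) 1"

definition dxi :: "'n::finite \<Rightarrow> 'n scovector" where
  "dxi i = axis ({}, {i}) 1"

text \<open>
  \<open>J(dx\<^sub>I \<and> d\<xi>\<^sub>J) = d\<xi>\<^sub>I \<and> (-1)\<^bsup>|J|\<^esup> dx\<^sub>J = (-1)\<^bsup>|J| + |I||J|\<^esup> dx\<^sub>J \<and> d\<xi>\<^sub>I\<close>.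
  That this is the multiplicative operator with \<open>dx\<^sub>i \<mapsto> d\<xi>\<^sub>i\<close>, \<open>d\<xi>\<^sub>i \<mapsto> - dx\<^sub>i\<close> is proved below.
\<close>

definition Jop :: "'n::finite scovector \<Rightarrow> 'n scovector" where
  "Jop a = (\<chi> P. (-1) ^ (card (fst P) + card (fst P) * card (snd P)) * a $ (snd P, fst P))"

lemma Jop_wedge: "Jop (a \<and>\<^sub>s b) = Jop a \<and>\<^sub>s Jop b"
proof -
  have sgn: "(-1) ^ (card A + card A * card B) * swap_sign J I (B - J) (A - I) =
      swap_sign I J (A - I) (B - J) * (-1) ^ (card I + card I * card J) *
        (-1) ^ (card (A - I) + card (A - I) * card (B - J))"
    if "I \<subseteq> A" "J \<subseteq> B" for A B I J :: "'a set"
  proof -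
    have c: "card A = card I + card (A - I)" "card B = card J + card (B - J)"
      using that by (simp_all add: card_Diff_subset card_mono)
    have "even ((card A + card A * card B) + (card I * card (B - J) + inversions J (B - J) + inversions I (A - I))) =
      even ((card J * card (A - I) + inversions I (A - I) + inversions J (B - J)) +
        (card I + card I * card J) + (card (A - I) + card (A - I) * card (B - J)))"
      unfolding c by (simp only: even_add even_mult_iff) blast
    then show ?thesis
      unfolding swap_sign_def power_add[symmetric] by (simp only: minus_one_power_iff)
  qed
  show ?thesis
    unfolding vec_eq_iff
  proof
    fix P :: "'a set \<times> 'a set"
    obtain A B where P: "P = (A, B)" by fastforce
    have "Jop (a \<and>\<^sub>s b) $ P = (\<Sum>J\<in>Pow B. \<Sum>I\<in>Pow A.
        ((-1) ^ (card A + card A * card B) * swap_sign J I (B - J) (A - I)) *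
          (a $ (J, I) * b $ (B - J, A - I)))"
      by (simp add: P Jop_def wedge_def sum_distrib_left mult_ac)
    also have "\<dots> = (\<Sum>I\<in>Pow A. \<Sum>J\<in>Pow B.
        ((-1) ^ (card A + card A * card B) * swap_sign J I (B - J) (A - I)) *
          (a $ (J, I) * b $ (B - J, A - I)))"
      by (rule sum.swap)
    also have "\<dots> = (Jop a \<and>\<^sub>s Jop b) $ P"
      unfolding P Jop_def wedge_def by (auto simp: sgn intro!: sum.cong)
    finally show "Jop (a \<and>\<^sub>s b) $ P = (Jop a \<and>\<^sub>s Jop b) $ P" .
  qed
qed

lemma Jop_dx: "Jop (dx i) = dxi i" and Jop_dxi: "Jop (dxi i) = - dx i"
  by (auto simp: vec_eq_iff Jop_def dx_def dxi_def axis_def)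

definition contract :: "'n::{finite,linorder} scovector \<Rightarrow> 'n scovector \<Rightarrow> 'n scovector"
    (infixr "\<rfloor>" 75) where
  "v \<rfloor> a = adjoint (\<lambda>b. v \<and>\<^sub>s b) a"


section \<open>Superforms\<close>

text \<open>Coefficients do not depend on \<open>\<xi>\<close>, so a superform is a function of \<open>x\<close> alone.\<close>

type_synonym 'n superform = "real^'n \<Rightarrow> 'n scovector"

definition superform_of_bidegree ::
    "(real^'n::finite) set \<Rightarrow> nat \<Rightarrow> nat \<Rightarrow> 'n superform \<Rightarrow> bool" where
  "superform_of_bidegree U p q a \<longleftrightarrow> smooth_on U a \<and>
     (\<forall>x\<in>U. \<forall>I J. a x $ (I, J) \<noteq> 0 \<longrightarrow> card I = p \<and> card J = q)"

definition symmetric_superform :: "(real^'n::finite) set \<Rightarrow> 'n superform \<Rightarrow> bool" where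
  "symmetric_superform U a \<longleftrightarrow> (\<forall>x\<in>U. Jop (a x) = a x)"

definition sd :: "'n::{finite,linorder} superform \<Rightarrow> 'n superform" where
  "sd a = (\<lambda>x. \<Sum>k\<in>UNIV. dx k \<and>\<^sub>s partial k a x)"

definition sd_sharp :: "'n::{finite,linorder} superform \<Rightarrow> 'n superform" where
  "sd_sharp a = (\<lambda>x. \<Sum>k\<in>UNIV. dxi k \<and>\<^sub>s partial k a x)"


section \<open>Supercurrents\<close>

text \<open>
  A supercurrent is a superform with distribution coefficients; the coefficients are
  functionals on test functions. The pairing of a supercurrent with test forms is the one
  extending integration of superforms, normalised by
  \<open>\<integral> f dx\<^sub>1 \<and> d\<xi>\<^sub>1 \<and> \<dots> \<and> dx\<^sub>n \<and> d\<xi>\<^sub>n = \<integral> f dx\<close>, so that the bidegree \<open>(0,0)\<close> current of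
  a measure has that measure as its coefficient.
\<close>

type_synonym 'n supercurrent = "'n set \<times> 'n set \<Rightarrow> (real^'n \<Rightarrow> real) \<Rightarrow> real"

definition test_function :: "(real^'n::finite) set \<Rightarrow> (real^'n \<Rightarrow> real) \<Rightarrow> bool" where
  "test_function U \<phi> \<longleftrightarrow> smooth_on UNIV \<phi> \<and>
     compact (closure {x. \<phi> x \<noteq> 0}) \<and> closure {x. \<phi> x \<noteq> 0} \<subseteq> U"

definition eq_current_on ::
    "(real^'n::finite) set \<Rightarrow> 'n supercurrent \<Rightarrow> 'n supercurrent \<Rightarrow> bool" where
  "eq_current_on U S T \<longleftrightarrow> (\<forall>P \<phi>. test_function U \<phi> \<longrightarrow> S P \<phi> = T P \<phi>)"

definition star_measure :: "(real^'n::finite) measure \<Rightarrow> 'n supercurrent" where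
  "star_measure \<mu> = (\<lambda>P \<phi>. if P = ({}, {}) then \<integral>x. \<phi> x \<partial>\<mu> else 0)"

definition wedge_current ::
    "'n::{finite,linorder} superform \<Rightarrow> 'n supercurrent \<Rightarrow> 'n supercurrent" where
  "wedge_current a T = (\<lambda>P \<phi>. \<Sum>I\<in>Pow (fst P). \<Sum>J\<in>Pow (snd P).
     swap_sign I J (fst P - I) (snd P - J) *
       T (fst P - I, snd P - J) (\<lambda>x. a x $ (I, J) * \<phi> x))"


section \<open>Surface measure\<close>

text \<open>
  Hausdorff measure of integer dimension, normalised to agree with Lebesgue measure on
  \<open>d\<close>-dimensional subspaces. Covers may use the empty set, which has to count as \<open>0\<close> also for
  \<open>d = 0\<close>; \<open>diameter\<close> is only meaningful on bounded sets.
\<close>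

definition hausdorff_gauge :: "nat \<Rightarrow> 'a::metric_space set \<Rightarrow> ennreal" where
  "hausdorff_gauge d C =
     (if C = {} then 0 else ennreal (unit_ball_vol (real d) * (diameter C / 2) ^ d))"

definition hausdorff_content :: "nat \<Rightarrow> real \<Rightarrow> 'a::metric_space set \<Rightarrow> ennreal" where
  "hausdorff_content d \<delta> A =
     (INF C \<in> {C :: nat \<Rightarrow> 'a set. A \<subseteq> (\<Union>i. C i) \<and> (\<forall>i. bounded (C i) \<and> diameter (C i) \<le> \<delta>)}.
        \<Sum>i. hausdorff_gauge d (C i))"

definition hausdorff :: "nat \<Rightarrow> 'a::metric_space set \<Rightarrow> ennreal" where
  "hausdorff d A = (SUP \<delta>\<in>{0<..}. hausdorff_content d \<delta> A)"

definition surface_measure :: "nat \<Rightarrow> 'a::metric_space set \<Rightarrow> 'a measure" where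
  "surface_measure d M = measure_of UNIV (sets borel) (\<lambda>B. hausdorff d (B \<inter> M))"

text \<open>
  \<open>measure_of\<close> yields the zero measure unless the given set function is countably additive on
  the Borel sets. That it is follows from Caratheodory's theorem, closed sets splitting Hausdorff
  measure additively.
\<close>

lemma hausdorff_content_le:
  assumes "A \<subseteq> (\<Union>i. C i)" "\<And>i. bounded (C i)" "\<And>i. diameter (C i) \<le> \<delta>"
  shows "hausdorff_content d \<delta> A \<le> (\<Sum>i::nat. hausdorff_gauge d (C i))"
  unfolding hausdorff_content_def using assms by (intro INF_lower) auto

lemma hausdorff_content_mono:
  "A \<subseteq> B \<Longrightarrow> \<delta>' \<le> \<delta> \<Longrightarrow> hausdorff_content d \<delta> A \<le> hausdorff_content d \<delta>' B"
  unfolding hausdorff_content_def by (rule INF_superset_mono) (auto intro: order_trans)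

lemma hausdorff_content_empty: "0 < \<delta> \<Longrightarrow> hausdorff_content d \<delta> {} = 0"
  using hausdorff_content_le[of "{}" "\<lambda>_. {}" \<delta> d] by (simp add: hausdorff_gauge_def)

lemma hausdorff_content_countably_subadditive:
  fixes A :: "nat \<Rightarrow> 'a::metric_space set"
  shows "hausdorff_content d \<delta> (\<Union>i. A i) \<le> (\<Sum>i. hausdorff_content d \<delta> (A i))"
proof (rule ennreal_le_epsilon)
  fix e :: real assume e: "0 < e" and fin: "(\<Sum>i. hausdorff_content d \<delta> (A i)) < top"
  have "\<exists>C::nat\<Rightarrow>'a set. A i \<subseteq> (\<Union>j. C j) \<and> (\<forall>j. bounded (C j) \<and> diameter (C j) \<le> \<delta>) \<and>
      (\<Sum>j. hausdorff_gauge d (C j)) \<le> hausdorff_content d \<delta> (A i) + ennreal (e * (1/2)^Suc i)" for i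
  proof -
    have "hausdorff_content d \<delta> (A i) \<noteq> top"
      using fin by (auto simp: less_top dest: ennreal_suminf_lessD)
    then have "hausdorff_content d \<delta> (A i) < hausdorff_content d \<delta> (A i) + ennreal (e * (1/2)^Suc i)"
      using e by (cases "hausdorff_content d \<delta> (A i)") (auto simp: ennreal_plus[symmetric] ennreal_less_iff simp del: ennreal_plus)
    then show ?thesis
      unfolding hausdorff_content_def[of d \<delta> "A i"] INF_less_iff by (auto intro: less_imp_le)
  qed
  then obtain C :: "nat \<Rightarrow> nat \<Rightarrow> 'a set" where C: "\<And>i. A i \<subseteq> (\<Union>j. C i j)"
      "\<And>i j. bounded (C i j)" "\<And>i j. diameter (C i j) \<le> \<delta>"
      "\<And>i. (\<Sum>j. hausdorff_gauge d (C i j)) \<le> hausdorff_content d \<delta> (A i) + ennreal (e * (1/2)^Suc i)"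
    by metis
  have "hausdorff_content d \<delta> (\<Union>i. A i) \<le> (\<Sum>k. hausdorff_gauge d ((\<lambda>(i,j). C i j) (prod_decode k)))"
  proof (rule hausdorff_content_le)
    show "(\<Union>i. A i) \<subseteq> (\<Union>k. (\<lambda>(i,j). C i j) (prod_decode k))"
    proof
      fix x assume "x \<in> (\<Union>i. A i)"
      then obtain i j where "x \<in> C i j" using C(1) by blast
      then show "x \<in> (\<Union>k. (\<lambda>(i,j). C i j) (prod_decode k))"
        by (auto intro!: exI[of _ "prod_encode (i,j)"])
    qed
  qed (auto simp: C split: prod.split)
  also have "\<dots> = (\<Sum>i. \<Sum>j. hausdorff_gauge d (C i j))"
    using suminf_ennreal_2dimen[of "\<lambda>i. \<Sum>j. hausdorff_gauge d (C i j)" "\<lambda>(i,j). hausdorff_gauge d (C i j)"]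
    by (simp add: comp_def case_prod_beta)
  also have "\<dots> \<le> (\<Sum>i. hausdorff_content d \<delta> (A i) + ennreal (e * (1/2)^Suc i))"
    by (intro suminf_le C) auto
  also have "\<dots> = (\<Sum>i. hausdorff_content d \<delta> (A i)) + (\<Sum>i. ennreal (e * (1/2)^Suc i))"
    by (intro suminf_add[symmetric]) auto
  also have "(\<Sum>i. ennreal (e * (1/2)^Suc i)) = ennreal e"
    using e sums_mult[OF power_half_series, of e]
    by (intro suminf_ennreal_eq) auto
  finally show "hausdorff_content d \<delta> (\<Union>i. A i) \<le> (\<Sum>i. hausdorff_content d \<delta> (A i)) + ennreal e" .
qed

lemma hausdorff_mono: "A \<subseteq> B \<Longrightarrow> hausdorff d A \<le> hausdorff d B"
  unfolding hausdorff_def by (intro SUP_mono bexI hausdorff_content_mono) auto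

lemma hausdorff_empty: "hausdorff d {} = 0"
  by (simp add: hausdorff_def hausdorff_content_empty)

lemma hausdorff_countably_subadditive: "hausdorff d (\<Union>i. A i) \<le> (\<Sum>i. hausdorff d (A i))"
  unfolding hausdorff_def[of d "\<Union>i. A i"]
proof (rule SUP_least)
  fix \<delta> :: real assume "\<delta> \<in> {0<..}"
  then have "(\<Sum>i. hausdorff_content d \<delta> (A i)) \<le> (\<Sum>i. hausdorff d (A i))"
    by (intro suminf_le) (auto simp: hausdorff_def intro: SUP_upper)
  then show "hausdorff_content d \<delta> (\<Union>i. A i) \<le> (\<Sum>i. hausdorff d (A i))"
    using hausdorff_content_countably_subadditive order_trans by blast
qed

lemma hausdorff_subadditive: "hausdorff d (A \<union> B) \<le> hausdorff d A + hausdorff d B"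
proof -
  have "hausdorff d (\<Union>i. binaryset A B i) \<le> (\<Sum>i. hausdorff d (binaryset A B i))"
    by (rule hausdorff_countably_subadditive)
  also have "\<dots> = hausdorff d A + hausdorff d B"
    using suminf_binaryset_eq[of "hausdorff d" A B] by (simp add: hausdorff_empty comp_def)
  finally show ?thesis by (simp add: UN_binaryset_eq)
qed

lemma hausdorff_separated:
  fixes A B :: "'a::metric_space set"
  assumes "0 < \<epsilon>" and sep: "\<And>x y. x \<in> A \<Longrightarrow> y \<in> B \<Longrightarrow> \<epsilon> \<le> dist x y"
  shows "hausdorff d A + hausdorff d B \<le> hausdorff d (A \<union> B)"
proof -
  have small: "hausdorff_content d \<delta> A + hausdorff_content d \<delta> B \<le> hausdorff_content d \<delta> (A \<union> B)"
    if "\<delta> < \<epsilon>" "0 < \<delta>" for \<delta>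
    unfolding hausdorff_content_def[of d \<delta> "A \<union> B"]
  proof (rule INF_greatest)
    fix C :: "nat \<Rightarrow> 'a set"
    assume "C \<in> {C. A \<union> B \<subseteq> (\<Union>i. C i) \<and> (\<forall>i. bounded (C i) \<and> diameter (C i) \<le> \<delta>)}"
    then have cov: "A \<union> B \<subseteq> (\<Union>i. C i)" and bd: "\<And>i. bounded (C i)" and dm: "\<And>i. diameter (C i) \<le> \<delta>"
      by auto
    define CA CB where "CA = (\<lambda>i. if C i \<inter> A = {} then {} else C i)"
      and "CB = (\<lambda>i. if C i \<inter> B = {} then {} else C i)"
    have "C i \<inter> A = {} \<or> C i \<inter> B = {}" for i
    proof (rule ccontr)
      assume "\<not> ?thesis"
      then obtain x y where xy: "x \<in> C i" "x \<in> A" "y \<in> C i" "y \<in> B" by blast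
      have "dist x y \<le> \<delta>"
        using diameter_bounded_bound[OF bd xy(1,3)] dm[of i] by linarith
      then show False using sep[OF xy(2,4)] that by linarith
    qed
    then have le: "hausdorff_gauge d (CA i) + hausdorff_gauge d (CB i) \<le> hausdorff_gauge d (C i)" for i
      by (auto simp: CA_def CB_def hausdorff_gauge_def)
    have "hausdorff_content d \<delta> A \<le> (\<Sum>i. hausdorff_gauge d (CA i))"
    proof (rule hausdorff_content_le)
      show "A \<subseteq> (\<Union>i. CA i)"
      proof
        fix x assume "x \<in> A"
        moreover from this obtain i where "x \<in> C i" using cov by blast
        ultimately have "x \<in> CA i" by (auto simp: CA_def)
        then show "x \<in> (\<Union>i. CA i)" by blast
      qed
    qed (use bd dm that in \<open>auto simp: CA_def\<close>)
    moreover have "hausdorff_content d \<delta> B \<le> (\<Sum>i. hausdorff_gauge d (CB i))"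
    proof (rule hausdorff_content_le)
      show "B \<subseteq> (\<Union>i. CB i)"
      proof
        fix x assume "x \<in> B"
        moreover from this obtain i where "x \<in> C i" using cov by blast
        ultimately have "x \<in> CB i" by (auto simp: CB_def)
        then show "x \<in> (\<Union>i. CB i)" by blast
      qed
    qed (use bd dm that in \<open>auto simp: CB_def\<close>)
    ultimately have "hausdorff_content d \<delta> A + hausdorff_content d \<delta> B \<le>
        (\<Sum>i. hausdorff_gauge d (CA i)) + (\<Sum>i. hausdorff_gauge d (CB i))"
      by (rule add_mono)
    also have "\<dots> = (\<Sum>i. hausdorff_gauge d (CA i) + hausdorff_gauge d (CB i))"
      by (intro suminf_add) auto
    also have "\<dots> \<le> (\<Sum>i. hausdorff_gauge d (C i))"
      by (intro suminf_le le) auto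
    finally show "hausdorff_content d \<delta> A + hausdorff_content d \<delta> B \<le> (\<Sum>i. hausdorff_gauge d (C i))" .
  qed
  have "hausdorff_content d \<delta> A + hausdorff_content d \<delta>' B \<le> hausdorff d (A \<union> B)"
    if "0 < \<delta>" "0 < \<delta>'" for \<delta> \<delta>'
  proof -
    define \<eta> where "\<eta> = min (min \<delta> \<delta>') (\<epsilon> / 2)"
    have \<eta>: "0 < \<eta>" "\<eta> \<le> \<delta>" "\<eta> \<le> \<delta>'" "\<eta> < \<epsilon>" using that assms(1) by (auto simp: \<eta>_def)
    have "hausdorff_content d \<delta> A + hausdorff_content d \<delta>' B \<le>
        hausdorff_content d \<eta> A + hausdorff_content d \<eta> B"
      by (intro add_mono hausdorff_content_mono \<eta> order_refl)
    also have "\<dots> \<le> hausdorff_content d \<eta> (A \<union> B)" by (rule small[OF \<eta>(4,1)])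
    also have "\<dots> \<le> hausdorff d (A \<union> B)"
      unfolding hausdorff_def using \<eta> by (intro SUP_upper) auto
    finally show ?thesis .
  qed
  then show ?thesis
    unfolding hausdorff_def[of d A] hausdorff_def[of d B]
    by (subst ennreal_SUP_add_left[symmetric], force)
      (auto intro!: SUP_least simp: ennreal_SUP_add_right)
qed

lemma hausdorff_separated_sum:
  fixes R :: "nat \<Rightarrow> 'a::metric_space set"
  assumes sep: "\<And>i j. i < j \<Longrightarrow> \<exists>\<epsilon>>0. \<forall>x\<in>R i. \<forall>y\<in>R j. \<epsilon> \<le> dist x y"
  shows "(\<Sum>i<n. hausdorff d (R i)) \<le> hausdorff d (\<Union>i<n. R i)"
proof (induction n)
  case 0
  then show ?case by simp
next
  case (Suc n)
  obtain e where e: "\<And>i. i < n \<Longrightarrow> 0 < e i" "\<And>i x y. i < n \<Longrightarrow> x \<in> R i \<Longrightarrow> y \<in> R n \<Longrightarrow> e i \<le> dist x y"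
    using sep[of _ n] by metis
  define \<epsilon> where "\<epsilon> = Min (insert 1 (e ` {..<n}))"
  have "0 < \<epsilon>" and \<epsilon>: "\<And>i. i < n \<Longrightarrow> \<epsilon> \<le> e i" by (auto simp: \<epsilon>_def e)
  have "hausdorff d (\<Union>i<n. R i) + hausdorff d (R n) \<le> hausdorff d ((\<Union>i<n. R i) \<union> R n)"
    by (rule hausdorff_separated[OF \<open>0 < \<epsilon>\<close>]) (use e \<epsilon> in \<open>force intro: order_trans\<close>)
  then show ?case
    using order_trans[OF add_right_mono[OF Suc.IH, of "hausdorff d (R n)"]]
    by (simp add: lessThan_Suc Un_commute add.commute)
qed

lemma hausdorff_split_closed:
  fixes F T :: "'a::metric_space set"
  assumes "closed F"
  shows "hausdorff d (T \<inter> F) + hausdorff d (T - F) = hausdorff d T"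
proof (rule antisym)
  have "hausdorff d T = hausdorff d ((T \<inter> F) \<union> (T - F))" by (simp add: Int_Diff_Un)
  then show "hausdorff d T \<le> hausdorff d (T \<inter> F) + hausdorff d (T - F)"
    using hausdorff_subadditive by metis
  show "hausdorff d (T \<inter> F) + hausdorff d (T - F) \<le> hausdorff d T"
  proof (cases "F = {} \<or> hausdorff d T = top")
    case True
    then show ?thesis by (auto simp: hausdorff_empty)
  next
    case False
    then have "F \<noteq> {}" and fin: "hausdorff d T < top" by (auto simp: less_top)
    define r where "r = (\<lambda>k::nat. 1 / real (Suc k))"
    have r_pos: "0 < r k" and r_anti: "k < l \<Longrightarrow> r l < r k" for k l
      by (auto simp: r_def field_simps)
    define S where "S = (\<lambda>k. {x\<in>T. r k \<le> infdist x F})"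
    define R where "R = (\<lambda>k. {x\<in>T. r (Suc k) \<le> infdist x F \<and> infdist x F < r k})"
    have sepR: "\<exists>\<epsilon>>0. \<forall>x\<in>R i. \<forall>y\<in>R j. \<epsilon> \<le> dist x y" if "Suc i < j" for i j
    proof (intro exI conjI ballI)
      show "0 < r (Suc i) - r j" using r_anti[OF that] by simp
      fix x y assume "x \<in> R i" "y \<in> R j"
      then have "r (Suc i) \<le> infdist x F" "infdist y F < r j" by (auto simp: R_def)
      moreover have "infdist x F \<le> infdist y F + dist x y" by (rule infdist_triangle)
      ultimately show "r (Suc i) - r j \<le> dist x y" by linarith
    qed
    have half: "(\<Sum>i. hausdorff d (R (2 * i + c))) \<le> hausdorff d T" for c
    proof (rule suminf_le_const[OF summableI])
      fix n
      have "(\<Sum>i<n. hausdorff d (R (2 * i + c))) \<le> hausdorff d (\<Union>i<n. R (2 * i + c))"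
        by (rule hausdorff_separated_sum) (use sepR in auto)
      also have "\<dots> \<le> hausdorff d T" by (rule hausdorff_mono) (auto simp: R_def)
      finally show "(\<Sum>i<n. hausdorff d (R (2 * i + c))) \<le> hausdorff d T" .
    qed
    have "(\<Sum>i<2 * n. hausdorff d (R i)) =
        (\<Sum>i<n. hausdorff d (R (2 * i))) + (\<Sum>i<n. hausdorff d (R (2 * i + 1)))" for n
      by (induction n) (auto simp: algebra_simps)
    also have "\<dots> n \<le> hausdorff d T + hausdorff d T" for n
      using half[of 0] half[of 1] sum_le_suminf[OF summableI, of "{..<n}" "\<lambda>i. hausdorff d (R (2 * i))"]
        sum_le_suminf[OF summableI, of "{..<n}" "\<lambda>i. hausdorff d (R (2 * i + 1))"]
      by (intro add_mono) (auto intro: order_trans)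
    finally have part: "(\<Sum>i<2 * n. hausdorff d (R i)) \<le> hausdorff d T + hausdorff d T" for n .
    have "(\<Sum>i. hausdorff d (R i)) \<le> hausdorff d T + hausdorff d T"
    proof (rule suminf_le_const[OF summableI])
      fix n
      have "(\<Sum>i<n. hausdorff d (R i)) \<le> (\<Sum>i<2 * n. hausdorff d (R i))"
        by (intro sum_mono2) auto
      then show "(\<Sum>i<n. hausdorff d (R i)) \<le> hausdorff d T + hausdorff d T"
        using part order_trans by blast
    qed
    then have finR: "(\<Sum>i. hausdorff d (R i)) < top"
      using fin by (metis ennreal_add_less_top order.strict_trans1)
    have tail: "(\<lambda>k. \<Sum>i. hausdorff d (R (i + k))) \<longlonglongrightarrow> 0"
    proof -
      define g where "g = (\<lambda>i. enn2real (hausdorff d (R i)))"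
      have g: "hausdorff d (R i) = ennreal (g i)" for i
        using finR ennreal_suminf_lessD[OF finR] by (simp add: g_def)
      have g0: "0 \<le> g i" for i by (simp add: g_def)
      have sg: "summable g"
        using finR g0 by (intro summable_suminf_not_top) (auto simp: g)
      have "(\<lambda>k. \<Sum>i. g (i + k)) \<longlonglongrightarrow> 0"
        by (rule suminf_exist_split2[OF sg])
      then have "(\<lambda>k. ennreal (\<Sum>i. g (i + k))) \<longlonglongrightarrow> ennreal 0"
        by (intro tendsto_ennrealI)
      moreover have "ennreal (\<Sum>i. g (i + k)) = (\<Sum>i. hausdorff d (R (i + k)))" for k
        unfolding g using g0 sg by (intro suminf_ennreal2[symmetric]) (auto simp: summable_iff_shift)
      ultimately show ?thesis by simp
    qed
    have "hausdorff d (T \<inter> F) + hausdorff d (T - F) \<le> hausdorff d T + (\<Sum>i. hausdorff d (R (i + k)))" for k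
    proof -
      have "T - F \<subseteq> S k \<union> (\<Union>i. R (i + k))"
      proof
        fix x assume x: "x \<in> T - F"
        then have "0 < infdist x F"
          using in_closed_iff_infdist_zero[OF assms \<open>F \<noteq> {}\<close>] infdist_nonneg[of x F] by fastforce
        then obtain m where m: "r m < infdist x F"
          unfolding r_def using nat_approx_posE by blast
        show "x \<in> S k \<union> (\<Union>i. R (i + k))"
        proof (cases "r k \<le> infdist x F")
          case True
          then show ?thesis using x by (simp add: S_def)
        next
          case False
          define l where "l = (LEAST l. r l \<le> infdist x F)"
          have l: "r l \<le> infdist x F" unfolding l_def using LeastI[of "\<lambda>l. r l \<le> infdist x F" m] m by simp
          have nl: "infdist x F < r i" if "i < l" for i
            using not_less_Least[of i "\<lambda>l. r l \<le> infdist x F"] that unfolding l_def by simp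
          have "k < l"
          proof (rule ccontr)
            assume "\<not> k < l"
            then have "r k \<le> r l" using r_anti[of l k] by (cases "l = k") auto
            then show False using l False by linarith
          qed
          then obtain i where "l = Suc (i + k)"
            using less_imp_Suc_add[of k l] by (auto simp: add.commute)
          then have "x \<in> R (i + k)" using l nl[of "i + k"] x by (simp add: R_def)
          then show ?thesis by blast
        qed
      qed
      then have "hausdorff d (T - F) \<le> hausdorff d (S k \<union> (\<Union>i. R (i + k)))"
        by (rule hausdorff_mono)
      also have "\<dots> \<le> hausdorff d (S k) + hausdorff d (\<Union>i. R (i + k))"
        by (rule hausdorff_subadditive)
      also have "\<dots> \<le> hausdorff d (S k) + (\<Sum>i. hausdorff d (R (i + k)))"
        by (intro add_left_mono hausdorff_countably_subadditive)
      finally have "hausdorff d (T \<inter> F) + hausdorff d (T - F) \<le>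
          (hausdorff d (T \<inter> F) + hausdorff d (S k)) + (\<Sum>i. hausdorff d (R (i + k)))"
        unfolding add.assoc by (rule add_left_mono)
      also have "hausdorff d (T \<inter> F) + hausdorff d (S k) \<le> hausdorff d ((T \<inter> F) \<union> S k)"
      proof (rule hausdorff_separated[OF r_pos[of k]])
        fix x y assume "x \<in> T \<inter> F" "y \<in> S k"
        then show "r k \<le> dist x y"
          using infdist_le[of x F y] by (auto simp: S_def dist_commute)
      qed
      also have "\<dots> \<le> hausdorff d T" by (rule hausdorff_mono) (auto simp: S_def)
      finally show ?thesis by (simp add: add_right_mono)
    qed
    moreover have "(\<lambda>k. hausdorff d T + (\<Sum>i. hausdorff d (R (i + k)))) \<longlonglongrightarrow> hausdorff d T + 0"
      by (intro tendsto_add tendsto_const tail)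
    ultimately show ?thesis
      by (intro LIMSEQ_le_const[where X="\<lambda>k. hausdorff d T + (\<Sum>i. hausdorff d (R (i + k)))"]) auto
  qed
qed

lemma sets_surface_measure [simp]: "sets (surface_measure d M) = sets borel"
  by (simp add: surface_measure_def sigma_algebra.sets_measure_of_eq[OF sets.sigma_algebra_axioms[of borel, unfolded space_borel]])

lemma emeasure_surface_measure:
  fixes M :: "'a::metric_space set"
  assumes "B \<in> sets borel"
  shows "emeasure (surface_measure d M) B = hausdorff d (B \<inter> M)"
proof -
  let ?h = "\<lambda>B. hausdorff d (B \<inter> M)"
  interpret sigma_algebra "UNIV :: 'a set" "Pow UNIV" by (rule sigma_algebra_Pow)
  have "outer_measure_space (Pow UNIV) ?h"
    unfolding outer_measure_space_def positive_def increasing_def countably_subadditive_def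
    by (auto simp: hausdorff_empty intro!: hausdorff_mono
        order_trans[OF _ hausdorff_countably_subadditive])
  then have ms: "measure_space UNIV (lambda_system UNIV (Pow UNIV) ?h) ?h"
    by (rule caratheodory_lemma)
  then have sa: "sigma_algebra UNIV (lambda_system UNIV (Pow UNIV) ?h)"
    by (simp add: measure_space_def)
  have "F \<in> lambda_system UNIV (Pow UNIV) ?h" if "closed F" for F
  proof -
    have "hausdorff d (T \<inter> F \<inter> M) + hausdorff d ((T - F) \<inter> M) = hausdorff d (T \<inter> M)" for T
    proof -
      have "T \<inter> F \<inter> M = (T \<inter> M) \<inter> F" "(T - F) \<inter> M = T \<inter> M - F" by auto
      then show ?thesis by (simp only: hausdorff_split_closed[OF that])
    qed
    then show ?thesis unfolding lambda_system_eq by simp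
  qed
  then have sub: "sets borel \<subseteq> lambda_system UNIV (Pow UNIV) ?h"
    unfolding borel_eq_closed using sigma_algebra.sigma_sets_subset[OF sa, of "Collect closed"]
    by (auto simp: sets_measure_of)
  have "measure_space UNIV (sets borel) ?h"
    using ms sub sets.sigma_algebra_axioms[of "borel :: 'a measure"]
    by (auto simp: measure_space_def positive_def countably_additive_def)
  then show ?thesis
    unfolding surface_measure_def using assms
    by (intro emeasure_measure_of_sigma) (auto simp: measure_space_def)
qed


section \<open>Submanifolds and the operators attached to defining functions\<close>

text \<open>\<open>n\<^sub>j = d\<rho>\<^sub>j\<close> and \<open>F\<^sub>j = d n\<^sub>j\<^sup>#\<close>.\<close>

definition conormal :: "(nat \<Rightarrow> real^'n::{finite,linorder} \<Rightarrow> real) \<Rightarrow> nat \<Rightarrow> 'n superform" where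
  "conormal \<rho> j = sd (\<lambda>x. scalar (\<rho> j x))"

definition Fform :: "(nat \<Rightarrow> real^'n::{finite,linorder} \<Rightarrow> real) \<Rightarrow> nat \<Rightarrow> 'n superform" where
  "Fform \<rho> j = sd (\<lambda>x. Jop (conormal \<rho> j x))"

definition smooth_submanifold :: "nat \<Rightarrow> (real^'n::{finite,linorder}) set \<Rightarrow> bool" where
  "smooth_submanifold p M \<longleftrightarrow> (\<forall>x\<in>M. \<exists>V \<rho>. open V \<and> x \<in> V \<and>
     (\<forall>j\<in>{1..p}. smooth_on V (\<rho> j)) \<and>
     M \<inter> V = {y\<in>V. \<forall>j\<in>{1..p}. \<rho> j y = 0} \<and>
     (\<forall>y\<in>M \<inter> V. \<forall>c. (\<Sum>j=1..p. c j *\<^sub>R conormal \<rho> j y) = 0 \<longrightarrow> (\<forall>j\<in>{1..p}. c j = 0)))"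

definition orthonormal_defining_functions ::
    "nat \<Rightarrow> (real^'n::{finite,linorder}) set \<Rightarrow> (real^'n::{finite,linorder}) set \<Rightarrow> (nat \<Rightarrow> real^'n::{finite,linorder} \<Rightarrow> real) \<Rightarrow> bool" where
  "orthonormal_defining_functions p M U \<rho> \<longleftrightarrow> open U \<and>
     (\<forall>j\<in>{1..p}. smooth_on U (\<rho> j)) \<and>
     M \<inter> U = {y\<in>U. \<forall>j\<in>{1..p}. \<rho> j y = 0} \<and>
     (\<forall>y\<in>M \<inter> U. \<forall>i\<in>{1..p}. \<forall>j\<in>{1..p}.
        conormal \<rho> i y \<bullet> conormal \<rho> j y = (if i = j then 1 else 0))"

definition normal_form :: "nat \<Rightarrow> (nat \<Rightarrow> real^'n::{finite,linorder} \<Rightarrow> real) \<Rightarrow> 'n superform" where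
  "normal_form p \<rho> = (\<lambda>x. foldr (\<lambda>j b. conormal \<rho> j x \<and>\<^sub>s b) [1..<Suc p] (scalar 1))"

text \<open>The supercurrent \<open>[M]\<^sub>s = c\<^sub>p n \<and> n\<^sup># * dS\<^sub>M\<close>.\<close>

definition Ms_current ::
    "nat \<Rightarrow> (real^'n::{finite,linorder}) set \<Rightarrow> (nat \<Rightarrow> real^'n::{finite,linorder} \<Rightarrow> real) \<Rightarrow> 'n supercurrent" where
  "Ms_current p M \<rho> = wedge_current
     (\<lambda>x. (-1) ^ (p * (p - 1) div 2) *\<^sub>R (normal_form p \<rho> x \<and>\<^sub>s Jop (normal_form p \<rho> x)))
     (star_measure (surface_measure (CARD('n) - p) M))"

text \<open>Equality of superforms on \<open>U\<close> as forms on \<open>M\<^sub>s\<close>.\<close>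

definition eq_on_Ms ::
    "nat \<Rightarrow> (real^'n::{finite,linorder}) set \<Rightarrow> (real^'n::{finite,linorder}) set \<Rightarrow> (nat \<Rightarrow> real^'n::{finite,linorder} \<Rightarrow> real) \<Rightarrow>
      'n superform \<Rightarrow> 'n superform \<Rightarrow> bool" where
  "eq_on_Ms p M U \<rho> a b \<longleftrightarrow>
     eq_current_on U (wedge_current a (Ms_current p M \<rho>)) (wedge_current b (Ms_current p M \<rho>))"

text \<open>
  \<open>b\<close> represents the form on \<open>M\<^sub>s\<close> given by \<open>a\<close> and has no normal components. The latter is
  only asked at points of \<open>M\<close>, where it determines \<open>b\<close>.
\<close>

definition canonical_extension ::
    "nat \<Rightarrow> (real^'n::{finite,linorder}) set \<Rightarrow> (real^'n::{finite,linorder}) set \<Rightarrow> (nat \<Rightarrow> real^'n::{finite,linorder} \<Rightarrow> real) \<Rightarrow>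
      'n superform \<Rightarrow> 'n superform \<Rightarrow> bool" where
  "canonical_extension p M U \<rho> a b \<longleftrightarrow> smooth_on U b \<and> eq_on_Ms p M U \<rho> b a \<and>
     (\<forall>x\<in>M \<inter> U. \<forall>j\<in>{1..p}.
        conormal \<rho> j x \<rfloor> b x = 0 \<and> Jop (conormal \<rho> j x) \<rfloor> b x = 0)"

definition D_sharp ::
    "nat \<Rightarrow> (nat \<Rightarrow> real^'n::{finite,linorder} \<Rightarrow> real) \<Rightarrow> 'n superform \<Rightarrow> 'n superform" where
  "D_sharp p \<rho> b =
     (\<lambda>x. sd_sharp b x + (\<Sum>j=1..p. Fform \<rho> j x \<and>\<^sub>s (conormal \<rho> j x \<rfloor> b x)))"

definition curvature_form ::
    "nat \<Rightarrow> (nat \<Rightarrow> real^'n::{finite,linorder} \<Rightarrow> real) \<Rightarrow> 'n superform" where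
  "curvature_form p \<rho> = (\<lambda>x. (1/2) *\<^sub>R (\<Sum>j=1..p. Fform \<rho> j x \<and>\<^sub>s Fform \<rho> j x))"

end

theory Submission
  imports Defs
begin

text \<open>
  In \<open>(D\<^sup>#)\<^sup>2 a\<close> all derivatives of the coefficients of \<open>a\<close> cancel, and on all of \<open>U\<close>
  \<open>(D\<^sup>#)\<^sup>2 a = a \<rfloor> R + \<Sum>\<^sub>i\<^sub>j (n\<^sub>i \<bullet> a) F\<^sub>j \<and> (n\<^sub>j \<rfloor> F\<^sub>i)\<close>.
  Differentiating \<open>n\<^sub>i \<bullet> n\<^sub>j = \<delta>\<^sub>i\<^sub>j\<close> along \<open>M\<close> shows that \<open>n\<^sub>i \<rfloor> F\<^sub>j + n\<^sub>j \<rfloor> F\<^sub>i\<close> is on \<open>M\<close> a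
  combination of the \<open>n\<^sub>s\<^sup>#\<close>, which \<open>n \<and> n\<^sup>#\<close> annihilates. Hence, if \<open>b\<close> is the canonical
  extension of \<open>a\<close>, the difference of the two sides wedged with \<open>n \<and> n\<^sup>#\<close> is
  \<open>(c\<^sub>T \<rfloor> R) \<and> n \<and> n\<^sup>#\<close> for the tangential part \<open>c\<^sub>T\<close> of \<open>c = a - b\<close>. As \<open>c\<^sub>T\<close> is a linear function of
  \<open>c \<and> n \<and> n\<^sup>#\<close> with smooth coefficients, the vanishing of the current \<open>c \<and> [M]\<^sub>s\<close>, tested against
  smooth multiples of a given test function, is all that is needed.

  The Bochner integral of a function that is not integrable is \<open>0\<close>, so integrals may only be
  combined linearly once the surface measure of \<open>M\<close> is known to be finite on compact subsets of
  \<open>U\<close>; this is proved by covering graphs over the tangent space by grids.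
\<close>


section \<open>Calculus of smooth functions\<close>

text \<open>The obstacle is that the canonical extension \<open>b\<close> agrees with
  \<open>a\<close> only as a current. Making this pointwise along \<open>M\<close> would require
  surface measure to charge every nonempty relatively open piece of \<open>M\<close>, a lower bound
  on Hausdorff measure. Carrying \<open>a - b\<close> through the formula instead leaves only upper
  bounds on the measure to be proved. Derivatives cancel in \<open>(D\<^sup>#)\<^sup>2 a\<close>
  because they enter through coefficients of \<open>d\<xi>\<^sub>m \<and> d\<xi>\<^sub>l\<close>
  that are symmetric in m and l: second derivatives of \<open>a\<close>, third derivatives of the
  defining functions, and products of a derivative of \<open>n\<^sub>j \<bullet> a\<close> with a
  Hessian entry. The normals are orthonormal on \<open>M\<close> alone, so their products may be
  differentiated in tangent directions only. \<open>M\<close> is given by equations and is never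
  parametrised: points of \<open>M\<close> in a prescribed tangent direction come from an open
  mapping argument, and the grid covering uses only that tangential coordinates control distances
  between points of \<open>M\<close>.\<close>

lemma partial_eq: "(f has_derivative D) (at x) \<Longrightarrow> partial k f x = D (axis k 1)"
  by (simp add: partial_def frechet_derivative_at[symmetric])

lemma partial_linear:
  assumes "f differentiable (at x)" "bounded_linear L"
  shows "partial k (\<lambda>x. L (f x)) x = L (partial k f x)"
proof -
  have "((\<lambda>x. L (f x)) has_derivative (\<lambda>h. L (frechet_derivative f (at x) h))) (at x)"
    using bounded_linear.has_derivative[OF assms(2) frechet_derivative_works[THEN iffD1, OF assms(1)]] .
  from partial_eq[OF this] show ?thesis by (simp add: partial_def)
qed

lemma partial_bilinear:
  assumes "f differentiable (at x)" "g differentiable (at x)" "bounded_bilinear B"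
  shows "partial k (\<lambda>x. B (f x) (g x)) x = B (partial k f x) (g x) + B (f x) (partial k g x)"
proof -
  have "((\<lambda>x. B (f x) (g x)) has_derivative
      (\<lambda>h. B (f x) (frechet_derivative g (at x) h) + B (frechet_derivative f (at x) h) (g x))) (at x)"
    by (rule bounded_bilinear.FDERIV[OF assms(3)])
      (use assms frechet_derivative_works in blast)+
  from partial_eq[OF this] show ?thesis by (simp add: partial_def)
qed

lemma partial_sum:
  assumes "\<And>i. i \<in> A \<Longrightarrow> f i differentiable (at x)"
  shows "partial k (\<lambda>x. \<Sum>i\<in>A. f i x) x = (\<Sum>i\<in>A. partial k (f i) x)"
proof -
  have "((\<lambda>x. \<Sum>i\<in>A. f i x) has_derivative (\<lambda>h. \<Sum>i\<in>A. frechet_derivative (f i) (at x) h)) (at x)"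
    by (rule has_derivative_sum) (use assms frechet_derivative_works in blast)
  from partial_eq[OF this] show ?thesis by (simp add: partial_def)
qed

lemma partial_add:
  assumes "f differentiable (at x)" "g differentiable (at x)"
  shows "partial k (\<lambda>x. f x + g x) x = partial k f x + partial k g x"
proof -
  have "((\<lambda>x. f x + g x) has_derivative
      (\<lambda>h. frechet_derivative f (at x) h + frechet_derivative g (at x) h)) (at x)"
    by (rule has_derivative_add) (use assms frechet_derivative_works in blast)+
  from partial_eq[OF this] show ?thesis by (simp add: partial_def)
qed

lemma differentiable_linear:
  "bounded_linear L \<Longrightarrow> f differentiable (at x) \<Longrightarrow> (\<lambda>x. L (f x)) differentiable (at x)"
  unfolding differentiable_def by (blast dest: bounded_linear.has_derivative)

lemma differentiable_bilinear:
  "bounded_bilinear B \<Longrightarrow> f differentiable (at x) \<Longrightarrow> g differentiable (at x) \<Longrightarrow>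
    (\<lambda>x. B (f x) (g x)) differentiable (at x)"
  unfolding differentiable_def by (blast dest: bounded_bilinear.FDERIV)

lemma differentiable_cong_open:
  assumes "open U" "x \<in> U" "\<And>y. y \<in> U \<Longrightarrow> f y = g y" "f differentiable (at x)"
  shows "g differentiable (at x)"
  using assms unfolding differentiable_def by (meson has_derivative_transform_within_open)

lemma partial_cong_open:
  assumes "open U" "x \<in> U" "\<And>y. y \<in> U \<Longrightarrow> f y = g y"
  shows "partial k f x = partial k g x"
proof -
  have "(f has_derivative D) (at x) \<longleftrightarrow> (g has_derivative D) (at x)" for D
    using assms by (metis has_derivative_transform_within_open)
  then show ?thesis unfolding partial_def frechet_derivative_def by simp
qed

section \<open>Closure properties of smooth functions\<close>

text \<open>\<open>smooth_on\<close> quantifies over all orders at once and offers no induction.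
  Bounding the order does: by the Leibniz rule a derivative of a product is a sum of products whose
  factors are smooth up to one order less.\<close>

definition smooth_upto :: "nat \<Rightarrow> (real^'n::finite) set \<Rightarrow> (real^'n \<Rightarrow> 'b::real_normed_vector) \<Rightarrow> bool" where
  "smooth_upto m U f \<longleftrightarrow> (\<forall>ks. length ks \<le> m \<longrightarrow> (\<forall>x\<in>U. foldr partial ks f differentiable (at x)))"

lemma smooth_on_upto: "smooth_on U f \<longleftrightarrow> (\<forall>m. smooth_upto m U f)"
  unfolding smooth_on_def smooth_upto_def by auto

lemma smooth_upto_0: "smooth_upto 0 U f \<longleftrightarrow> (\<forall>x\<in>U. f differentiable (at x))"
  unfolding smooth_upto_def by auto

text \<open>\<open>foldr\<close> applies the last list entry first, so the innermost derivative sits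
  at the right end of the list; hence \<open>ks @ [k]\<close> and \<open>rev_cases\<close>.\<close>

lemma smooth_upto_Suc:
  "smooth_upto (Suc m) U f \<longleftrightarrow> (\<forall>x\<in>U. f differentiable (at x)) \<and> (\<forall>k. smooth_upto m U (partial k f))"
proof (intro iffI conjI allI)
  assume f: "smooth_upto (Suc m) U f"
  show "\<forall>x\<in>U. f differentiable (at x)" using f[unfolded smooth_upto_def, rule_format, of "[]"] by simp
  show "smooth_upto m U (partial k f)" for k
    unfolding smooth_upto_def
  proof (intro allI impI)
    fix ks :: "'a list" assume "length ks \<le> m"
    then show "\<forall>x\<in>U. foldr partial ks (partial k f) differentiable (at x)"
      using f[unfolded smooth_upto_def, rule_format, of "ks @ [k]"] by simp
  qed
next
  assume f: "(\<forall>x\<in>U. f differentiable (at x)) \<and> (\<forall>k. smooth_upto m U (partial k f))"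
  show "smooth_upto (Suc m) U f"
    unfolding smooth_upto_def
  proof (intro allI impI)
    fix ks :: "'a list" assume l: "length ks \<le> Suc m"
    show "\<forall>x\<in>U. foldr partial ks f differentiable (at x)"
    proof (cases ks rule: rev_cases)
      case Nil
      then show ?thesis using f by simp
    next
      case (snoc ks' k)
      then show ?thesis using f l unfolding smooth_upto_def by simp
    qed
  qed
qed

lemma smooth_upto_lower: "smooth_upto (Suc m) U f \<Longrightarrow> smooth_upto m U f"
  unfolding smooth_upto_def by auto

lemma smooth_upto_differentiable: "smooth_upto m U f \<Longrightarrow> x \<in> U \<Longrightarrow> f differentiable (at x)"
  unfolding smooth_upto_def by (metis foldr.simps(1) id_apply le0 list.size(3))

text \<open>Derivatives of sums and products are computed at points of \<open>U\<close> only; since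
  \<open>U\<close> is open, such an identity can be differentiated again.\<close>

lemma smooth_upto_cong:
  assumes "open U"
  shows "(\<And>x. x \<in> U \<Longrightarrow> f x = g x) \<Longrightarrow> smooth_upto m U f \<Longrightarrow> smooth_upto m U g"
proof (induction m arbitrary: f g)
  case 0
  then show ?case unfolding smooth_upto_0 using differentiable_cong_open[OF assms] by metis
next
  case (Suc m)
  have "smooth_upto m U (partial k g)" for k
    by (rule Suc.IH[of "partial k f"])
      (use Suc.prems partial_cong_open[OF assms _ Suc.prems(1)] in \<open>auto simp: smooth_upto_Suc\<close>)
  then show ?case using Suc.prems unfolding smooth_upto_Suc
    using differentiable_cong_open[OF assms] by metis
qed

lemma smooth_upto_add:
  assumes "open U"
  shows "smooth_upto m U f \<Longrightarrow> smooth_upto m U g \<Longrightarrow> smooth_upto m U (\<lambda>x. f x + g x)"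
proof (induction m arbitrary: f g)
  case 0
  then show ?case unfolding smooth_upto_0 by (auto intro: differentiable_add)
next
  case (Suc m)
  have "smooth_upto m U (partial k (\<lambda>x. f x + g x))" for k
    by (rule smooth_upto_cong[OF assms, of "\<lambda>x. partial k f x + partial k g x"])
      (use Suc in \<open>auto simp: smooth_upto_Suc partial_add\<close>)
  then show ?case using Suc.prems unfolding smooth_upto_Suc by (auto intro: differentiable_add)
qed

lemma smooth_upto_linear:
  assumes "open U" "bounded_linear L"
  shows "smooth_upto m U f \<Longrightarrow> smooth_upto m U (\<lambda>x. L (f x))"
proof (induction m arbitrary: f)
  case 0
  then show ?case unfolding smooth_upto_0 by (auto intro: differentiable_linear assms)
next
  case (Suc m)
  have "smooth_upto m U (partial k (\<lambda>x. L (f x)))" for k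
    by (rule smooth_upto_cong[OF assms(1), of "\<lambda>x. L (partial k f x)"])
      (use Suc in \<open>auto simp: smooth_upto_Suc partial_linear assms(2)\<close>)
  then show ?case using Suc.prems unfolding smooth_upto_Suc by (auto intro: differentiable_linear assms)
qed

lemma smooth_upto_bilinear:
  assumes "open U" "bounded_bilinear B"
  shows "smooth_upto m U f \<Longrightarrow> smooth_upto m U g \<Longrightarrow> smooth_upto m U (\<lambda>x. B (f x) (g x))"
proof (induction m arbitrary: f g)
  case 0
  then show ?case unfolding smooth_upto_0 by (auto intro: differentiable_bilinear assms)
next
  case (Suc m)
  have "smooth_upto m U (partial k (\<lambda>x. B (f x) (g x)))" for k
  proof (rule smooth_upto_cong[OF assms(1), of "\<lambda>x. B (partial k f x) (g x) + B (f x) (partial k g x)"])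
    show "B (partial k f x) (g x) + B (f x) (partial k g x) = partial k (\<lambda>x. B (f x) (g x)) x" if "x \<in> U" for x
      using partial_bilinear[OF _ _ assms(2)] smooth_upto_differentiable[OF _ that] Suc.prems by metis
    show "smooth_upto m U (\<lambda>x. B (partial k f x) (g x) + B (f x) (partial k g x))"
      using Suc.prems by (intro smooth_upto_add[OF assms(1)] Suc.IH smooth_upto_lower[OF Suc.prems(1)] smooth_upto_lower[OF Suc.prems(2)])
        (simp_all add: smooth_upto_Suc)
  qed
  then show ?case using Suc.prems unfolding smooth_upto_Suc by (auto intro: differentiable_bilinear assms)
qed

lemma smooth_upto_const: "smooth_upto m U (\<lambda>x. c)"
proof (induction m arbitrary: c)
  case 0
  then show ?case unfolding smooth_upto_0 by auto
next
  case (Suc m)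
  have "partial k (\<lambda>x. c) = (\<lambda>x::real^'a. 0)" for k
    unfolding partial_def by simp
  then show ?case unfolding smooth_upto_Suc using Suc by auto
qed

lemma smooth_on_differentiable: "smooth_on U f \<Longrightarrow> x \<in> U \<Longrightarrow> f differentiable (at x)"
  using smooth_upto_differentiable[of 0 U f x] unfolding smooth_on_upto by simp

lemma smooth_on_continuous: "smooth_on U f \<Longrightarrow> continuous_on U f"
  by (intro continuous_at_imp_continuous_on ballI differentiable_imp_continuous_within smooth_on_differentiable)

lemma smooth_on_partial: "smooth_on U f \<Longrightarrow> smooth_on U (partial k f)"
  unfolding smooth_on_upto using smooth_upto_Suc[of _ U f] by simp

lemma smooth_on_cong:
  "open U \<Longrightarrow> (\<And>x. x \<in> U \<Longrightarrow> f x = g x) \<Longrightarrow> smooth_on U f \<Longrightarrow> smooth_on U g"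
  unfolding smooth_on_upto using smooth_upto_cong[of U f g] by simp

lemma smooth_on_const: "smooth_on U (\<lambda>x. c)"
  unfolding smooth_on_upto by (intro allI smooth_upto_const)

lemma smooth_on_add:
  "open U \<Longrightarrow> smooth_on U f \<Longrightarrow> smooth_on U g \<Longrightarrow> smooth_on U (\<lambda>x. f x + g x)"
  unfolding smooth_on_upto by (intro allI smooth_upto_add) simp_all

lemma smooth_on_linear:
  "open U \<Longrightarrow> bounded_linear L \<Longrightarrow> smooth_on U f \<Longrightarrow> smooth_on U (\<lambda>x. L (f x))"
  unfolding smooth_on_upto using smooth_upto_linear[of U L _ f] by simp

lemma smooth_on_bilinear:
  "open U \<Longrightarrow> bounded_bilinear B \<Longrightarrow> smooth_on U f \<Longrightarrow> smooth_on U g \<Longrightarrow> smooth_on U (\<lambda>x. B (f x) (g x))"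
  unfolding smooth_on_upto using smooth_upto_bilinear[of U B _ f g] by simp

lemma smooth_on_sum:
  assumes "open U" "\<And>i. i \<in> A \<Longrightarrow> smooth_on U (f i)"
  shows "smooth_on U (\<lambda>x. \<Sum>i\<in>A. f i x)"
  using assms(2)
proof (induction A rule: infinite_finite_induct)
  case (insert i A)
  then show ?case using smooth_on_add[OF assms(1), of "f i" "\<lambda>x. \<Sum>i\<in>A. f i x"] by auto
qed (auto simp: smooth_on_const)

lemma smooth_on_Un: "smooth_on (A \<union> B) f \<longleftrightarrow> smooth_on A f \<and> smooth_on B f"
  unfolding smooth_on_def by auto

lemma smooth_on_subset: "smooth_on A f \<Longrightarrow> B \<subseteq> A \<Longrightarrow> smooth_on B f"
  unfolding smooth_on_def by auto

section \<open>Equality of mixed partial derivatives\<close>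

text \<open>The mean value theorem twice: along \<open>k\<close> for the increment of
  \<open>f\<close> in direction \<open>l\<close>, then along \<open>l\<close> for
  \<open>partial k f\<close>. The quotient becomes \<open>partial l (partial k f)\<close> at an
  intermediate point, and this derivative is continuous.\<close>

lemma mixed_difference_quotient:
  fixes f :: "real^'n::finite \<Rightarrow> real"
  assumes "open U" "x \<in> U" "smooth_on U f" "0 < e"
  obtains d where "0 < d" "\<And>t. 0 < t \<Longrightarrow> t < d \<Longrightarrow>
    \<bar>(f (x + t *\<^sub>R axis k 1 + t *\<^sub>R axis l 1) - f (x + t *\<^sub>R axis k 1) - f (x + t *\<^sub>R axis l 1) + f x) / t\<^sup>2
      - partial l (partial k f) x\<bar> < e"
proof -
  let ?k = "axis k 1 :: real^'n" and ?l = "axis l 1 :: real^'n"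
  have "continuous (at x) (partial l (partial k f))"
    using smooth_on_continuous[OF smooth_on_partial[OF smooth_on_partial[OF assms(3)]]] assms(1,2)
    by (simp add: continuous_on_eq_continuous_at)
  then obtain d1 where d1: "0 < d1" "\<And>y. dist y x < d1 \<Longrightarrow>
      \<bar>partial l (partial k f) y - partial l (partial k f) x\<bar> < e"
    using assms(4) unfolding continuous_at_eps_delta dist_real_def by metis
  obtain d2 where d2: "0 < d2" "ball x d2 \<subseteq> U" using assms(1,2) openE by metis
  \<comment> \<open>Steps shorter than \<open>d\<close> in each of the two directions add up to less
    than \<open>2 * d\<close>.\<close>
  define d where "d = min d1 d2 / 2"
  have near: "dist (x + s *\<^sub>R ?k + t *\<^sub>R ?l) x < min d1 d2" if "0 \<le> s" "s < d" "0 \<le> t" "t < d" for s t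
  proof -
    have "dist (x + s *\<^sub>R ?k + t *\<^sub>R ?l) x = norm (s *\<^sub>R ?k + t *\<^sub>R ?l)" by (simp add: dist_norm add.assoc)
    also have "\<dots> \<le> s + t" using norm_triangle_ineq[of "s *\<^sub>R ?k" "t *\<^sub>R ?l"] that by simp
    finally show ?thesis using that unfolding d_def by simp
  qed
  have inU: "x + s *\<^sub>R ?k + t *\<^sub>R ?l \<in> U" if "0 \<le> s" "s < d" "0 \<le> t" "t < d" for s t
    using near[OF that] d2 by (auto simp: dist_commute subset_eq)
  have dir: "((\<lambda>s. g (y + s *\<^sub>R axis i 1)) has_real_derivative partial i g (y + s *\<^sub>R axis i 1)) (at s)"
    if "g differentiable (at (y + s *\<^sub>R axis i 1))" for g :: "real^'n \<Rightarrow> real" and y i s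
  proof -
    have "(g has_derivative frechet_derivative g (at (y + s *\<^sub>R axis i 1))) (at (y + s *\<^sub>R axis i 1))"
      using that frechet_derivative_works by blast
    then have g: "(g has_derivative frechet_derivative g (at (y + s *\<^sub>R axis i 1)))
        (at ((\<lambda>s. y + s *\<^sub>R axis i 1) s))" by simp
    have "((\<lambda>s. y + s *\<^sub>R axis i 1) has_derivative (\<lambda>h. h *\<^sub>R axis i 1)) (at s)"
      by (auto intro!: derivative_eq_intros)
    from has_derivative_compose[OF this g] have
      "((\<lambda>s. g (y + s *\<^sub>R axis i 1)) has_derivative
        (\<lambda>h. frechet_derivative g (at (y + s *\<^sub>R axis i 1)) (h *\<^sub>R axis i 1))) (at s)" .
    moreover have "frechet_derivative g (at (y + s *\<^sub>R axis i 1)) (h *\<^sub>R axis i 1) =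
        h * partial i g (y + s *\<^sub>R axis i 1)" for h
      unfolding partial_def using linear_frechet_derivative[OF that] by (simp add: linear_cmul)
    ultimately show ?thesis unfolding has_field_derivative_def by (simp add: mult.commute[of "partial i g _", abs_def])
  qed
  have fd: "f differentiable (at y)" "partial k f differentiable (at y)" if "y \<in> U" for y
    using smooth_on_differentiable[OF assms(3) that] smooth_on_differentiable[OF smooth_on_partial[OF assms(3)] that] by simp_all
  show ?thesis
  proof (rule that[of d])
    show "0 < d" using d1 d2 unfolding d_def by simp
    fix t :: real assume t: "0 < t" "t < d"
    define h where "h = (\<lambda>s. f (x + t *\<^sub>R ?l + s *\<^sub>R ?k) - f (x + s *\<^sub>R ?k))"
    have hd: "(h has_real_derivative
        (partial k f (x + t *\<^sub>R ?l + s *\<^sub>R ?k) - partial k f (x + s *\<^sub>R ?k))) (at s)" if "0 \<le> s" "s \<le> t" for s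
      unfolding h_def using that t inU[of s t] inU[of s 0]
      by (intro DERIV_diff dir fd) (auto simp: add_ac)
    obtain s where s: "0 < s" "s < t" and hs: "h t - h 0 = (t - 0) *
        (partial k f (x + t *\<^sub>R ?l + s *\<^sub>R ?k) - partial k f (x + s *\<^sub>R ?k))"
      using MVT2[OF t(1) hd] by auto
    have pd: "((\<lambda>r. partial k f (x + s *\<^sub>R ?k + r *\<^sub>R ?l)) has_real_derivative
        partial l (partial k f) (x + s *\<^sub>R ?k + r *\<^sub>R ?l)) (at r)" if "0 \<le> r" "r \<le> t" for r
      using s t that by (intro dir fd inU) auto
    obtain r where r: "0 < r" "r < t" and hr: "partial k f (x + s *\<^sub>R ?k + t *\<^sub>R ?l) - partial k f (x + s *\<^sub>R ?k + 0 *\<^sub>R ?l) =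
        (t - 0) * partial l (partial k f) (x + s *\<^sub>R ?k + r *\<^sub>R ?l)"
      using MVT2[OF t(1) pd] by auto
    have "f (x + t *\<^sub>R ?k + t *\<^sub>R ?l) - f (x + t *\<^sub>R ?k) - f (x + t *\<^sub>R ?l) + f x = h t - h 0"
      unfolding h_def by (simp add: algebra_simps)
    also have "\<dots> = t\<^sup>2 * partial l (partial k f) (x + s *\<^sub>R ?k + r *\<^sub>R ?l)"
      using hs hr by (simp add: algebra_simps power2_eq_square)
    finally have "(f (x + t *\<^sub>R ?k + t *\<^sub>R ?l) - f (x + t *\<^sub>R ?k) - f (x + t *\<^sub>R ?l) + f x) / t\<^sup>2 =
        partial l (partial k f) (x + s *\<^sub>R ?k + r *\<^sub>R ?l)" using t by simp
    then show "\<bar>(f (x + t *\<^sub>R ?k + t *\<^sub>R ?l) - f (x + t *\<^sub>R ?k) - f (x + t *\<^sub>R ?l) + f x) / t\<^sup>2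
      - partial l (partial k f) x\<bar> < e"
      using d1(2) near[of s r] s r t by simp
  qed
qed

text \<open>The second difference quotient does not change when \<open>k\<close> and
  \<open>l\<close> are exchanged, yet for small \<open>t\<close> it is close to both mixed
  derivatives.\<close>

lemma partial_commute:
  fixes f :: "real^'n::finite \<Rightarrow> real"
  assumes "open U" "x \<in> U" "smooth_on U f"
  shows "partial k (partial l f) x = partial l (partial k f) x"
proof (rule ccontr)
  define e where "e = \<bar>partial k (partial l f) x - partial l (partial k f) x\<bar> / 2"
  assume "\<not> ?thesis"
  then have e: "0 < e" unfolding e_def by simp
  let ?D = "\<lambda>k l t. (f (x + t *\<^sub>R axis k 1 + t *\<^sub>R axis l 1) - f (x + t *\<^sub>R axis k 1) - f (x + t *\<^sub>R axis l 1) + f x) / t\<^sup>2"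
  obtain d1 where d1: "0 < d1" "\<And>t. 0 < t \<Longrightarrow> t < d1 \<Longrightarrow> \<bar>?D k l t - partial l (partial k f) x\<bar> < e"
    using mixed_difference_quotient[OF assms e] by blast
  obtain d2 where d2: "0 < d2" "\<And>t. 0 < t \<Longrightarrow> t < d2 \<Longrightarrow> \<bar>?D l k t - partial k (partial l f) x\<bar> < e"
    using mixed_difference_quotient[OF assms e] by blast
  define t where "t = min d1 d2 / 2"
  have t: "0 < t" "t < d1" "t < d2" using d1 d2 unfolding t_def by auto
  have "?D l k t = ?D k l t" by (simp add: algebra_simps)
  then have "\<bar>partial k (partial l f) x - partial l (partial k f) x\<bar> < 2 * e"
    using d1(2)[OF t(1,2)] d2(2)[OF t(1,3)] by linarith
  then show False unfolding e_def by simp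
qed


section \<open>Exterior algebra\<close>

lemma inversions_Un_left:
  fixes I K L :: "'n::{finite,linorder} set"
  assumes "I \<inter> K = {}"
  shows "inversions (I \<union> K) L = inversions I L + inversions K L"
proof -
  have "{(i, k). i \<in> I \<union> K \<and> k \<in> L \<and> k < i} =
      {(i, k). i \<in> I \<and> k \<in> L \<and> k < i} \<union> {(i, k). i \<in> K \<and> k \<in> L \<and> k < i}" by auto
  then show ?thesis unfolding inversions_def using assms
    by (simp add: card_Un_disjoint disjoint_iff)
qed

lemma inversions_Un_right:
  fixes I K L :: "'n::{finite,linorder} set"
  assumes "K \<inter> L = {}"
  shows "inversions I (K \<union> L) = inversions I K + inversions I L"
proof -
  have "{(i, k). i \<in> I \<and> k \<in> K \<union> L \<and> k < i} =
      {(i, k). i \<in> I \<and> k \<in> K \<and> k < i} \<union> {(i, k). i \<in> I \<and> k \<in> L \<and> k < i}" by auto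
  then show ?thesis unfolding inversions_def using assms
    by (simp add: card_Un_disjoint disjoint_iff)
qed

lemma inversions_empty [simp]: "inversions {} K = 0" "inversions I {} = 0"
  by (simp_all add: inversions_def)

lemma inversions_insert_right:
  fixes I :: "'n::{finite,linorder} set"
  shows "k \<notin> I \<Longrightarrow> inversions {r} (insert k I) = inversions {r} I + (if k < r then 1 else 0)"
proof -
  assume "k \<notin> I"
  then have "inversions {r} ({k} \<union> I) = inversions {r} {k} + inversions {r} I"
    by (intro inversions_Un_right) auto
  moreover have "{(i, j). i = r \<and> j = k \<and> j < i} = (if k < r then {(r, k)} else {})" by auto
  ultimately show ?thesis by (simp add: inversions_def)
qed

text \<open>Inversion counts and cardinalities are additive over disjoint unions, so the two
  exponents agree as natural numbers and not merely in parity.\<close>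

lemma swap_sign_assoc:
  fixes I J K L P Q :: "'n::{finite,linorder} set"
  assumes "I \<inter> K = {}" "I \<inter> P = {}" "K \<inter> P = {}" "J \<inter> L = {}" "J \<inter> Q = {}" "L \<inter> Q = {}"
  shows "swap_sign (I \<union> K) (J \<union> L) P Q * swap_sign I J K L =
    swap_sign I J (K \<union> P) (L \<union> Q) * swap_sign K L P Q"
  unfolding swap_sign_def power_add[symmetric] inversions_Un_left[OF assms(1)] inversions_Un_left[OF assms(4)]
    inversions_Un_right[OF assms(3)] inversions_Un_right[OF assms(6)]
    card_Un_disjoint[OF finite finite assms(3)] card_Un_disjoint[OF finite finite assms(4)]
  by (rule arg_cong[where f="\<lambda>n. (-1) ^ n"]) (simp add: algebra_simps)

text \<open>Both sides run over the ordered partitions of \<open>A\<close> into three parts; the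
  outer sum splits off the last part on the left and the first part on the right.\<close>

lemma sum_Pow_Pow_swap:
  fixes f :: "'a set \<Rightarrow> 'a set \<Rightarrow> 'a set \<Rightarrow> 'b::comm_monoid_add"
  assumes "finite A"
  shows "(\<Sum>I\<in>Pow A. \<Sum>I'\<in>Pow I. f I' (I - I') (A - I)) =
    (\<Sum>I\<in>Pow A. \<Sum>K\<in>Pow (A - I). f I K (A - I - K))"
proof -
  have "(\<Sum>I\<in>Pow A. \<Sum>I'\<in>Pow I. f I' (I - I') (A - I)) =
      (\<Sum>(I, I')\<in>Sigma (Pow A) Pow. f I' (I - I') (A - I))"
    using assms by (subst sum.Sigma) (auto intro: finite_subset)
  also have "\<dots> = (\<Sum>(I, K)\<in>Sigma (Pow A) (\<lambda>I. Pow (A - I)). f I K (A - I - K))"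
    by (rule sum.reindex_bij_witness[where i="\<lambda>(I, K). (I \<union> K, I)" and j="\<lambda>(I, I'). (I', I - I')"])
      (auto simp: Un_absorb1 Diff_Diff_Int intro!: arg_cong2[where f="\<lambda>x y. f _ x y"])
  also have "\<dots> = (\<Sum>I\<in>Pow A. \<Sum>K\<in>Pow (A - I). f I K (A - I - K))"
    using assms by (subst sum.Sigma) (auto intro: finite_subset)
  finally show ?thesis .
qed

lemma wedge_nth:
  "(a \<and>\<^sub>s b) $ (A, B) = (\<Sum>I\<in>Pow A. \<Sum>J\<in>Pow B.
     swap_sign I J (A - I) (B - J) * a $ (I, J) * b $ (A - I, B - J))"
  by (simp add: wedge_def)

lemma wedge_assoc: "(a \<and>\<^sub>s b) \<and>\<^sub>s c = a \<and>\<^sub>s b \<and>\<^sub>s c"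
proof -
  have "((a \<and>\<^sub>s b) \<and>\<^sub>s c) $ (A, B) = (a \<and>\<^sub>s b \<and>\<^sub>s c) $ (A, B)" for A B
  proof -
    let ?f = "\<lambda>I K P J L Q. swap_sign (I \<union> K) (J \<union> L) P Q * swap_sign I J K L *
      a $ (I, J) * b $ (K, L) * c $ (P, Q)"
    have "((a \<and>\<^sub>s b) \<and>\<^sub>s c) $ (A, B) =
        (\<Sum>I\<in>Pow A. \<Sum>J\<in>Pow B. \<Sum>I'\<in>Pow I. \<Sum>J'\<in>Pow J. ?f I' (I - I') (A - I) J' (J - J') (B - J))"
      unfolding wedge_nth
      by (intro sum.cong refl)
        (auto simp: sum_distrib_left sum_distrib_right Un_absorb1 algebra_simps intro!: sum.cong)
    also have "\<dots> = (\<Sum>I\<in>Pow A. \<Sum>I'\<in>Pow I. \<Sum>J\<in>Pow B. \<Sum>J'\<in>Pow J. ?f I' (I - I') (A - I) J' (J - J') (B - J))"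
      by (intro sum.cong refl sum.swap)
    also have "\<dots> = (\<Sum>I\<in>Pow A. \<Sum>K\<in>Pow (A - I). \<Sum>J\<in>Pow B. \<Sum>L\<in>Pow (B - J). ?f I K (A - I - K) J L (B - J - L))"
      unfolding sum_Pow_Pow_swap[OF finite, of "\<lambda>I' K P. \<Sum>J\<in>Pow B. \<Sum>J'\<in>Pow J. ?f I' K P J' (J - J') (B - J)"]
      by (rule sum.cong[OF refl], rule sum.cong[OF refl])
        (rule sum_Pow_Pow_swap[OF finite, of "?f _ _ _"])
    also have "\<dots> = (\<Sum>I\<in>Pow A. \<Sum>J\<in>Pow B. \<Sum>K\<in>Pow (A - I). \<Sum>L\<in>Pow (B - J). ?f I K (A - I - K) J L (B - J - L))"
      by (intro sum.cong refl sum.swap)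
    also have "\<dots> = (a \<and>\<^sub>s b \<and>\<^sub>s c) $ (A, B)"
      unfolding wedge_nth sum_distrib_left
    proof (intro sum.cong refl)
      fix I J K L assume "I \<in> Pow A" "J \<in> Pow B" "K \<in> Pow (A - I)" "L \<in> Pow (B - J)"
      then have "swap_sign (I \<union> K) (J \<union> L) (A - I - K) (B - J - L) * swap_sign I J K L =
          swap_sign I J (A - I) (B - J) * swap_sign K L (A - I - K) (B - J - L)"
        using swap_sign_assoc[of I K "A - I - K" J L "B - J - L"] by (auto simp: Un_absorb1)
      then show "?f I K (A - I - K) J L (B - J - L) = swap_sign I J (A - I) (B - J) * a $ (I, J) *
          (swap_sign K L (A - I - K) (B - J - L) * b $ (K, L) * c $ (A - I - K, B - J - L))"
        by (simp add: mult_ac)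
    qed
    finally show ?thesis .
  qed
  then show ?thesis by (simp add: vec_eq_iff)
qed

lemma bounded_bilinear_wedge: "bounded_bilinear (\<and>\<^sub>s)"
  by (subst bilinear_conv_bounded_bilinear[symmetric])
    (auto simp: bilinear_def wedge_def vec_eq_iff sum.distrib algebra_simps sum_distrib_left intro!: linearI)

lemmas wedge_add_left = bounded_bilinear.add_left[OF bounded_bilinear_wedge]
  and wedge_add_right = bounded_bilinear.add_right[OF bounded_bilinear_wedge]
  and wedge_diff_left = bounded_bilinear.diff_left[OF bounded_bilinear_wedge]
  and wedge_diff_right = bounded_bilinear.diff_right[OF bounded_bilinear_wedge]
  and wedge_minus_left = bounded_bilinear.minus_left[OF bounded_bilinear_wedge]
  and wedge_minus_right = bounded_bilinear.minus_right[OF bounded_bilinear_wedge]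
  and wedge_scaleR_left = bounded_bilinear.scaleR_left[OF bounded_bilinear_wedge]
  and wedge_scaleR_right = bounded_bilinear.scaleR_right[OF bounded_bilinear_wedge]
  and wedge_sum_left = bounded_bilinear.sum_left[OF bounded_bilinear_wedge]
  and wedge_sum_right = bounded_bilinear.sum_right[OF bounded_bilinear_wedge]
  and wedge_zero_left [simp] = bounded_bilinear.zero_left[OF bounded_bilinear_wedge]
  and wedge_zero_right [simp] = bounded_bilinear.zero_right[OF bounded_bilinear_wedge]

lemma bounded_linear_Jop: "bounded_linear Jop"
  by (subst linear_conv_bounded_linear[symmetric])
    (auto simp: Jop_def vec_eq_iff algebra_simps intro!: linearI)

section \<open>Wedging and contracting with basis covectors\<close>

lemma dx_wedge_nth:
  "(dx r \<and>\<^sub>s a) $ (I, J) = (if r \<in> I then (-1) ^ inversions {r} (I - {r}) * a $ (I - {r}, J) else 0)"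
proof -
  have "(dx r \<and>\<^sub>s a) $ (I, J) = (\<Sum>K\<in>Pow I. \<Sum>L\<in>Pow J.
      if L = {} then (if K = {r} then (-1) ^ inversions {r} (I - {r}) * a $ (I - {r}, J) else 0) else 0)"
    unfolding wedge_nth
    by (intro sum.cong refl) (auto simp: dx_def axis_def swap_sign_def)
  also have "\<dots> = (\<Sum>K\<in>Pow I. if K = {r} then (-1) ^ inversions {r} (I - {r}) * a $ (I - {r}, J) else 0)"
    by (intro sum.cong refl) (simp add: finite_subset)
  finally show ?thesis by simp
qed

lemma dxi_wedge_nth:
  "(dxi r \<and>\<^sub>s a) $ (I, J) =
    (if r \<in> J then (-1) ^ (card I + inversions {r} (J - {r})) * a $ (I, J - {r}) else 0)"
proof -
  have "(dxi r \<and>\<^sub>s a) $ (I, J) = (\<Sum>K\<in>Pow I. \<Sum>L\<in>Pow J.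
      if K = {} then (if L = {r} then (-1) ^ (card I + inversions {r} (J - {r})) * a $ (I, J - {r}) else 0) else 0)"
    unfolding wedge_nth
    by (intro sum.cong refl) (auto simp: dxi_def axis_def swap_sign_def)
  also have "\<dots> = (\<Sum>K\<in>Pow I. if K = {} then (if r \<in> J then (-1) ^ (card I + inversions {r} (J - {r})) * a $ (I, J - {r}) else 0) else 0)"
    by (intro sum.cong refl) (auto simp: finite_subset)
  finally show ?thesis by simp
qed

lemma wedge_scalar_right [simp]: "a \<and>\<^sub>s scalar c = c *\<^sub>R a"
proof -
  have "(a \<and>\<^sub>s scalar c) $ (A, B) = (c *\<^sub>R a) $ (A, B)" for A B
  proof -
    have "(a \<and>\<^sub>s scalar c) $ (A, B) = (\<Sum>K\<in>Pow A. \<Sum>L\<in>Pow B.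
        if L = B then (if K = A then c * a $ (A, B) else 0) else 0)"
      unfolding wedge_nth by (intro sum.cong refl) (auto simp: scalar_def axis_def swap_sign_def)
    also have "\<dots> = (\<Sum>K\<in>Pow A. if K = A then c * a $ (A, B) else 0)"
      by (intro sum.cong refl) (simp add: finite_subset)
    finally show ?thesis by simp
  qed
  then show ?thesis by (simp add: vec_eq_iff)
qed

lemma inner_contract: "b \<bullet> (v \<rfloor> a) = (v \<and>\<^sub>s b) \<bullet> a"
  unfolding contract_def
  by (rule adjoint_works)
    (use bounded_bilinear.bounded_linear_right[OF bounded_bilinear_wedge] linear_conv_bounded_linear in blast)

lemma contract_unique: "(\<And>b. b \<bullet> c = (v \<and>\<^sub>s b) \<bullet> a) \<Longrightarrow> v \<rfloor> a = c"
  by (metis inner_contract vector_eq_ldot)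

lemma bounded_bilinear_contract: "bounded_bilinear (\<rfloor>)"
proof (subst bilinear_conv_bounded_bilinear[symmetric], unfold bilinear_def, intro conjI allI linearI)
qed (rule contract_unique,
  simp add: inner_add_left inner_add_right inner_contract wedge_add_left wedge_scaleR_left)+

lemmas contract_scaleR_left = bounded_bilinear.scaleR_left[OF bounded_bilinear_contract]
  and contract_scaleR_right = bounded_bilinear.scaleR_right[OF bounded_bilinear_contract]
  and contract_sum_left = bounded_bilinear.sum_left[OF bounded_bilinear_contract]
  and contract_sum_right = bounded_bilinear.sum_right[OF bounded_bilinear_contract]
  and contract_zero_right [simp] = bounded_bilinear.zero_right[OF bounded_bilinear_contract]

lemma inner_scovector:
  fixes a b :: "'n::finite scovector"
  shows "a \<bullet> b = (\<Sum>I\<in>UNIV. \<Sum>J\<in>UNIV. a $ (I, J) * b $ (I, J))"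
  by (simp add: inner_vec_def sum.cartesian_product flip: UNIV_Times_UNIV)

text \<open>The matrix of wedging with \<open>dx r\<close> has at most one nonzero entry in each row
  and column, so its transpose can be read off from \<open>dx_wedge_nth\<close>;
  \<open>insert r\<close> is the bijection between the index sets involved.\<close>

lemma contract_dx_nth:
  "(dx r \<rfloor> a) $ (I, J) = (if r \<in> I then 0 else (-1) ^ inversions {r} I * a $ (insert r I, J))"
proof -
  define c :: "'a scovector" where
    "c = (\<chi> P. if r \<in> fst P then 0 else (-1) ^ inversions {r} (fst P) * a $ (insert r (fst P), snd P))"
  have "b \<bullet> c = (dx r \<and>\<^sub>s b) \<bullet> a" for b
  proof -
    have "b \<bullet> c = (\<Sum>I | r \<notin> I. \<Sum>J\<in>UNIV. b $ (I, J) * ((-1) ^ inversions {r} I * a $ (insert r I, J)))"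
      unfolding inner_scovector c_def by (rule sum.mono_neutral_cong_right) auto
    also have "\<dots> = (\<Sum>I | r \<in> I. \<Sum>J\<in>UNIV. b $ (I - {r}, J) * ((-1) ^ inversions {r} (I - {r}) * a $ (I, J)))"
      by (rule sum.reindex_bij_witness[where i="\<lambda>I. I - {r}" and j="insert r"])
        (auto simp: insert_absorb)
    also have "\<dots> = (dx r \<and>\<^sub>s b) \<bullet> a"
      unfolding inner_scovector dx_wedge_nth by (rule sum.mono_neutral_cong_left) (auto simp: mult_ac)
    finally show ?thesis .
  qed
  from contract_unique[OF this] show ?thesis by (simp add: c_def)
qed

text \<open>The canonical anticommutation relation. Later rules for contracting products follow from
  it and from \<open>contract_dx_dxi\<close> by linearity, without further counting of
  signs.\<close>

lemma contract_dx_dx: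
  "dx r \<rfloor> (dx k \<and>\<^sub>s a) = (if r = k then a else 0) - dx k \<and>\<^sub>s (dx r \<rfloor> a)"
proof -
  have "(dx r \<rfloor> (dx k \<and>\<^sub>s a)) $ (I, J) = ((if r = k then a else 0) - dx k \<and>\<^sub>s (dx r \<rfloor> a)) $ (I, J)" for I J
  proof (cases "r = k")
    case True
    then show ?thesis by (auto simp: contract_dx_nth dx_wedge_nth insert_absorb)
  next
    case False
    show ?thesis
    proof (cases "k \<in> I \<and> r \<notin> I")
      case True
      define K where "K = I - {k}"
      have I: "I = insert k K" "k \<notin> K" "r \<notin> K" using True unfolding K_def by auto
      have "insert r (insert k K) - {k} = insert r K" using I False by auto
      then show ?thesis using False I
        by (auto simp: contract_dx_nth dx_wedge_nth inversions_insert_right insert_Diff_if)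
    next
      case F: False
      then show ?thesis using False by (auto simp: contract_dx_nth dx_wedge_nth)
    qed
  qed
  then show ?thesis by (simp add: vec_eq_iff)
qed

lemma contract_dx_dxi: "dx r \<rfloor> (dxi k \<and>\<^sub>s a) = - (dxi k \<and>\<^sub>s (dx r \<rfloor> a))"
proof -
  have "(dx r \<rfloor> (dxi k \<and>\<^sub>s a)) $ (I, J) = (- (dxi k \<and>\<^sub>s (dx r \<rfloor> a))) $ (I, J)" for I J
    by (auto simp: contract_dx_nth dxi_wedge_nth)
  then show ?thesis by (simp add: vec_eq_iff)
qed

lemma contract_dx_scalar [simp]: "dx r \<rfloor> scalar c = 0"
proof -
  have "(dx r \<rfloor> scalar c) $ (I, J) = 0" for I J
    by (auto simp: contract_dx_nth scalar_def axis_def)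
  then show ?thesis by (simp add: vec_eq_iff)
qed

text \<open>When both indices occur and differ, exactly one of \<open>k < r\<close> and
  \<open>r < k\<close> adds an inversion, whence the sign; in all other cases both sides
  vanish.\<close>

lemma dx_wedge_dx: "dx r \<and>\<^sub>s dx k \<and>\<^sub>s a = - (dx k \<and>\<^sub>s dx r \<and>\<^sub>s a)"
proof -
  have "(dx r \<and>\<^sub>s dx k \<and>\<^sub>s a) $ (I, J) = (- (dx k \<and>\<^sub>s dx r \<and>\<^sub>s a)) $ (I, J)" for I J
  proof (cases "r \<in> I \<and> k \<in> I \<and> r \<noteq> k")
    case True
    define K where "K = I - {r} - {k}"
    have K: "I - {r} = insert k K" "I - {k} = insert r K" "k \<notin> K" "r \<notin> K"
      "insert k K - {k} = K" "insert r K - {r} = K" "I - {r} - {k} = K" "I - {k} - {r} = K"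
      using True unfolding K_def by auto
    show ?thesis using True by (auto simp: K dx_wedge_nth inversions_insert_right)
  next
    case False
    then show ?thesis by (auto simp: dx_wedge_nth)
  qed
  then show ?thesis by (simp add: vec_eq_iff)
qed

lemma dxi_wedge_dxi: "dxi r \<and>\<^sub>s dxi k \<and>\<^sub>s a = - (dxi k \<and>\<^sub>s dxi r \<and>\<^sub>s a)"
proof -
  have "(dxi r \<and>\<^sub>s dxi k \<and>\<^sub>s a) $ (I, J) = (- (dxi k \<and>\<^sub>s dxi r \<and>\<^sub>s a)) $ (I, J)" for I J
  proof (cases "r \<in> J \<and> k \<in> J \<and> r \<noteq> k")
    case True
    define K where "K = J - {r} - {k}"
    have K: "J - {r} = insert k K" "J - {k} = insert r K" "k \<notin> K" "r \<notin> K"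
      "insert k K - {k} = K" "insert r K - {r} = K" "J - {r} - {k} = K" "J - {k} - {r} = K"
      using True unfolding K_def by auto
    show ?thesis using True by (auto simp: K dxi_wedge_nth inversions_insert_right power_add)
  next
    case False
    then show ?thesis by (auto simp: dxi_wedge_nth)
  qed
  then show ?thesis by (simp add: vec_eq_iff)
qed

lemma dxi_wedge_dx: "dxi r \<and>\<^sub>s dx k \<and>\<^sub>s a = - (dx k \<and>\<^sub>s dxi r \<and>\<^sub>s a)"
proof -
  have "(dxi r \<and>\<^sub>s dx k \<and>\<^sub>s a) $ (I, J) = (- (dx k \<and>\<^sub>s dxi r \<and>\<^sub>s a)) $ (I, J)" for I J
  proof (cases "k \<in> I")
    case True
    define K where "K = I - {k}"
    have "I = insert k K" "k \<notin> K" using True unfolding K_def by auto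
    then show ?thesis by (auto simp: dx_wedge_nth dxi_wedge_nth power_add)
  qed (auto simp: dx_wedge_nth dxi_wedge_nth)
  then show ?thesis by (simp add: vec_eq_iff)
qed

section \<open>Covectors with arbitrary coefficient vectors\<close>

text \<open>Gradients and Hessian rows are kept as vectors in \<open>real^'n\<close>; derivatives
  and inner products then pass through a linear embedding instead of being computed in the exterior
  algebra.\<close>

definition dxv :: "real^'n::{finite,linorder} \<Rightarrow> 'n scovector" where
  "dxv v = (\<Sum>k\<in>UNIV. v $ k *\<^sub>R dx k)"

definition dxiv :: "real^'n::{finite,linorder} \<Rightarrow> 'n scovector" where
  "dxiv v = (\<Sum>k\<in>UNIV. v $ k *\<^sub>R dxi k)"

lemma bounded_linear_dxv: "bounded_linear dxv"
  by (subst linear_conv_bounded_linear[symmetric])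
    (auto simp: dxv_def sum.distrib scaleR_add_left scaleR_sum_right intro!: linearI)

lemma bounded_linear_dxiv: "bounded_linear dxiv"
  by (subst linear_conv_bounded_linear[symmetric])
    (auto simp: dxiv_def sum.distrib scaleR_add_left scaleR_sum_right intro!: linearI)

lemmas dxv_diff = linear_diff[OF bounded_linear.linear[OF bounded_linear_dxv]]
  and dxv_scaleR = linear_scale[OF bounded_linear.linear[OF bounded_linear_dxv]]
  and dxv_sum = linear_sum[OF bounded_linear.linear[OF bounded_linear_dxv]]
  and dxiv_add = linear_add[OF bounded_linear.linear[OF bounded_linear_dxiv]]
  and dxiv_scaleR = linear_scale[OF bounded_linear.linear[OF bounded_linear_dxiv]]
  and dxiv_sum = linear_sum[OF bounded_linear.linear[OF bounded_linear_dxiv]]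

lemmas Jop_minus = linear_neg[OF bounded_linear.linear[OF bounded_linear_Jop]]
  and Jop_scaleR = linear_scale[OF bounded_linear.linear[OF bounded_linear_Jop]]
  and Jop_sum = linear_sum[OF bounded_linear.linear[OF bounded_linear_Jop]]

lemma dxv_axis: "dxv (axis k 1) = dx k"
  unfolding dxv_def axis_def by (simp add: if_distrib[where f="\<lambda>c. c *\<^sub>R _"] cong: if_cong)

lemma Jop_dxv: "Jop (dxv v) = dxiv v"
  by (simp add: dxv_def dxiv_def Jop_sum Jop_scaleR Jop_dx)

lemma Jop_dxiv: "Jop (dxiv v) = - dxv v"
  by (simp add: dxv_def dxiv_def Jop_sum Jop_scaleR Jop_dxi sum_negf)

lemma Jop_scalar [simp]: "Jop (scalar c) = scalar c"
  by (auto simp: vec_eq_iff Jop_def scalar_def axis_def)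

lemma contract_dx_dxv: "dx k \<rfloor> (dxv u \<and>\<^sub>s a) = (u $ k) *\<^sub>R a - dxv u \<and>\<^sub>s (dx k \<rfloor> a)"
proof -
  have "dx k \<rfloor> (dxv u \<and>\<^sub>s a) = (\<Sum>r\<in>UNIV. u $ r *\<^sub>R (if k = r then a else 0)) - dxv u \<and>\<^sub>s (dx k \<rfloor> a)"
    by (simp add: dxv_def wedge_sum_left wedge_scaleR_left contract_sum_right contract_scaleR_right
        contract_dx_dx scaleR_diff_right sum_subtractf)
  also have "(\<Sum>r\<in>UNIV. u $ r *\<^sub>R (if k = r then a else 0)) = u $ k *\<^sub>R a"
    by (simp add: if_distrib[where f="\<lambda>c. _ *\<^sub>R c"] cong: if_cong)
  finally show ?thesis .
qed

lemma contract_dxv_dxv: "dxv v \<rfloor> (dxv u \<and>\<^sub>s a) = (v \<bullet> u) *\<^sub>R a - dxv u \<and>\<^sub>s (dxv v \<rfloor> a)"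
  unfolding dxv_def[of v]
  by (simp add: contract_sum_left contract_scaleR_left contract_dx_dxv scaleR_diff_right sum_subtractf
      inner_vec_def scaleR_sum_left wedge_sum_right wedge_scaleR_right)

lemma contract_dxv_dxiv: "dxv v \<rfloor> (dxiv u \<and>\<^sub>s a) = - (dxiv u \<and>\<^sub>s (dxv v \<rfloor> a))"
proof -
  have "dxv v \<rfloor> (dxiv u \<and>\<^sub>s a) = - (\<Sum>j\<in>UNIV. \<Sum>i\<in>UNIV. (u $ j * v $ i) *\<^sub>R (dxi j \<and>\<^sub>s (dx i \<rfloor> a)))"
    by (simp add: dxv_def dxiv_def contract_sum_left contract_scaleR_left contract_sum_right
        contract_scaleR_right wedge_sum_left wedge_scaleR_left contract_dx_dxi scaleR_sum_right sum_negf)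
  also have "(\<Sum>j\<in>UNIV. \<Sum>i\<in>UNIV. (u $ j * v $ i) *\<^sub>R (dxi j \<and>\<^sub>s (dx i \<rfloor> a))) =
      (\<Sum>j\<in>UNIV. u $ j *\<^sub>R (dxi j \<and>\<^sub>s (dxv v \<rfloor> a)))"
    by (simp add: dxv_def contract_sum_left contract_scaleR_left wedge_sum_right wedge_scaleR_right scaleR_sum_right)
  also have "\<dots> = dxiv u \<and>\<^sub>s (dxv v \<rfloor> a)"
    by (simp add: dxiv_def wedge_sum_left wedge_scaleR_left)
  finally show ?thesis .
qed

lemma contract_dxv_scalar [simp]: "dxv v \<rfloor> scalar c = 0"
  by (simp add: dxv_def contract_sum_left contract_scaleR_left)

lemma contract_dxv: "dxv v \<rfloor> dxv u = scalar (v \<bullet> u)"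
proof -
  have "scalar (v \<bullet> u) = (v \<bullet> u) *\<^sub>R scalar 1" by (auto simp: scalar_def vec_eq_iff axis_def)
  moreover have "dxv v \<rfloor> dxv u = (v \<bullet> u) *\<^sub>R scalar 1"
    using contract_dxv_dxv[of v u "scalar 1"] by simp
  ultimately show ?thesis by metis
qed

lemma dxv_wedge_dxv: "dxv u \<and>\<^sub>s dxv v \<and>\<^sub>s a = - (dxv v \<and>\<^sub>s dxv u \<and>\<^sub>s a)"
proof -
  have e: "dxv u \<and>\<^sub>s dxv v \<and>\<^sub>s a = (\<Sum>i\<in>UNIV. \<Sum>j\<in>UNIV. (u $ i * v $ j) *\<^sub>R (dx i \<and>\<^sub>s dx j \<and>\<^sub>s a))" for u v
  proof -
    have "dxv u \<and>\<^sub>s dxv v \<and>\<^sub>s a = (\<Sum>i\<in>UNIV. u $ i *\<^sub>R (dx i \<and>\<^sub>s dxv v \<and>\<^sub>s a))"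
      by (simp add: dxv_def[of u] wedge_sum_left wedge_scaleR_left)
    then show ?thesis
      by (simp add: dxv_def wedge_sum_right wedge_sum_left wedge_scaleR_right wedge_scaleR_left scaleR_sum_right)
  qed
  have "(u $ i * v $ j) *\<^sub>R (dx i \<and>\<^sub>s dx j \<and>\<^sub>s a) = - ((v $ j * u $ i) *\<^sub>R (dx j \<and>\<^sub>s dx i \<and>\<^sub>s a))" for i j
    using dx_wedge_dx[of i j a] by (simp add: mult.commute)
  then show ?thesis unfolding e[of u v] e[of v u] sum_negf[symmetric]
    by (subst (2) sum.swap) simp
qed

text \<open>\<open>Jop\<close> is multiplicative and turns \<open>dxv\<close> into
  \<open>dxiv\<close>, so this is the image of \<open>dxv_wedge_dxv\<close>.\<close>

lemma dxiv_wedge_dxiv: "dxiv u \<and>\<^sub>s dxiv v \<and>\<^sub>s a = - (dxiv v \<and>\<^sub>s dxiv u \<and>\<^sub>s a)"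
proof -
  have "Jop (dxv u \<and>\<^sub>s dxv v \<and>\<^sub>s b) = Jop (- (dxv v \<and>\<^sub>s dxv u \<and>\<^sub>s b))" for b by (simp only: dxv_wedge_dxv[of u v])
  then have *: "dxiv u \<and>\<^sub>s dxiv v \<and>\<^sub>s Jop b = - (dxiv v \<and>\<^sub>s dxiv u \<and>\<^sub>s Jop b)" for b
    by (simp add: Jop_wedge Jop_minus Jop_dxv)
  \<comment> \<open>The unit as third factor suffices; a general one is restored by
    associativity.\<close>
  have "dxiv u \<and>\<^sub>s dxiv v = - (dxiv v \<and>\<^sub>s dxiv u)" using *[of "scalar 1"] by simp
  then show ?thesis by (metis wedge_assoc wedge_minus_left)
qed

lemma dxiv_wedge_dxv: "dxiv u \<and>\<^sub>s dxv v \<and>\<^sub>s a = - (dxv v \<and>\<^sub>s dxiv u \<and>\<^sub>s a)"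
proof -
  have "dxiv u \<and>\<^sub>s dxv v \<and>\<^sub>s a = (\<Sum>i\<in>UNIV. u $ i *\<^sub>R (dxi i \<and>\<^sub>s dxv v \<and>\<^sub>s a))"
    by (simp add: dxiv_def wedge_sum_left wedge_scaleR_left)
  also have "\<dots> = - (\<Sum>i\<in>UNIV. \<Sum>j\<in>UNIV. (u $ i * v $ j) *\<^sub>R (dx j \<and>\<^sub>s dxi i \<and>\<^sub>s a))"
    by (simp add: dxv_def wedge_sum_right wedge_sum_left wedge_scaleR_right wedge_scaleR_left
        scaleR_sum_right dxi_wedge_dx sum_negf)
  also have "(\<Sum>i\<in>UNIV. \<Sum>j\<in>UNIV. (u $ i * v $ j) *\<^sub>R (dx j \<and>\<^sub>s dxi i \<and>\<^sub>s a)) =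
      (\<Sum>j\<in>UNIV. \<Sum>i\<in>UNIV. (u $ i * v $ j) *\<^sub>R (dx j \<and>\<^sub>s dxi i \<and>\<^sub>s a))"
    by (rule sum.swap)
  also have "\<dots> = (\<Sum>j\<in>UNIV. v $ j *\<^sub>R (dx j \<and>\<^sub>s dxiv u \<and>\<^sub>s a))"
    by (simp add: dxiv_def wedge_sum_right wedge_sum_left wedge_scaleR_right wedge_scaleR_left
        scaleR_sum_right mult.commute)
  also have "\<dots> = dxv v \<and>\<^sub>s dxiv u \<and>\<^sub>s a"
    by (simp add: dxv_def wedge_sum_left wedge_scaleR_left)
  finally show ?thesis .
qed

lemma dxv_square [simp]: "dxv v \<and>\<^sub>s dxv v \<and>\<^sub>s a = 0"
  using dxv_wedge_dxv[of v v a] by (simp add: vec_eq_iff)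

lemma scalar_wedge [simp]: "scalar c \<and>\<^sub>s a = c *\<^sub>R a"
proof -
  have "(scalar c \<and>\<^sub>s a) $ (A, B) = (c *\<^sub>R a) $ (A, B)" for A B
  proof -
    have "(scalar c \<and>\<^sub>s a) $ (A, B) = (\<Sum>K\<in>Pow A. \<Sum>L\<in>Pow B.
        if L = {} then (if K = {} then c * a $ (A, B) else 0) else 0)"
      unfolding wedge_nth by (intro sum.cong refl) (auto simp: scalar_def axis_def swap_sign_def)
    also have "\<dots> = (\<Sum>K\<in>Pow A. if K = {} then c * a $ (A, B) else 0)"
      by (intro sum.cong refl) (simp add: finite_subset)
    finally show ?thesis by simp
  qed
  then show ?thesis by (simp add: vec_eq_iff)
qed

lemma inner_Jop: "Jop a \<bullet> Jop a = a \<bullet> a"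
proof -
  have "Jop a \<bullet> Jop a = (\<Sum>I\<in>UNIV. \<Sum>J\<in>UNIV. a $ (J, I) * a $ (J, I))"
    unfolding inner_scovector Jop_def by (simp add: mult_ac)
  also have "\<dots> = a \<bullet> a" unfolding inner_scovector by (rule sum.swap)
  finally show ?thesis .
qed

section \<open>Products of normal covectors\<close>

definition wedges :: "('i \<Rightarrow> real^'n::{finite,linorder}) \<Rightarrow> 'i list \<Rightarrow> 'n scovector \<Rightarrow> 'n scovector" where
  "wedges \<nu> js c = foldr (\<lambda>j b. dxv (\<nu> j) \<and>\<^sub>s b) js c"

lemma wedges_simps [simp]: "wedges \<nu> [] c = c" "wedges \<nu> (j # js) c = dxv (\<nu> j) \<and>\<^sub>s wedges \<nu> js c"
  by (simp_all add: wedges_def)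

lemma wedges_wedge: "wedges \<nu> js a \<and>\<^sub>s c = wedges \<nu> js (a \<and>\<^sub>s c)"
  by (induction js) (simp_all add: wedge_assoc)

lemma wedges_absorb: "i \<in> set js \<Longrightarrow> dxv (\<nu> i) \<and>\<^sub>s wedges \<nu> js c = 0"
proof (induction js)
  case (Cons j js)
  then show ?case using dxv_wedge_dxv[of "\<nu> i" "\<nu> j" "wedges \<nu> js c"] by auto
qed simp

lemma dxiv_wedges: "dxiv u \<and>\<^sub>s wedges \<nu> js c = (-1) ^ length js *\<^sub>R wedges \<nu> js (dxiv u \<and>\<^sub>s c)"
  by (induction js) (simp_all add: dxiv_wedge_dxv wedge_scaleR_right)

lemma wedges_zero [simp]: "wedges \<nu> js 0 = 0"
  by (induction js) simp_all

lemma contract_wedges: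
  "(\<And>j. j \<in> set js \<Longrightarrow> v \<bullet> \<nu> j = 0) \<Longrightarrow> dxv v \<rfloor> c = 0 \<Longrightarrow> dxv v \<rfloor> wedges \<nu> js c = 0"
  by (induction js) (simp_all add: contract_dxv_dxv)

text \<open>On covectors annihilated by contraction with a unit normal, wedging with that normal is
  an isometry, because its adjoint is a left inverse there. Orthogonality of the normals keeps the
  partial products in this kernel.\<close>

lemma inner_wedges:
  assumes "distinct js" "\<And>i j. i \<in> set js \<Longrightarrow> j \<in> set js \<Longrightarrow> \<nu> i \<bullet> \<nu> j = (if i = j then 1 else 0)"
    "\<And>j. j \<in> set js \<Longrightarrow> dxv (\<nu> j) \<rfloor> c = 0"
  shows "wedges \<nu> js c \<bullet> wedges \<nu> js c = c \<bullet> c"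
  using assms
proof (induction js)
  case (Cons j js)
  have "dxv (\<nu> j) \<rfloor> wedges \<nu> js c = 0" using Cons.prems by (intro contract_wedges) auto
  then have "wedges \<nu> (j # js) c \<bullet> wedges \<nu> (j # js) c = wedges \<nu> js c \<bullet> wedges \<nu> js c"
    using Cons.prems(2)[of j j] by (simp add: inner_contract[symmetric] contract_dxv_dxv)
  then show ?case using Cons by auto
qed simp

text \<open>The form \<open>n \<and> n\<^sup>#\<close> without the sign
  \<open>c\<^sub>p\<close>.\<close>

definition normal_wedge :: "('i \<Rightarrow> real^'n::{finite,linorder}) \<Rightarrow> 'i list \<Rightarrow> 'n scovector" where
  "normal_wedge \<nu> js = wedges \<nu> js (scalar 1) \<and>\<^sub>s Jop (wedges \<nu> js (scalar 1))"

lemma normal_wedge_eq: "normal_wedge \<nu> js = wedges \<nu> js (Jop (wedges \<nu> js (scalar 1)))"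
  by (simp add: normal_wedge_def wedges_wedge)

lemma dxv_normal_wedge: "i \<in> set js \<Longrightarrow> dxv (\<nu> i) \<and>\<^sub>s normal_wedge \<nu> js = 0"
  by (simp add: normal_wedge_eq wedges_absorb)

text \<open>Up to sign the factor moves past the first block and then meets the second, where
  \<open>n\<^sub>i\<^sup># \<and> n\<^sup># = J(n\<^sub>i \<and> n) = 0\<close>.\<close>

lemma dxiv_normal_wedge: "i \<in> set js \<Longrightarrow> dxiv (\<nu> i) \<and>\<^sub>s normal_wedge \<nu> js = 0"
  unfolding normal_wedge_eq dxiv_wedges
  by (simp add: Jop_dxv[symmetric] Jop_wedge[symmetric] wedges_absorb linear_0[OF bounded_linear.linear[OF bounded_linear_Jop]])

lemma contract_Jop_wedges: "dxv v \<rfloor> Jop (wedges \<nu> js (scalar 1)) = 0"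
  by (induction js) (simp_all add: Jop_wedge Jop_dxv contract_dxv_dxiv)

lemma contract_normal_wedge:
  "(\<And>j. j \<in> set js \<Longrightarrow> v \<bullet> \<nu> j = 0) \<Longrightarrow> dxv v \<rfloor> normal_wedge \<nu> js = 0"
  unfolding normal_wedge_eq by (rule contract_wedges) (simp_all add: contract_Jop_wedges)

text \<open>Two uses of \<open>inner_wedges\<close>, one for each block, with the isometry
  \<open>Jop\<close> in between.\<close>

lemma inner_normal_wedge:
  fixes \<nu> :: "'i \<Rightarrow> real^'n::{finite,linorder}"
  assumes "distinct js" "\<And>i j. i \<in> set js \<Longrightarrow> j \<in> set js \<Longrightarrow> \<nu> i \<bullet> \<nu> j = (if i = j then 1 else 0)"
  shows "normal_wedge \<nu> js \<bullet> normal_wedge \<nu> js = 1"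
proof -
  have "normal_wedge \<nu> js \<bullet> normal_wedge \<nu> js =
      wedges \<nu> js (scalar 1) \<bullet> wedges \<nu> js (scalar 1)"
    unfolding normal_wedge_eq
    by (subst inner_wedges[OF assms]) (simp_all add: contract_Jop_wedges inner_Jop)
  also have "\<dots> = scalar 1 \<bullet> (scalar 1 :: 'n scovector)"
    by (rule inner_wedges[OF assms]) simp_all
  also have "\<dots> = 1" by (simp add: scalar_def inner_axis_axis)
  finally show ?thesis .
qed

text \<open>The tangential part of a covector \<open>c\<close> is recovered linearly from \<open>c \<and> n \<and> n\<^sup>#\<close>.\<close>

lemma tangential_component:
  fixes \<nu> :: "'i \<Rightarrow> real^'n::{finite,linorder}"
  assumes "distinct js" and on: "\<And>i j. i \<in> set js \<Longrightarrow> j \<in> set js \<Longrightarrow> \<nu> i \<bullet> \<nu> j = (if i = j then 1 else 0)"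
  shows "(dxv c \<and>\<^sub>s normal_wedge \<nu> js) \<bullet> (dx k \<and>\<^sub>s normal_wedge \<nu> js) =
    (c - (\<Sum>j\<in>set js. (\<nu> j \<bullet> c) *\<^sub>R \<nu> j)) $ k"
proof -
  define t where "t = c - (\<Sum>j\<in>set js. (\<nu> j \<bullet> c) *\<^sub>R \<nu> j)"
  have "dxv c \<and>\<^sub>s normal_wedge \<nu> js = dxv t \<and>\<^sub>s normal_wedge \<nu> js"
    unfolding t_def
    by (simp add: dxv_diff dxv_sum dxv_scaleR wedge_diff_left wedge_sum_left wedge_scaleR_left dxv_normal_wedge)
  moreover have "t \<bullet> \<nu> i = 0" if "i \<in> set js" for i
  proof -
    have "(\<Sum>j\<in>set js. (\<nu> j \<bullet> c) *\<^sub>R \<nu> j) \<bullet> \<nu> i = (\<Sum>j\<in>set js. if j = i then \<nu> j \<bullet> c else 0)"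
      unfolding inner_sum_left using on that by (intro sum.cong) auto
    then show ?thesis unfolding t_def using that by (simp add: inner_diff_left inner_commute[of c])
  qed
  then have "dxv t \<rfloor> normal_wedge \<nu> js = 0" by (rule contract_normal_wedge)
  \<comment> \<open>Adjointness moves \<open>dxv t\<close> to the right factor as a contraction; by
    the anticommutation relation only \<open>t $ k\<close> times the form of norm 1 remains.\<close>
  then have "(dxv t \<and>\<^sub>s normal_wedge \<nu> js) \<bullet> (dx k \<and>\<^sub>s normal_wedge \<nu> js) = t $ k"
    using inner_normal_wedge[OF assms]
    by (simp add: inner_contract[symmetric] dxv_axis[symmetric] contract_dxv_dxv inner_axis)
  ultimately show ?thesis by (simp add: t_def)
qed

section \<open>Forms of bidegree (1,1) and their contractions\<close>

text \<open>The (1,1)-form with matrix \<open>h k $ l\<close>. It is \<open>F\<^sub>j\<close> when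
  \<open>h\<close> is the Hessian of \<open>\<rho> j\<close>, but it also expresses
  \<open>D\<^sup># a\<close>, whose matrix is not symmetric in general.\<close>

definition hessian_form :: "('n::{finite,linorder} \<Rightarrow> real^'n::{finite,linorder}) \<Rightarrow> 'n scovector" where
  "hessian_form h = (\<Sum>k\<in>UNIV. dx k \<and>\<^sub>s dxiv (h k))"

text \<open>A contraction passes a form of even total degree without a sign.\<close>

lemma contract_hessian_form_wedge:
  "dxv b \<rfloor> (hessian_form h \<and>\<^sub>s a) = dxiv (\<Sum>k\<in>UNIV. b $ k *\<^sub>R h k) \<and>\<^sub>s a + hessian_form h \<and>\<^sub>s (dxv b \<rfloor> a)"
proof -
  have "dxv b \<rfloor> (dx k \<and>\<^sub>s dxiv (h k) \<and>\<^sub>s a) = b $ k *\<^sub>R (dxiv (h k) \<and>\<^sub>s a) + dx k \<and>\<^sub>s dxiv (h k) \<and>\<^sub>s (dxv b \<rfloor> a)" for k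
    using contract_dxv_dxv[of b "axis k 1"] by (simp add: dxv_axis inner_axis contract_dxv_dxiv wedge_minus_right)
  then show ?thesis unfolding hessian_form_def
    by (simp add: wedge_sum_left contract_sum_right dxiv_sum dxiv_scaleR wedge_scaleR_left sum.distrib wedge_assoc)
qed

lemma contract_hessian_form: "dxv b \<rfloor> hessian_form h = dxiv (\<Sum>k\<in>UNIV. b $ k *\<^sub>R h k)"
  using contract_hessian_form_wedge[of b h "scalar 1"] by simp

lemma dxiv_hessian_form: "dxiv u \<and>\<^sub>s hessian_form h = hessian_form h \<and>\<^sub>s dxiv u"
proof -
  have "dxiv u \<and>\<^sub>s dx k \<and>\<^sub>s dxiv w = dx k \<and>\<^sub>s dxiv w \<and>\<^sub>s dxiv u" for k w
    using dxiv_wedge_dxv[of u "axis k 1" "dxiv w"] dxiv_wedge_dxiv[of u w "scalar 1"]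
    by (simp add: dxv_axis wedge_minus_right)
  then show ?thesis unfolding hessian_form_def by (simp add: wedge_sum_left wedge_sum_right wedge_assoc)
qed

text \<open>Contracting either factor yields the same term, since the even factor commutes with
  \<open>dxiv\<close>; this is the origin of the \<open>1/2\<close> in the curvature form.\<close>

lemma contract_hessian_square:
  "dxv b \<rfloor> ((1/2) *\<^sub>R (hessian_form h \<and>\<^sub>s hessian_form h)) =
    hessian_form h \<and>\<^sub>s dxiv (\<Sum>k\<in>UNIV. b $ k *\<^sub>R h k)"
  by (simp add: contract_scaleR_right contract_hessian_form_wedge contract_hessian_form dxiv_hessian_form
      scaleR_2[symmetric] flip: scaleR_2)

text \<open>\<open>Jop\<close> sends \<open>dx k \<and>\<^sub>s dxi l\<close> to
  \<open>dx l \<and>\<^sub>s dxi k\<close>, that is, it transposes the matrix.\<close>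

lemma Jop_hessian_form:
  assumes "\<And>k l. h k $ l = h l $ k"
  shows "Jop (hessian_form h) = hessian_form h"
proof -
  have "dxi k \<and>\<^sub>s dxv (h k) = - (dxv (h k) \<and>\<^sub>s dxi k)" for k
    using dxiv_wedge_dxv[of "axis k 1" "h k" "scalar 1"] by (simp add: dxv_axis Jop_dx flip: Jop_dxv)
  then have "Jop (hessian_form h) = (\<Sum>k\<in>UNIV. dxv (h k) \<and>\<^sub>s dxi k)"
    unfolding hessian_form_def by (simp add: Jop_sum Jop_wedge Jop_dx Jop_dxiv wedge_minus_right)
  also have "\<dots> = (\<Sum>k\<in>UNIV. \<Sum>l\<in>UNIV. h k $ l *\<^sub>R (dx l \<and>\<^sub>s dxi k))"
    by (simp add: dxv_def wedge_sum_left wedge_scaleR_left)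
  also have "\<dots> = (\<Sum>l\<in>UNIV. \<Sum>k\<in>UNIV. h l $ k *\<^sub>R (dx l \<and>\<^sub>s dxi k))"
    by (subst sum.swap) (simp add: assms)
  also have "\<dots> = hessian_form h"
    unfolding hessian_form_def by (simp add: dxiv_def wedge_sum_right wedge_scaleR_right)
  finally show ?thesis .
qed

text \<open>Exchanging the two indices turns the sum into its negative. All derivative terms in
  \<open>(D\<^sup>#)\<^sup>2 a\<close> disappear in this way.\<close>

lemma dxi_wedge_dxi_symmetric_sum:
  assumes "\<And>l m. S l m = S m l"
  shows "(\<Sum>l\<in>UNIV. \<Sum>m\<in>UNIV. S l m *\<^sub>R (dxi l \<and>\<^sub>s dxi m)) = 0"
proof -
  let ?s = "\<Sum>l\<in>UNIV. \<Sum>m\<in>UNIV. S l m *\<^sub>R (dxi l \<and>\<^sub>s dxi m)"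
  have "S l m *\<^sub>R (dxi m \<and>\<^sub>s dxi l) = - (S l m *\<^sub>R (dxi l \<and>\<^sub>s dxi m))" for l m
    using dxi_wedge_dxi[of m l "scalar 1"] by simp
  moreover have "?s = (\<Sum>l\<in>UNIV. \<Sum>m\<in>UNIV. S l m *\<^sub>R (dxi m \<and>\<^sub>s dxi l))"
    by (subst sum.swap) (intro sum.cong refl arg_cong2[where f=scaleR] assms)
  ultimately have "?s = - ?s" by (simp only: sum_negf)
  then show ?thesis by (simp add: vec_eq_iff)
qed

section \<open>Bidegree of a single covector\<close>

text \<open>The pointwise part of \<open>superform_of_bidegree\<close>. Zero has every bidegree,
  which makes the notion closed under sums.\<close>

definition homogeneous :: "nat \<Rightarrow> nat \<Rightarrow> 'n::finite scovector \<Rightarrow> bool" where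
  "homogeneous p q a \<longleftrightarrow> (\<forall>I J. a $ (I, J) \<noteq> 0 \<longrightarrow> card I = p \<and> card J = q)"

lemma homogeneous_sum: "(\<And>i. i \<in> A \<Longrightarrow> homogeneous p q (f i)) \<Longrightarrow> homogeneous p q (\<Sum>i\<in>A. f i)"
  unfolding homogeneous_def by (metis sum.neutral sum_component)

lemma homogeneous_scaleR: "homogeneous p q a \<Longrightarrow> homogeneous p q (c *\<^sub>R a)"
  by (auto simp: homogeneous_def)

lemma homogeneous_dx_wedge: "homogeneous p q a \<Longrightarrow> homogeneous (Suc p) q (dx k \<and>\<^sub>s a)"
  unfolding homogeneous_def dx_wedge_nth by (metis card.remove finite mult_zero_right)

lemma homogeneous_dxiv_wedge: "homogeneous p q a \<Longrightarrow> homogeneous p (Suc q) (dxiv v \<and>\<^sub>s a)"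
proof -
  assume "homogeneous p q a"
  then have "homogeneous p (Suc q) (dxi k \<and>\<^sub>s a)" for k
    unfolding homogeneous_def dxi_wedge_nth by (metis card.remove finite mult_zero_right)
  then show ?thesis
    by (simp add: dxiv_def wedge_sum_left wedge_scaleR_left homogeneous_sum homogeneous_scaleR)
qed

lemma homogeneous_hessian_wedge:
  "homogeneous p q a \<Longrightarrow> homogeneous (Suc p) (Suc q) (hessian_form h \<and>\<^sub>s a)"
  by (simp add: hessian_form_def wedge_sum_left wedge_assoc homogeneous_sum homogeneous_dx_wedge homogeneous_dxiv_wedge)

lemma homogeneous_hessian_square: "homogeneous 2 2 (hessian_form h \<and>\<^sub>s hessian_form h)"
proof -
  have "homogeneous 0 0 (scalar 1 :: 'a scovector)" by (auto simp: homogeneous_def scalar_def axis_def)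
  from homogeneous_hessian_wedge[OF homogeneous_hessian_wedge[OF this], of h h]
  show ?thesis by (simp add: numeral_2_eq_2)
qed

lemma homogeneous_1_0:
  assumes "homogeneous 1 0 a"
  shows "a = dxv (\<chi> k. a $ ({k}, {}))"
proof -
  have "a $ (I, J) = dxv (\<chi> k. a $ ({k}, {})) $ (I, J)" for I J
  proof (cases "\<exists>k. (I, J) = ({k}, {})")
    case True
    then show ?thesis by (auto simp: dxv_def dx_def axis_def if_distrib cong: if_cong)
  next
    case False
    then have "a $ (I, J) = 0" using assms unfolding homogeneous_def
      by (metis card_0_eq card_1_singletonE finite)
    moreover have "dxv (\<chi> k. a $ ({k}, {})) $ (I, J) = 0"
      using False unfolding dxv_def dx_def axis_def by (auto intro!: sum.neutral split: if_splits)
    ultimately show ?thesis by simp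
  qed
  then show ?thesis unfolding vec_eq_iff split_paired_All by blast
qed


section \<open>Level sets with orthonormal gradients\<close>

text \<open>Covering by the \<open>(2 N)\<^bsup>card K\<^esup>\<close> cells of a grid of mesh \<open>r / N\<close> bounds the content uniformly in \<open>N\<close>.\<close>

lemma hausdorff_finite_of_coordinates:
  fixes A :: "'a::euclidean_space set" and K :: "'a set"
  assumes "finite K" "0 \<le> L" "0 < r"
    and bound: "\<And>y e. y \<in> A \<Longrightarrow> e \<in> K \<Longrightarrow> \<bar>e \<bullet> y\<bar> < r"
    and lip: "\<And>y z. y \<in> A \<Longrightarrow> z \<in> A \<Longrightarrow> norm (y - z) \<le> L * (\<Sum>e\<in>K. \<bar>e \<bullet> (y - z)\<bar>)"
  shows "hausdorff (card K) A < top"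
proof -
  define d where "d = card K"
  \<comment> \<open>There are \<open>(2 * N) ^ d\<close> cells of diameter at most
    \<open>L * d * r / N\<close>; the powers of \<open>N\<close> cancel, so the bound does not
    depend on \<open>\<delta>\<close>.\<close>
  define C where "C = unit_ball_vol (real d) * (L * d * r / 2) ^ d * 2 ^ d"
  have content: "hausdorff_content d \<delta> A \<le> ennreal C" if "0 < \<delta>" for \<delta>
  proof -
    obtain N0 where "L * d * r / \<delta> < real N0" using reals_Archimedean2 by blast
    then have "L * d * r / \<delta> < real (Suc N0)" "0 < Suc N0" by simp_all
    then obtain N :: nat where N: "L * d * r / \<delta> < real N" "0 < N" by blast
    define s where "s = r / real N"
    have s: "0 < s" using assms N unfolding s_def by simp
    define cell where "cell = (\<lambda>g. {y\<in>A. \<forall>e\<in>K. \<lfloor>(e \<bullet> y) / s\<rfloor> = g e})"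
    define G where "G = K \<rightarrow>\<^sub>E {- int N..<int N}"
    have finG: "finite G" unfolding G_def using assms by (simp add: finite_PiE)
    have cardG: "card G = (2 * N) ^ d" unfolding G_def d_def using assms by (simp add: card_PiE nat_mult_distrib power_mult_distrib)
    have diam: "dist y z \<le> L * d * s" if "y \<in> cell g" "z \<in> cell g" for y z g
    proof -
      have "\<bar>e \<bullet> (y - z)\<bar> \<le> s" if "e \<in> K" for e
      proof -
        have "\<lfloor>(e \<bullet> y) / s\<rfloor> = \<lfloor>(e \<bullet> z) / s\<rfloor>" using \<open>y \<in> cell g\<close> \<open>z \<in> cell g\<close> that unfolding cell_def by auto
        then have "\<bar>(e \<bullet> y) / s - (e \<bullet> z) / s\<bar> \<le> 1" by linarith
        then have "\<bar>e \<bullet> (y - z)\<bar> / s \<le> 1" using s by (simp add: inner_diff_right diff_divide_distrib[symmetric])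
        then show ?thesis using s by (simp add: divide_le_eq)
      qed
      then have "(\<Sum>e\<in>K. \<bar>e \<bullet> (y - z)\<bar>) \<le> d * s" unfolding d_def
        using sum_bounded_above[of K "\<lambda>e. \<bar>e \<bullet> (y - z)\<bar>" s] by simp
      then have "L * (\<Sum>e\<in>K. \<bar>e \<bullet> (y - z)\<bar>) \<le> L * (d * s)" using assms by (intro mult_left_mono) auto
      then show ?thesis using lip[of y z] that unfolding cell_def by (auto simp: dist_norm mult_ac)
    qed
    have diam': "bounded (cell g)" "diameter (cell g) \<le> L * d * s" for g
    proof -
      show "bounded (cell g)" unfolding bounded_two_points using diam by blast
      show "diameter (cell g) \<le> L * d * s"
        by (rule diameter_le) (use assms s diam in \<open>auto simp: dist_norm\<close>)
    qed
    have le\<delta>: "L * d * s \<le> \<delta>"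
      using N that unfolding s_def by (simp add: field_simps)
    obtain h where h: "bij_betw h {..<card G} G" using finG ex_bij_betw_nat_finite[of G] by (metis atLeast0LessThan)
    define D where "D = (\<lambda>i. if i < card G then cell (h i) else {})"
    have "A \<subseteq> (\<Union>i. D i)"
    proof
      fix y assume y: "y \<in> A"
      define g where "g = (\<lambda>e\<in>K. \<lfloor>(e \<bullet> y) / s\<rfloor>)"
      have "g \<in> G" unfolding G_def g_def restrict_PiE_iff
      proof
        fix e assume e: "e \<in> K"
        have "\<bar>(e \<bullet> y) / s\<bar> < real N"
          using bound[OF y e] s assms N unfolding s_def by (simp add: field_simps abs_mult)
        then have "- real N \<le> (e \<bullet> y) / s" "(e \<bullet> y) / s < real N" by linarith+
        then show "\<lfloor>(e \<bullet> y) / s\<rfloor> \<in> {- int N..<int N}"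
          using e by (simp add: le_floor_iff floor_less_iff)
      qed
      then have "g \<in> h ` {..<card G}" using h by (simp add: bij_betw_def)
      then obtain i where "i < card G" "h i = g" by blast
      then have "y \<in> D i" unfolding D_def cell_def g_def using y by simp
      then show "y \<in> (\<Union>i. D i)" by blast
    qed
    moreover have "bounded (D i)" "diameter (D i) \<le> \<delta>" for i
      unfolding D_def using diam'[of "h i"] le\<delta> that by (auto intro: order_trans)
    ultimately have "hausdorff_content d \<delta> A \<le> (\<Sum>i. hausdorff_gauge d (D i))"
      by (rule hausdorff_content_le)
    also have "\<dots> = (\<Sum>i<card G. hausdorff_gauge d (D i))"
      by (rule suminf_finite) (auto simp: D_def hausdorff_gauge_def)
    also have "\<dots> \<le> (\<Sum>i<card G. ennreal (unit_ball_vol (real d) * (L * d * s / 2) ^ d))"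
    proof (rule sum_mono)
      fix i
      have "unit_ball_vol (real d) * (diameter (D i) / 2) ^ d \<le> unit_ball_vol (real d) * (L * d * s / 2) ^ d"
        if "i < card G" using that diam'[of "h i"] diameter_ge_0[OF diam'(1)[of "h i"]]
        unfolding D_def by (intro mult_left_mono power_mono) auto
      then show "i \<in> {..<card G} \<Longrightarrow> hausdorff_gauge d (D i) \<le> ennreal (unit_ball_vol (real d) * (L * d * s / 2) ^ d)"
        unfolding hausdorff_gauge_def by (auto intro: ennreal_leI)
    qed
    also have "\<dots> = ennreal (real (card G) * (unit_ball_vol (real d) * (L * d * s / 2) ^ d))"
      using assms s by (simp add: ennreal_mult' ennreal_of_nat_eq_real_of_nat)
    also have "real (card G) * (unit_ball_vol (real d) * (L * d * s / 2) ^ d) = C"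
      unfolding cardG C_def s_def using N by (simp add: power_mult_distrib power_divide)
    finally show ?thesis .
  qed
  have "hausdorff d A \<le> ennreal C"
    unfolding hausdorff_def by (rule SUP_least) (use content in auto)
  then show ?thesis unfolding d_def using ennreal_less_top order.strict_trans1 by blast
qed

section \<open>Strict differentiability\<close>

text \<open>Differentiability at \<open>x\<close> would only compare \<open>x\<close> with nearby
  points; here two arbitrary points near \<open>x\<close> are compared. By continuity of the
  gradient, \<open>f\<close> minus its linear part at \<open>x\<close> has a gradient of norm at
  most \<open>e\<close> on a ball, and the ball is convex.\<close>

lemma strict_derivative:
  fixes f :: "real^'n::finite \<Rightarrow> real"
  assumes "open U" "x \<in> U" "smooth_on U f" "0 < e"
  obtains d where "0 < d" "ball x d \<subseteq> U"
    "\<And>y z. y \<in> ball x d \<Longrightarrow> z \<in> ball x d \<Longrightarrow> \<bar>f y - f z - (\<chi> k. partial k f x) \<bullet> (y - z)\<bar> \<le> e * norm (y - z)"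
proof -
  define g where "g = (\<lambda>y. \<chi> k. partial k f y)"
  have der: "(f has_derivative (\<lambda>v. g y \<bullet> v)) (at y)" if "y \<in> U" for y
  proof -
    have lin: "linear (frechet_derivative f (at y))"
      using linear_frechet_derivative smooth_on_differentiable assms(3) that by blast
    have "frechet_derivative f (at y) v = g y \<bullet> v" for v
    proof -
      have "frechet_derivative f (at y) v = frechet_derivative f (at y) (\<Sum>k\<in>UNIV. v $ k *\<^sub>R axis k 1)"
        by (simp add: basis_expansion flip: scalar_mult_eq_scaleR)
      also have "\<dots> = (\<Sum>k\<in>UNIV. v $ k * partial k f y)"
        by (simp add: linear_sum[OF lin] linear_scale[OF lin] partial_def)
      also have "\<dots> = g y \<bullet> v" by (simp add: g_def inner_vec_def mult.commute)
      finally show ?thesis .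
    qed
    then have "frechet_derivative f (at y) = (\<lambda>v. g y \<bullet> v)" by blast
    then show ?thesis using smooth_on_differentiable[OF assms(3) that] frechet_derivative_works by metis
  qed
  have "continuous_on U g" unfolding g_def
    by (intro continuous_on_vec_lambda smooth_on_continuous smooth_on_partial assms)
  then have "continuous (at x) g" using assms by (simp add: continuous_on_eq_continuous_at)
  then obtain d1 where d1: "0 < d1" "\<And>y. dist y x < d1 \<Longrightarrow> dist (g y) (g x) < e"
    using assms(4) unfolding continuous_at_eps_delta by metis
  obtain d2 where d2: "0 < d2" "ball x d2 \<subseteq> U" using assms openE by metis
  define d where "d = min d1 d2"
  show ?thesis
  proof (rule that[of d])
    show "0 < d" "ball x d \<subseteq> U" using d1 d2 unfolding d_def by auto
    fix y z assume yz: "y \<in> ball x d" "z \<in> ball x d"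
    have "norm ((\<lambda>y. f y - g x \<bullet> y) y - (\<lambda>y. f y - g x \<bullet> y) z) \<le> e * norm (y - z)"
    proof (rule differentiable_bound[of "ball x d" _ "\<lambda>y v. g y \<bullet> v - g x \<bullet> v"])
      fix w assume w: "w \<in> ball x d"
      then have "w \<in> U" using d2 unfolding d_def by auto
      then show "((\<lambda>y. f y - g x \<bullet> y) has_derivative (\<lambda>v. g w \<bullet> v - g x \<bullet> v)) (at w within ball x d)"
        by (rule has_derivative_at_withinI[OF has_derivative_diff[OF der
              bounded_linear.has_derivative[OF bounded_linear_inner_right has_derivative_ident]]])
      have "norm (g w - g x) \<le> e" using d1(2)[of w] w unfolding d_def by (simp add: dist_norm norm_minus_commute)
      then show "onorm (\<lambda>v. g w \<bullet> v - g x \<bullet> v) \<le> e"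
        by (intro onorm_le order_trans[OF _ mult_right_mono[of "norm (g w - g x)" e]])
          (auto simp: inner_diff_left[symmetric] Cauchy_Schwarz_ineq2)
    qed (use yz in auto)
    then show "\<bar>f y - f z - (\<chi> k. partial k f x) \<bullet> (y - z)\<bar> \<le> e * norm (y - z)"
      by (simp add: inner_diff_right g_def algebra_simps)
  qed
qed

lemma strict_derivative_finite:
  fixes f :: "'i \<Rightarrow> real^'n::finite \<Rightarrow> real"
  assumes "open U" "x \<in> U" "finite J" "\<And>j. j \<in> J \<Longrightarrow> smooth_on U (f j)" "0 < e"
  shows "\<exists>d>0. ball x d \<subseteq> U \<and> (\<forall>j\<in>J. \<forall>y\<in>ball x d. \<forall>z\<in>ball x d.
    \<bar>f j y - f j z - (\<chi> k. partial k (f j) x) \<bullet> (y - z)\<bar> \<le> e * norm (y - z))"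
  using assms(3,4)
proof (induction J)
  case empty
  then show ?case using assms by (metis ball_empty empty_iff openE)
next
  case (insert j J)
  then obtain d where d: "d>0" "ball x d \<subseteq> U" "\<forall>j\<in>J. \<forall>y\<in>ball x d. \<forall>z\<in>ball x d.
    \<bar>f j y - f j z - (\<chi> k. partial k (f j) x) \<bullet> (y - z)\<bar> \<le> e * norm (y - z)" by auto
  have "smooth_on U (f j)" using insert.prems by simp
  from strict_derivative[OF assms(1,2) this assms(5)]
  obtain d' where d': "0 < d'" "\<And>y z. y \<in> ball x d' \<Longrightarrow> z \<in> ball x d' \<Longrightarrow>
      \<bar>f j y - f j z - (\<chi> k. partial k (f j) x) \<bullet> (y - z)\<bar> \<le> e * norm (y - z)"
    by metis
  show ?case
    by (rule exI[of _ "min d d'"]) (use d d' in auto)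
qed

section \<open>Local finiteness of surface measure and Lagrange multipliers\<close>

text \<open>The geometry is separated from the exterior algebra: real functions with gradient
  vectors, and no order on the coordinate indices. Orthonormality is available on \<open>M\<close>
  only.\<close>

locale orthonormal_level_set =
  fixes M U :: "(real^'n::finite) set" and J :: "'i set" and f :: "'i \<Rightarrow> real^'n \<Rightarrow> real"
  assumes open_U: "open U" and finite_J: "finite J"
    and smooth_f: "\<And>j. j \<in> J \<Longrightarrow> smooth_on U (f j)"
    and level_set: "M \<inter> U = {y\<in>U. \<forall>j\<in>J. f j y = 0}"
    and orthonormal: "\<And>x i j. x \<in> M \<inter> U \<Longrightarrow> i \<in> J \<Longrightarrow> j \<in> J \<Longrightarrow>
      (\<chi> k. partial k (f i) x) \<bullet> (\<chi> k. partial k (f j) x) = (if i = j then 1 else 0)"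
begin

abbreviation "grad \<equiv> \<lambda>j x. \<chi> k. partial k (f j) x"

lemma closedin_level_set: "closedin (top_of_set U) (M \<inter> U)"
proof -
  have "closedin (top_of_set U) {y\<in>U. f j y = 0}" if "j \<in> J" for j
    using smooth_on_continuous[OF smooth_f[OF that]] continuous_closedin_preimage_constant by blast
  moreover have "M \<inter> U = U \<inter> (\<Inter>j\<in>J. {y\<in>U. f j y = 0})" unfolding level_set by auto
  ultimately show ?thesis
    by (cases "J = {}") (auto intro!: closedin_Inter closedin_Int)
qed

text \<open>\<open>K\<close> is an orthonormal basis of the tangent space. Together with the
  gradients it is one of the whole space, and a norm is at most the sum of the absolute
  coordinates.\<close>

lemma tangent_basis:
  assumes x: "x \<in> M \<inter> U"
  obtains K where "finite K" "card K = CARD('n) - card J"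
    "\<And>v. norm v \<le> (\<Sum>e\<in>K. \<bar>e \<bullet> v\<bar>) + (\<Sum>j\<in>J. \<bar>grad j x \<bullet> v\<bar>)" "\<And>e. e \<in> K \<Longrightarrow> norm e = 1"
proof -
  let ?g = "\<lambda>j. grad j x"
  have inj: "inj_on ?g J"
  proof (rule inj_onI)
    fix i j assume "i \<in> J" "j \<in> J" "?g i = ?g j"
    then show "i = j" using orthonormal[OF x, of i j] orthonormal[OF x, of i i] by (auto split: if_splits)
  qed
  have nz: "0 \<notin> ?g ` J"
  proof
    assume "0 \<in> ?g ` J"
    then obtain j where "j \<in> J" "?g j = 0" by auto
    then show False using orthonormal[OF x, of j j] by simp
  qed
  have "pairwise orthogonal (?g ` J)"
    unfolding pairwise_def orthogonal_def using orthonormal[OF x] by fastforce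
  then have indep: "independent (?g ` J)" using nz by (rule pairwise_orthogonal_independent)
  define T where "T = {y\<in>UNIV. \<forall>v\<in>span (?g ` J). orthogonal v y}"
  have T: "subspace T" unfolding T_def
    using subspace_orthogonal_to_vectors[of "span (?g ` J)"] by (simp add: orthogonal_commute)
  have "dim T + dim (span (?g ` J)) = CARD('n)"
    unfolding T_def using dim_subspace_orthogonal_to_vectors[of "span (?g ` J)" UNIV] by simp
  then have dimT: "dim T = CARD('n) - card J"
    using indep inj by (simp add: dim_eq_card_independent card_image)
  obtain K where K: "K \<subseteq> T" "pairwise orthogonal K" "\<And>e. e \<in> K \<Longrightarrow> norm e = 1"
      "independent K" "card K = dim T" "span K = T"
    using orthonormal_basis_subspace[OF T] by metis
  have finK: "finite K" using K(4) independent_imp_finite by blast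
  have "norm v \<le> (\<Sum>e\<in>K. \<bar>e \<bullet> v\<bar>) + (\<Sum>j\<in>J. \<bar>?g j \<bullet> v\<bar>)" for v
  proof -
    define w where "w = v - (\<Sum>j\<in>J. (?g j \<bullet> v) *\<^sub>R ?g j)"
    have orth: "?g i \<bullet> w = 0" if "i \<in> J" for i
    proof -
      have "?g i \<bullet> (\<Sum>j\<in>J. (?g j \<bullet> v) *\<^sub>R ?g j) = (\<Sum>j\<in>J. if i = j then ?g j \<bullet> v else 0)"
        unfolding inner_sum_right using orthonormal[OF x that] by (intro sum.cong) auto
      then show ?thesis using that finite_J unfolding w_def by (simp add: inner_diff_right)
    qed
    have "w \<in> T"
    proof -
      have "\<forall>v\<in>span (?g ` J). orthogonal v w"
      proof
        fix u assume "u \<in> span (?g ` J)"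
        then show "orthogonal u w"
          by (rule span_induct) (use orth in \<open>auto simp: orthogonal_def subspace_def inner_add_left\<close>)
      qed
      then show ?thesis unfolding T_def by simp
    qed
    have ew: "e \<bullet> w = e \<bullet> v" if "e \<in> K" for e
    proof -
      have "?g j \<bullet> e = 0" if "j \<in> J" for j
        using K(1) \<open>e \<in> K\<close> that unfolding T_def orthogonal_def by (auto intro: span_base)
      then show ?thesis unfolding w_def by (simp add: inner_diff_right inner_sum_right inner_commute)
    qed
    have "w = (\<Sum>e\<in>K. (e \<bullet> w) *\<^sub>R e)"
    proof -
      define z where "z = w - (\<Sum>e\<in>K. (e \<bullet> w) *\<^sub>R e)"
      have "e \<bullet> z = 0" if "e \<in> K" for e
      proof -
        have "e \<bullet> (\<Sum>a\<in>K. (a \<bullet> w) *\<^sub>R a) = (\<Sum>a\<in>K. if e = a then a \<bullet> w else 0)"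
          unfolding inner_sum_right
          using K(2) K(3)[of e] that by (intro sum.cong) (auto simp: pairwise_def orthogonal_def norm_eq_1)
        then show ?thesis using that finK unfolding z_def by (simp add: inner_diff_right)
      qed
      moreover have "z \<in> span K" unfolding z_def
        by (intro span_diff span_sum span_scale) (use \<open>w \<in> T\<close> K span_base in auto)
      ultimately have "z \<bullet> z = 0"
        using orthogonal_to_span[of z K z] by (auto simp: orthogonal_def inner_commute)
      then show ?thesis unfolding z_def by simp
    qed
    then have wK: "(\<Sum>e\<in>K. (e \<bullet> v) *\<^sub>R e) = w" by (simp add: ew)
    have "v = (\<Sum>e\<in>K. (e \<bullet> v) *\<^sub>R e) + (\<Sum>j\<in>J. (?g j \<bullet> v) *\<^sub>R ?g j)"
      unfolding wK w_def by simp
    from order_trans[OF eq_refl[OF arg_cong[OF this, of norm]] norm_triangle_ineq]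
    have "norm v \<le> norm (\<Sum>e\<in>K. (e \<bullet> v) *\<^sub>R e) + norm (\<Sum>j\<in>J. (?g j \<bullet> v) *\<^sub>R ?g j)" .
    also have "\<dots> \<le> (\<Sum>e\<in>K. norm ((e \<bullet> v) *\<^sub>R e)) + (\<Sum>j\<in>J. norm ((?g j \<bullet> v) *\<^sub>R ?g j))"
      by (intro add_mono norm_sum)
    also have "\<dots> = (\<Sum>e\<in>K. \<bar>e \<bullet> v\<bar>) + (\<Sum>j\<in>J. \<bar>?g j \<bullet> v\<bar>)"
      using K(3) orthonormal[OF x] by (auto simp: norm_eq_sqrt_inner intro!: arg_cong2[where f="(+)"] sum.cong)
    finally show ?thesis .
  qed
  then show ?thesis using that[of K] finK K dimT by simp
qed

text \<open>Each \<open>f j\<close> vanishes at both of two points of \<open>M\<close>, so strict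
  differentiability makes the normal coordinates of their difference small. The tangential
  coordinates then control the distance with constant 2, as the grid covering demands.\<close>

lemma locally_finite_hausdorff:
  assumes x: "x \<in> M \<inter> U"
  obtains V where "open V" "x \<in> V" "hausdorff (CARD('n) - card J) (V \<inter> M) < top"
proof -
  obtain K where K: "finite K" "card K = CARD('n) - card J"
    "\<And>v. norm v \<le> (\<Sum>e\<in>K. \<bar>e \<bullet> v\<bar>) + (\<Sum>j\<in>J. \<bar>grad j x \<bullet> v\<bar>)" "\<And>e. e \<in> K \<Longrightarrow> norm e = 1"
    using tangent_basis[OF x] by metis
  \<comment> \<open>The normal coordinates together may take up at most half of the norm; the
    summand 1 covers an empty \<open>J\<close>.\<close>
  define e where "e = 1 / (2 * real (card J) + 1)"
  have e: "0 < e" "card J * e \<le> 1 / 2" unfolding e_def by (auto simp: field_simps)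
  obtain d where d: "d>0" "ball x d \<subseteq> U" "\<forall>j\<in>J. \<forall>y\<in>ball x d. \<forall>z\<in>ball x d.
    \<bar>f j y - f j z - (\<chi> k. partial k (f j) x) \<bullet> (y - z)\<bar> \<le> e * norm (y - z)"
    using strict_derivative_finite[where f=f, OF open_U _ finite_J smooth_f e(1), of x] x by blast
  have "hausdorff (card K) (ball x d \<inter> M) < top"
  proof (rule hausdorff_finite_of_coordinates[OF K(1), of 2 "norm x + d"])
    fix y e assume "y \<in> ball x d \<inter> M" "e \<in> K"
    then show "\<bar>e \<bullet> y\<bar> < norm x + d"
      using Cauchy_Schwarz_ineq2[of e y] K(4) norm_triangle_sub[of y x] by (auto simp: dist_norm norm_minus_commute)
  next
    fix y z assume yz: "y \<in> ball x d \<inter> M" "z \<in> ball x d \<inter> M"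
    have "\<bar>grad j x \<bullet> (y - z)\<bar> \<le> e * norm (y - z)" if "j \<in> J" for j
    proof -
      have "f j y = 0" "f j z = 0" using level_set yz d(2) that by blast+
      then show ?thesis using d(3) yz that by fastforce
    qed
    then have "(\<Sum>j\<in>J. \<bar>grad j x \<bullet> (y - z)\<bar>) \<le> card J * (e * norm (y - z))"
      using sum_bounded_above[of J "\<lambda>j. \<bar>grad j x \<bullet> (y - z)\<bar>"] by blast
    also have "\<dots> \<le> 1 / 2 * norm (y - z)" using mult_right_mono[OF e(2), of "norm (y - z)"] by (simp add: mult.assoc)
    finally show "norm (y - z) \<le> 2 * (\<Sum>e\<in>K. \<bar>e \<bullet> (y - z)\<bar>)" using K(3)[of "y - z"] by linarith
  qed (use d in \<open>auto intro: add_nonneg_pos\<close>)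
  then show ?thesis using that[of "ball x d"] d K by simp
qed

text \<open>A point of \<open>C\<close> off \<open>M\<close> has a neighbourhood missing
  \<open>M\<close>, because \<open>M\<close> is closed in \<open>U\<close>; compactness leaves
  finitely many neighbourhoods.\<close>

lemma compact_finite_hausdorff:
  assumes "compact C" "C \<subseteq> U"
  shows "hausdorff (CARD('n) - card J) (C \<inter> M) < top"
proof -
  let ?h = "hausdorff (CARD('n) - card J)"
  have "\<exists>V. open V \<and> x \<in> V \<and> ?h (V \<inter> M) < top" if "x \<in> C" for x
  proof (cases "x \<in> M")
    case True
    then show ?thesis using locally_finite_hausdorff[of x] that assms by blast
  next
    case False
    have "openin (top_of_set U) (U - M \<inter> U)" using closedin_level_set by (simp add: closedin_def)
    then have "open (U - M)" using openin_open_trans[OF _ open_U] by (simp add: Diff_Int)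
    moreover have "x \<in> U - M" using that assms False by auto
    moreover have "(U - M) \<inter> M = {}" by auto
    ultimately show ?thesis by (metis hausdorff_empty ennreal_zero_less_top)
  qed
  then obtain V where V: "\<And>x. x \<in> C \<Longrightarrow> open (V x) \<and> x \<in> V x \<and> ?h (V x \<inter> M) < top" by metis
  obtain D where D: "D \<subseteq> C" "finite D" "C \<subseteq> (\<Union>x\<in>D. V x)"
    using compactE_image[OF assms(1), of C V] V by blast
  have "?h ((\<Union>x\<in>D. V x) \<inter> M) < top"
    using D(2,1)
  proof (induction D)
    case empty
    then show ?case by (simp add: hausdorff_empty)
  next
    case (insert x D)
    have "?h ((\<Union>x\<in>insert x D. V x) \<inter> M) \<le> ?h (V x \<inter> M) + ?h ((\<Union>x\<in>D. V x) \<inter> M)"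
      using hausdorff_subadditive[of _ "V x \<inter> M" "(\<Union>x\<in>D. V x) \<inter> M"] by (simp add: Int_Un_distrib2)
    also have "\<dots> < top" using insert V by (simp add: ennreal_add_less_top)
    finally show ?case .
  qed
  moreover have "?h (C \<inter> M) \<le> ?h ((\<Union>x\<in>D. V x) \<inter> M)" by (rule hausdorff_mono) (use D in auto)
  ultimately show ?thesis by (rule order.strict_trans1[rotated])
qed

text \<open>The map \<open>y \<mapsto> (y - x) + \<Sum>\<^sub>j (f\<^sub>j(y) - grad f\<^sub>j(x) \<bullet> (y - x)) grad f\<^sub>j(x)\<close> has derivative \<open>id\<close> at \<open>x\<close> and
  sends points over the tangent space to points of \<open>M\<close>; it is open at \<open>x\<close>.\<close>

lemma tangent_approximation:
  assumes x: "x \<in> M \<inter> U" and v: "\<And>j. j \<in> J \<Longrightarrow> grad j x \<bullet> v = 0" and "0 < e" "0 < r"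
  obtains y t where "y \<in> M \<inter> U" "y \<noteq> x \<or> v = 0" "dist y x < r" "0 < t"
    "norm (y - x - t *\<^sub>R v) \<le> e * norm (y - x)"
proof -
  define e' where "e' = e / (real (card J) + 1)"
  have e': "0 < e'" "card J * e' \<le> e" unfolding e'_def using assms by (auto simp: field_simps)
  obtain d where d: "d>0" "ball x d \<subseteq> U" "\<forall>j\<in>J. \<forall>y\<in>ball x d. \<forall>z\<in>ball x d.
    \<bar>f j y - f j z - (\<chi> k. partial k (f j) x) \<bullet> (y - z)\<bar> \<le> e' * norm (y - z)"
    using strict_derivative_finite[where f=f, OF open_U _ finite_J smooth_f e'(1), of x] x by blast
  have fx: "f j x = 0" if "j \<in> J" for j using x level_set that by blast
  define R where "R = (\<lambda>y. \<Sum>j\<in>J. (f j y - grad j x \<bullet> (y - x)) *\<^sub>R grad j x)"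
  define \<Phi> where "\<Phi> = (\<lambda>y. (y - x) + R y)"
  have normg: "norm (grad j x) = 1" if "j \<in> J" for j
    using orthonormal[OF x that that] by (simp add: norm_eq_1)
  have "x \<in> U" using x by simp
  have der: "(f j has_derivative (\<lambda>v. grad j x \<bullet> v)) (at x)" if j: "j \<in> J" for j
    unfolding has_derivative_within_alt2
  proof (intro conjI allI impI bounded_linear_inner_right)
    fix \<epsilon> :: real assume "0 < \<epsilon>"
    obtain d where "0 < d" "\<And>y z. y \<in> ball x d \<Longrightarrow> z \<in> ball x d \<Longrightarrow> \<bar>f j y - f j z - grad j x \<bullet> (y - z)\<bar> \<le> \<epsilon> * norm (y - z)"
      using strict_derivative[OF open_U \<open>x \<in> U\<close> smooth_f[OF j] \<open>0 < \<epsilon>\<close>] by metis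
    then show "\<forall>\<^sub>F y in at x. norm (f j y - f j x - grad j x \<bullet> (y - x)) \<le> \<epsilon> * norm (y - x)"
      unfolding eventually_at by (auto simp: dist_commute intro!: exI[of _ d])
  qed
  \<comment> \<open>The linear part of the correction \<open>R\<close> cancels at \<open>x\<close>,
    which leaves the identity.\<close>
  have "(\<Phi> has_derivative (\<lambda>v. v - 0 + (\<Sum>j\<in>J. (grad j x \<bullet> v - grad j x \<bullet> (v - 0)) *\<^sub>R grad j x))) (at x)"
    unfolding \<Phi>_def R_def
    by (intro has_derivative_add has_derivative_diff has_derivative_ident has_derivative_const
        has_derivative_sum has_derivative_scaleR_left der has_derivative_inner_right)
  then have der\<Phi>: "(\<Phi> has_derivative id) (at x)" by (simp add: id_def)
  have cont: "continuous_on (ball x d) \<Phi>"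
    unfolding \<Phi>_def R_def
    by (intro continuous_intros continuous_on_subset[OF smooth_on_continuous[OF smooth_f] d(2)])
  define s where "s = min d r"
  have s: "0 < s" using d assms unfolding s_def by simp
  \<comment> \<open>Sussmann's open mapping theorem asks for continuity nearby and a
    right-invertible derivative at the single point \<open>x\<close>.\<close>
  have "\<Phi> x \<in> interior (\<Phi> ` ball x s)"
    by (rule sussmann_open_mapping[OF open_ball cont _ der\<Phi>, of id])
      (use d s in \<open>auto simp: s_def bounded_linear_ident id_def subset_eq interior_open\<close>)
  moreover have "\<Phi> x = 0" unfolding \<Phi>_def R_def using fx by simp
  ultimately obtain \<delta> where \<delta>: "0 < \<delta>" "ball 0 \<delta> \<subseteq> \<Phi> ` ball x s"
    by (metis mem_interior)
  define t where "t = \<delta> / (2 * (norm v + 1))"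
  have t: "0 < t" unfolding t_def using \<delta> by (simp add: add_nonneg_pos)
  have "norm (t *\<^sub>R v) < \<delta>"
  proof -
    have "norm (t *\<^sub>R v) = \<delta> * (norm v / (2 * (norm v + 1)))" using t \<delta>(1) norm_ge_zero[of v] unfolding t_def by simp
    also have "\<dots> < \<delta> * 1" using \<delta> norm_ge_zero[of v] by (intro mult_strict_left_mono) (auto simp: divide_less_eq add_nonneg_pos)
    finally show ?thesis by simp
  qed
  then have "t *\<^sub>R v \<in> ball 0 \<delta>" by simp
  then have "t *\<^sub>R v \<in> \<Phi> ` ball x s" using \<delta>(2) by (rule rev_subsetD)
  then obtain y where y: "y \<in> ball x s" "\<Phi> y = t *\<^sub>R v" by auto
  have yd: "y \<in> ball x d" "dist y x < r" using y unfolding s_def by (auto simp: dist_commute)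
  \<comment> \<open>In \<open>grad i x \<bullet> \<Phi> y\<close> the gradient terms cancel and
    \<open>f i y\<close> is left; it vanishes because \<open>\<Phi> y\<close> is a multiple of the
    tangent vector \<open>v\<close>.\<close>
  have "f i y = 0" if "i \<in> J" for i
  proof -
    have "grad i x \<bullet> R y = (\<Sum>j\<in>J. if i = j then f j y - grad j x \<bullet> (y - x) else 0)"
      unfolding R_def inner_sum_right using orthonormal[OF x that] by (intro sum.cong) auto
    then have "grad i x \<bullet> \<Phi> y = f i y" using that finite_J unfolding \<Phi>_def by (simp add: inner_add_right)
    then show ?thesis using y v[OF that] by simp
  qed
  then have yM: "y \<in> M \<inter> U" unfolding level_set using yd d by auto
  have "norm (R y) \<le> (\<Sum>j\<in>J. norm ((f j y - grad j x \<bullet> (y - x)) *\<^sub>R grad j x))"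
    unfolding R_def by (rule norm_sum)
  also have "\<dots> \<le> card J * (e' * norm (y - x))"
  proof (rule sum_bounded_above)
    fix j assume j: "j \<in> J"
    then have "\<bar>f j y - f j x - grad j x \<bullet> (y - x)\<bar> \<le> e' * norm (y - x)" using d yd by auto
    then show "norm ((f j y - grad j x \<bullet> (y - x)) *\<^sub>R grad j x) \<le> e' * norm (y - x)"
      using normg[OF j] fx[OF j] by simp
  qed
  also have "\<dots> \<le> e * norm (y - x)" using mult_right_mono[OF e'(2), of "norm (y - x)"] by (simp add: mult.assoc)
  finally have "norm (R y) \<le> e * norm (y - x)" .
  moreover have "y - x - t *\<^sub>R v = - R y" using y unfolding \<Phi>_def by (simp add: algebra_simps)
  ultimately have "norm (y - x - t *\<^sub>R v) \<le> e * norm (y - x)" by simp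
  moreover have "y \<noteq> x \<or> v = 0" using y t \<open>\<Phi> x = 0\<close> by auto
  ultimately show ?thesis using that yM yd t by blast
qed

text \<open>Lagrange multipliers. If the gradient of \<open>g\<close> had a tangential part
  \<open>v\<close>, a point of \<open>M\<close> reached from \<open>x\<close> nearly along
  \<open>v\<close> would change \<open>g\<close> to first order by
  \<open>t * (norm v)\<^sup>2\<close>, although \<open>g\<close> is constant on
  \<open>M \<inter> U\<close>.\<close>

lemma gradient_normal:
  assumes x: "x \<in> M \<inter> U" and g: "smooth_on U g" "\<And>y. y \<in> M \<inter> U \<Longrightarrow> g y = c"
  shows "(\<chi> k. partial k g x) = (\<Sum>j\<in>J. (grad j x \<bullet> (\<chi> k. partial k g x)) *\<^sub>R grad j x)"
proof -
  let ?G = "\<chi> k. partial k g x"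
  define v where "v = ?G - (\<Sum>j\<in>J. (grad j x \<bullet> ?G) *\<^sub>R grad j x)"
  have orth: "grad i x \<bullet> v = 0" if "i \<in> J" for i
  proof -
    have "grad i x \<bullet> (\<Sum>j\<in>J. (grad j x \<bullet> ?G) *\<^sub>R grad j x) = (\<Sum>j\<in>J. if i = j then grad j x \<bullet> ?G else 0)"
      unfolding inner_sum_right using orthonormal[OF x that] by (intro sum.cong) auto
    then show ?thesis using that finite_J unfolding v_def by (simp add: inner_diff_right)
  qed
  have Gv: "?G \<bullet> v = v \<bullet> v"
  proof -
    have "(\<Sum>j\<in>J. (grad j x \<bullet> ?G) *\<^sub>R grad j x) \<bullet> v = 0" by (simp add: inner_sum_left orth)
    then show ?thesis unfolding v_def by (simp add: inner_diff_left)
  qed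
  have "norm v = 0"
  proof (rule ccontr)
    assume nz: "norm v \<noteq> 0"
    define q where "q = norm ?G + 1"
    have q: "0 < q" unfolding q_def by (simp add: add_nonneg_pos)
    \<comment> \<open>\<open>e \<le> 1/2\<close> gives
      \<open>norm (y - x) \<le> 2 * (t * norm v)\<close>, and \<open>e * q \<le> norm v / 4\<close>
      then bounds \<open>t * (norm v * norm v)\<close> by half of itself.\<close>
    define e where "e = min (1/2) (norm v / (4 * q))"
    have e: "0 < e" "e \<le> 1/2" unfolding e_def using nz q by simp_all
    have "e * q \<le> norm v / (4 * q) * q" unfolding e_def using q by (intro mult_right_mono) auto
    then have eq: "e * (norm ?G + 1) \<le> norm v / 4" using q by (simp flip: q_def)
    have "x \<in> U" using x by simp
    from strict_derivative[OF open_U this g(1) e(1)]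
    obtain r where r: "0 < r" "\<And>y z. y \<in> ball x r \<Longrightarrow> z \<in> ball x r \<Longrightarrow> \<bar>g y - g z - ?G \<bullet> (y - z)\<bar> \<le> e * norm (y - z)"
      by metis
    obtain y t where y: "y \<in> M \<inter> U" "y \<noteq> x \<or> v = 0" "dist y x < r" "0 < t"
        "norm (y - x - t *\<^sub>R v) \<le> e * norm (y - x)"
      using tangent_approximation[OF x orth e(1) r(1)] by metis
    have "\<bar>?G \<bullet> (y - x)\<bar> \<le> e * norm (y - x)"
      using r(2)[of y x] y r(1) g(2)[OF y(1)] g(2)[OF x] by (simp add: dist_commute)
    moreover have "\<bar>?G \<bullet> (y - x - t *\<^sub>R v)\<bar> \<le> norm ?G * (e * norm (y - x))"
      using Cauchy_Schwarz_ineq2[of ?G "y - x - t *\<^sub>R v"] y(5) mult_left_mono[of _ _ "norm ?G"] by force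
    ultimately have "\<bar>?G \<bullet> (t *\<^sub>R v)\<bar> \<le> (e * (norm ?G + 1)) * norm (y - x)"
      by (simp add: inner_diff_right algebra_simps)
    also have "\<dots> \<le> norm v / 4 * norm (y - x)" using eq by (rule mult_right_mono) simp
    finally have 1: "t * (norm v * norm v) \<le> norm v / 4 * norm (y - x)"
      using Gv y(4) by (simp add: dot_square_norm power2_eq_square abs_mult)
    have "norm (y - x) \<le> norm (y - x - t *\<^sub>R v) + norm (t *\<^sub>R v)"
      using norm_triangle_ineq[of "y - x - t *\<^sub>R v" "t *\<^sub>R v"] by simp
    also have "\<dots> \<le> 1/2 * norm (y - x) + t * norm v"
      using y(4,5) mult_right_mono[OF e(2), of "norm (y - x)"] by simp
    finally have "norm (y - x) \<le> 2 * (t * norm v)" by simp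
    then have "norm v / 4 * norm (y - x) \<le> norm v / 4 * (2 * (t * norm v))" by (rule mult_left_mono) simp
    then have "t * (norm v * norm v) \<le> t * (norm v * norm v) / 2" using 1 by (simp add: mult_ac)
    moreover have "0 < t * (norm v * norm v)" using nz y(4) by simp
    ultimately show False by linarith
  qed
  then show ?thesis unfolding v_def by simp
qed

end


section \<open>The operator \<open>D\<^sup>#\<close>\<close>

lemma bounded_linear_axis: "bounded_linear (\<lambda>c::real. axis i c)"
  by (subst linear_conv_bounded_linear[symmetric]) (auto simp: axis_def vec_eq_iff intro!: linearI)

lemma bounded_linear_scalar: "bounded_linear scalar"
  unfolding scalar_def[abs_def] by (rule bounded_linear_axis)

lemma smooth_on_nth: "open U \<Longrightarrow> smooth_on U f \<Longrightarrow> smooth_on U (\<lambda>x. f x $ i)"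
  by (rule smooth_on_linear[OF _ bounded_linear_vec_nth])

lemma smooth_on_vec:
  fixes f :: "'m::finite \<Rightarrow> real^'n::finite \<Rightarrow> real"
  assumes "open U" "\<And>i. smooth_on U (f i)"
  shows "smooth_on U (\<lambda>x. \<chi> i. f i x)"
proof -
  have "smooth_on U (\<lambda>x. \<Sum>i\<in>UNIV. f i x *\<^sub>R (axis i 1 :: real^'m))"
    by (intro smooth_on_sum assms(1) smooth_on_linear[OF assms(1) bounded_linear_scaleR_left] assms(2))
  then show ?thesis
    by (rule smooth_on_cong[OF assms(1), rotated]) (simp add: vec_eq_iff axis_def if_distrib cong: if_cong)
qed

lemma partial_nth: "f differentiable (at x) \<Longrightarrow> partial k f x $ i = partial k (\<lambda>y. f y $ i) x"
  by (rule partial_linear[OF _ bounded_linear_vec_nth, symmetric])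

lemma partial_commute_vec:
  fixes f :: "real^'n::finite \<Rightarrow> real^'m::finite"
  assumes "open U" "x \<in> U" "smooth_on U f"
  shows "partial k (partial l f) x = partial l (partial k f) x"
proof -
  have "partial k (partial l f) x $ i = partial k (partial l (\<lambda>y. f y $ i)) x" for k l i
  proof -
    have "partial k (partial l f) x $ i = partial k (\<lambda>y. partial l f y $ i) x"
      by (rule partial_nth[OF smooth_on_differentiable[OF smooth_on_partial[OF assms(3)] assms(2)]])
    also have "\<dots> = partial k (partial l (\<lambda>y. f y $ i)) x"
      by (rule partial_cong_open[OF assms(1,2)])
        (rule partial_nth[OF smooth_on_differentiable[OF assms(3)]])
    finally show ?thesis .
  qed
  then show ?thesis
    using partial_commute[OF assms(1,2) smooth_on_nth[OF assms(1,3)]] by (simp add: vec_eq_iff)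
qed

section \<open>Smoothness of the forms attached to the defining functions\<close>

lemma smooth_on_sd: "open U \<Longrightarrow> smooth_on U a \<Longrightarrow> smooth_on U (sd a)"
  unfolding sd_def
  by (intro smooth_on_sum smooth_on_bilinear[OF _ bounded_bilinear_wedge] smooth_on_const smooth_on_partial)

lemma smooth_on_sd_sharp: "open U \<Longrightarrow> smooth_on U a \<Longrightarrow> smooth_on U (sd_sharp a)"
  unfolding sd_sharp_def
  by (intro smooth_on_sum smooth_on_bilinear[OF _ bounded_bilinear_wedge] smooth_on_const smooth_on_partial)

lemma smooth_on_conormal: "open U \<Longrightarrow> smooth_on U (\<rho> j) \<Longrightarrow> smooth_on U (conormal \<rho> j)"
  unfolding conormal_def by (intro smooth_on_sd smooth_on_linear[OF _ bounded_linear_scalar])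

lemma smooth_on_Fform: "open U \<Longrightarrow> smooth_on U (\<rho> j) \<Longrightarrow> smooth_on U (Fform \<rho> j)"
  unfolding Fform_def by (intro smooth_on_sd smooth_on_linear[OF _ bounded_linear_Jop] smooth_on_conormal)

lemma smooth_on_D_sharp:
  assumes "open U" "\<And>j. j \<in> {1..p} \<Longrightarrow> smooth_on U (\<rho> j)" "smooth_on U a"
  shows "smooth_on U (D_sharp p \<rho> a)"
  unfolding D_sharp_def
  by (intro smooth_on_add smooth_on_sum smooth_on_sd_sharp smooth_on_bilinear[OF assms(1) bounded_bilinear_wedge]
      smooth_on_bilinear[OF assms(1) bounded_bilinear_contract] smooth_on_Fform smooth_on_conormal assms)

lemma smooth_on_curvature_form:
  assumes "open U" "\<And>j. j \<in> {1..p} \<Longrightarrow> smooth_on U (\<rho> j)"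
  shows "smooth_on U (curvature_form p \<rho>)"
  unfolding curvature_form_def
  by (intro smooth_on_linear[OF assms(1) bounded_linear_scaleR_right] smooth_on_sum
      smooth_on_bilinear[OF assms(1) bounded_bilinear_wedge] smooth_on_Fform assms)

lemma smooth_on_normal_form:
  assumes "open U" "\<And>j. j \<in> {1..p} \<Longrightarrow> smooth_on U (\<rho> j)"
  shows "smooth_on U (normal_form p \<rho>)"
proof -
  have "smooth_on U (\<lambda>x. foldr (\<lambda>j b. conormal \<rho> j x \<and>\<^sub>s b) js (scalar 1))" if "set js \<subseteq> {1..p}" for js
    using that
  proof (induction js)
    case Nil
    then show ?case by (simp add: smooth_on_const)
  next
    case (Cons j js)
    then have "smooth_on U (\<lambda>x. conormal \<rho> j x \<and>\<^sub>s foldr (\<lambda>j b. conormal \<rho> j x \<and>\<^sub>s b) js (scalar 1))"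
      by (intro smooth_on_bilinear[OF assms(1) bounded_bilinear_wedge] smooth_on_conormal assms) auto
    then show ?case by simp
  qed
  from this[of "[1..<Suc p]"] show ?thesis unfolding normal_form_def by (simp del: upt_Suc add: atLeastLessThanSuc_atLeastAtMost)
qed

lemma conormal_eq:
  fixes \<rho> :: "nat \<Rightarrow> real^'n::{finite,linorder} \<Rightarrow> real"
  assumes "\<rho> j differentiable (at x)"
  shows "conormal \<rho> j x = dxv (\<chi> k. partial k (\<rho> j) x)"
proof -
  have "partial k (\<lambda>x. scalar (\<rho> j x) :: 'n scovector) x = scalar (partial k (\<rho> j) x)" for k
    by (rule partial_linear[OF assms bounded_linear_scalar])
  then show ?thesis by (simp add: conormal_def sd_def dxv_def)
qed

lemma inner_dxv: "dxv u \<bullet> dxv v = u \<bullet> v"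
proof -
  have "dxv u \<bullet> dxv v = scalar 1 \<bullet> (dxv u \<rfloor> dxv v)" by (simp add: inner_contract)
  also have "\<dots> = u \<bullet> v" by (simp add: contract_dxv scalar_def inner_axis_axis)
  finally show ?thesis .
qed

section \<open>Coordinate expressions for forms of bidegree (1,1) and (1,2)\<close>

lemma bounded_linear_hessian_term: "bounded_linear (\<lambda>v. dx k \<and>\<^sub>s dxiv v)"
  by (rule bounded_linear_compose[OF bounded_bilinear.bounded_linear_right[OF bounded_bilinear_wedge] bounded_linear_dxiv])

lemma partial_hessian_form:
  assumes "\<And>k. (\<lambda>y. A k y) differentiable (at x)"
  shows "partial m (\<lambda>y. hessian_form (\<lambda>k. A k y)) x = hessian_form (\<lambda>k. partial m (A k) x)"
proof -
  have "partial m (\<lambda>y. hessian_form (\<lambda>k. A k y)) x = (\<Sum>k\<in>UNIV. partial m (\<lambda>y. dx k \<and>\<^sub>s dxiv (A k y)) x)"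
    unfolding hessian_form_def
    by (rule partial_sum) (rule differentiable_linear[OF bounded_linear_hessian_term assms])
  also have "\<dots> = hessian_form (\<lambda>k. partial m (A k) x)"
    unfolding hessian_form_def
    by (intro sum.cong refl partial_linear[OF _ bounded_linear_hessian_term] assms)
  finally show ?thesis .
qed

lemma hessian_form_scaleR: "hessian_form (\<lambda>k. c *\<^sub>R h k) = c *\<^sub>R hessian_form h"
  by (simp add: hessian_form_def dxiv_scaleR wedge_scaleR_right scaleR_sum_right)

lemma hessian_form_add: "hessian_form (\<lambda>k. g k + h k) = hessian_form g + hessian_form h"
  by (simp add: hessian_form_def dxiv_add wedge_add_right sum.distrib)

lemma hessian_form_sum: "hessian_form (\<lambda>k. \<Sum>j\<in>J. h j k) = (\<Sum>j\<in>J. hessian_form (h j))"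
  by (simp add: hessian_form_def dxiv_sum wedge_sum_right) (rule sum.swap)

text \<open>This and \<open>sum_dxi_wedge_hessian\<close> bring (1,2)-forms to a common shape in
  which the coefficients of \<open>dxi m \<and>\<^sub>s dxi l\<close> can be compared.\<close>

lemma hessian_form_wedge_dxiv:
  "hessian_form h \<and>\<^sub>s dxiv w =
    (\<Sum>k\<in>UNIV. dx k \<and>\<^sub>s (\<Sum>m\<in>UNIV. \<Sum>l\<in>UNIV. (h k $ m * w $ l) *\<^sub>R (dxi m \<and>\<^sub>s dxi l)))"
proof -
  have "dxiv u \<and>\<^sub>s dxiv w = (\<Sum>m\<in>UNIV. \<Sum>l\<in>UNIV. (u $ m * w $ l) *\<^sub>R (dxi m \<and>\<^sub>s dxi l))" for u
  proof -
    have "dxiv u \<and>\<^sub>s dxiv w = (\<Sum>m\<in>UNIV. u $ m *\<^sub>R (dxi m \<and>\<^sub>s dxiv w))"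
      by (simp add: dxiv_def[of u] wedge_sum_left wedge_scaleR_left)
    then show ?thesis
      by (simp add: dxiv_def wedge_sum_right wedge_scaleR_right scaleR_sum_right)
  qed
  then show ?thesis by (simp add: hessian_form_def wedge_sum_left wedge_assoc)
qed

text \<open>Moving \<open>dxi m\<close> behind \<open>dx k\<close> transposes the matrix and
  reverses its sign.\<close>

lemma sum_dxi_wedge_dxv:
  "(\<Sum>m\<in>UNIV. dxi m \<and>\<^sub>s dxv (B m)) = hessian_form (\<lambda>k. \<chi> m. - (B m $ k))"
proof -
  have "dxi m \<and>\<^sub>s dxv (B m) = (\<Sum>k\<in>UNIV. - (B m $ k) *\<^sub>R (dx k \<and>\<^sub>s dxi m))" for m
  proof -
    have "dxi m \<and>\<^sub>s dx k = - (dx k \<and>\<^sub>s dxi m)" for k using dxi_wedge_dx[of m k "scalar 1"] by simp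
    then show ?thesis by (simp add: dxv_def wedge_sum_right wedge_scaleR_right)
  qed
  then have "(\<Sum>m\<in>UNIV. dxi m \<and>\<^sub>s dxv (B m)) = (\<Sum>k\<in>UNIV. \<Sum>m\<in>UNIV. - (B m $ k) *\<^sub>R (dx k \<and>\<^sub>s dxi m))"
    by (simp only:) (rule sum.swap)
  then show ?thesis
    by (simp add: hessian_form_def dxiv_def wedge_sum_right wedge_scaleR_right wedge_minus_right)
qed

lemma sum_dxi_wedge_hessian:
  "(\<Sum>m\<in>UNIV. dxi m \<and>\<^sub>s hessian_form (B m)) =
    (\<Sum>k\<in>UNIV. dx k \<and>\<^sub>s (\<Sum>m\<in>UNIV. \<Sum>l\<in>UNIV. - (B m k $ l) *\<^sub>R (dxi m \<and>\<^sub>s dxi l)))"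
proof -
  have "dxi m \<and>\<^sub>s hessian_form (B m) = (\<Sum>k\<in>UNIV. dx k \<and>\<^sub>s (\<Sum>l\<in>UNIV. - (B m k $ l) *\<^sub>R (dxi m \<and>\<^sub>s dxi l)))" for m
    by (simp add: hessian_form_def dxiv_def wedge_sum_right wedge_scaleR_right wedge_minus_right dxi_wedge_dx)
  then have "(\<Sum>m\<in>UNIV. dxi m \<and>\<^sub>s hessian_form (B m)) =
      (\<Sum>k\<in>UNIV. \<Sum>m\<in>UNIV. dx k \<and>\<^sub>s (\<Sum>l\<in>UNIV. - (B m k $ l) *\<^sub>R (dxi m \<and>\<^sub>s dxi l)))"
    by (simp only:) (rule sum.swap)
  then show ?thesis by (simp add: wedge_sum_right[symmetric])
qed

section \<open>Hessians of the defining functions and the square of \<open>D_sharp\<close>\<close>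

locale defining_functions =
  fixes M U :: "(real^'n::{finite,linorder}) set" and p :: nat
    and \<rho> :: "nat \<Rightarrow> real^'n::{finite,linorder} \<Rightarrow> real"
  assumes odf: "orthonormal_defining_functions p M U \<rho>"
begin

definition \<nu> :: "nat \<Rightarrow> real^'n::{finite,linorder} \<Rightarrow> real^'n::{finite,linorder}" where "\<nu> j x = (\<chi> k. partial k (\<rho> j) x)"

definition h :: "nat \<Rightarrow> 'n \<Rightarrow> real^'n::{finite,linorder} \<Rightarrow> real^'n::{finite,linorder}" where "h j k = partial k (\<nu> j)"

text \<open>The Hessian of \<open>\<rho> j\<close> as a linear map;
  \<open>n\<^sub>i \<rfloor> F\<^sub>j\<close> is \<open>dxiv (H j x (\<nu> i x))\<close>.\<close>

definition H :: "nat \<Rightarrow> real^'n::{finite,linorder} \<Rightarrow> real^'n::{finite,linorder} \<Rightarrow> real^'n::{finite,linorder}" where "H j x v = (\<Sum>k\<in>UNIV. v $ k *\<^sub>R h j k x)"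

lemma open_U: "open U" and smooth_\<rho>: "j \<in> {1..p} \<Longrightarrow> smooth_on U (\<rho> j)"
  using odf unfolding orthonormal_defining_functions_def by auto

lemma smooth_\<nu>: "j \<in> {1..p} \<Longrightarrow> smooth_on U (\<nu> j)"
  unfolding \<nu>_def by (intro smooth_on_vec open_U smooth_on_partial smooth_\<rho>)

lemma smooth_h: "j \<in> {1..p} \<Longrightarrow> smooth_on U (h j k)"
  unfolding h_def by (intro smooth_on_partial smooth_\<nu>)

lemma conormal_\<nu>: "j \<in> {1..p} \<Longrightarrow> x \<in> U \<Longrightarrow> conormal \<rho> j x = dxv (\<nu> j x)"
  unfolding \<nu>_def by (intro conormal_eq smooth_on_differentiable[OF smooth_\<rho>])

lemma Fform_h:
  assumes "j \<in> {1..p}" "x \<in> U"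
  shows "Fform \<rho> j x = hessian_form (\<lambda>k. h j k x)"
proof -
  have "partial k (\<lambda>x. Jop (conormal \<rho> j x)) x = dxiv (h j k x)" for k
  proof -
    have "partial k (\<lambda>x. Jop (conormal \<rho> j x)) x = partial k (\<lambda>x. dxiv (\<nu> j x)) x"
      by (rule partial_cong_open[OF open_U assms(2)]) (simp add: conormal_\<nu>[OF assms(1)] Jop_dxv)
    also have "\<dots> = dxiv (h j k x)"
      unfolding h_def by (rule partial_linear[OF smooth_on_differentiable[OF smooth_\<nu>] bounded_linear_dxiv]) (use assms in auto)
    finally show ?thesis .
  qed
  then show ?thesis by (simp add: Fform_def sd_def hessian_form_def)
qed

lemma h_symmetric:
  assumes "j \<in> {1..p}" "x \<in> U"
  shows "h j k x $ l = h j l x $ k"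
proof -
  have "h j k x $ l = partial k (partial l (\<rho> j)) x" for k l
    unfolding h_def using partial_nth[OF smooth_on_differentiable[OF smooth_\<nu>[OF assms(1)] assms(2)], of k l]
    by (simp add: \<nu>_def)
  then show ?thesis using partial_commute[OF open_U assms(2) smooth_\<rho>[OF assms(1)]] by simp
qed

text \<open>A third derivative of \<open>\<rho> j\<close>: commuting the derivatives in directions
  \<open>m\<close> and \<open>k\<close> puts \<open>m\<close> and \<open>l\<close> into one Hessian,
  whose symmetry on the open set \<open>U\<close> may be differentiated.\<close>

lemma partial_h_symmetric:
  assumes "j \<in> {1..p}" "x \<in> U"
  shows "partial m (h j k) x $ l = partial l (h j k) x $ m"
proof -
  have "partial m (h j k) x $ l = partial k (h j m) x $ l" for m l
    unfolding h_def using partial_commute_vec[OF open_U assms(2) smooth_\<nu>[OF assms(1)]] by simp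
  moreover have "partial k (h j m) x $ l = partial k (h j l) x $ m" for l m
  proof -
    have "partial k (h j m) x $ l = partial k (\<lambda>y. h j m y $ l) x" for m l
      by (rule partial_nth[OF smooth_on_differentiable[OF smooth_h[OF assms(1)] assms(2)]])
    moreover have "partial k (\<lambda>y. h j m y $ l) x = partial k (\<lambda>y. h j l y $ m) x"
      by (rule partial_cong_open[OF open_U assms(2)]) (rule h_symmetric[OF assms(1)])
    ultimately show ?thesis by simp
  qed
  ultimately show ?thesis by metis
qed

lemma D_sharp_1_0:
  assumes \<alpha>: "smooth_on U \<alpha>" "\<And>y. y \<in> U \<Longrightarrow> a y = dxv (\<alpha> y)" and x: "x \<in> U"
  shows "D_sharp p \<rho> a x =
    hessian_form (\<lambda>k. (\<chi> l. - (partial l \<alpha> x $ k)) + (\<Sum>j=1..p. (\<nu> j x \<bullet> \<alpha> x) *\<^sub>R h j k x))"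
proof -
  have "partial l a x = dxv (partial l \<alpha> x)" for l
  proof -
    have "partial l a x = partial l (\<lambda>y. dxv (\<alpha> y)) x"
      by (rule partial_cong_open[OF open_U x \<alpha>(2)])
    then show ?thesis
      by (simp add: partial_linear[OF smooth_on_differentiable[OF \<alpha>(1) x] bounded_linear_dxv])
  qed
  then have "sd_sharp a x = hessian_form (\<lambda>k. \<chi> l. - (partial l \<alpha> x $ k))"
    by (simp add: sd_sharp_def sum_dxi_wedge_dxv)
  moreover have "Fform \<rho> j x \<and>\<^sub>s (conormal \<rho> j x \<rfloor> a x) = hessian_form (\<lambda>k. (\<nu> j x \<bullet> \<alpha> x) *\<^sub>R h j k x)"
    if "j \<in> {1..p}" for j
    using that x \<alpha>(2) by (simp add: Fform_h conormal_\<nu> contract_dxv hessian_form_scaleR)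
  ultimately show ?thesis
    by (simp add: D_sharp_def hessian_form_add hessian_form_sum)
qed

lemma partial_inner_\<nu>:
  assumes "j \<in> {1..p}" "x \<in> U" "smooth_on U \<alpha>"
  shows "partial l (\<lambda>y. \<nu> j y \<bullet> \<alpha> y) x = h j l x \<bullet> \<alpha> x + \<nu> j x \<bullet> partial l \<alpha> x"
  unfolding h_def
  by (rule partial_bilinear[OF smooth_on_differentiable[OF smooth_\<nu>[OF assms(1)] assms(2)]
        smooth_on_differentiable[OF assms(3,2)] bounded_bilinear_inner])

text \<open>The right-hand side is subtracted, and what remains has coefficients symmetric in the
  two \<open>dxi\<close> indices.\<close>

lemma D_sharp_square:
  assumes \<alpha>: "smooth_on U \<alpha>" "\<And>y. y \<in> U \<Longrightarrow> a y = dxv (\<alpha> y)" and x: "x \<in> U"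
  shows "D_sharp p \<rho> (D_sharp p \<rho> a) x = (\<Sum>j=1..p. hessian_form (\<lambda>k. h j k x) \<and>\<^sub>s
    dxiv (H j x (\<alpha> x) + (\<Sum>i=1..p. (\<nu> i x \<bullet> \<alpha> x) *\<^sub>R H i x (\<nu> j x))))"
proof -
  define c where "c = (\<lambda>j y. \<nu> j y \<bullet> \<alpha> y)"
  define A where "A = (\<lambda>k y. (\<chi> l. - (partial l \<alpha> y $ k)) + (\<Sum>j=1..p. c j y *\<^sub>R h j k y))"
  define w where "w = (\<lambda>j. H j x (\<alpha> x) + (\<Sum>i=1..p. c i x *\<^sub>R H i x (\<nu> j x)))"
  have smooth_c: "smooth_on U (c j)" if "j \<in> {1..p}" for j
    unfolding c_def using that by (intro smooth_on_bilinear[OF open_U bounded_bilinear_inner] smooth_\<nu> \<alpha>)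
  have smooth_A: "smooth_on U (A k)" for k
    unfolding A_def
    by (intro smooth_on_add smooth_on_sum smooth_on_bilinear[OF open_U bounded_bilinear_scaleR] smooth_on_vec
        smooth_on_linear[OF open_U bounded_linear_minus[OF bounded_linear_ident]] smooth_on_nth smooth_on_partial
        smooth_h smooth_c open_U \<alpha>)
  have diff_A: "A k differentiable (at x)" for k by (rule smooth_on_differentiable[OF smooth_A x])
  have Da: "D_sharp p \<rho> a y = hessian_form (\<lambda>k. A k y)" if "y \<in> U" for y
    unfolding A_def c_def by (rule D_sharp_1_0[OF \<alpha> that])
  have "partial m (D_sharp p \<rho> a) x = hessian_form (\<lambda>k. partial m (A k) x)" for m
  proof -
    have "partial m (D_sharp p \<rho> a) x = partial m (\<lambda>y. hessian_form (\<lambda>k. A k y)) x"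
      by (rule partial_cong_open[OF open_U x]) (rule Da)
    then show ?thesis by (simp add: partial_hessian_form[OF diff_A])
  qed
  then have 1: "sd_sharp (D_sharp p \<rho> a) x = (\<Sum>k\<in>UNIV. dx k \<and>\<^sub>s
      (\<Sum>m\<in>UNIV. \<Sum>l\<in>UNIV. - (partial m (A k) x $ l) *\<^sub>R (dxi m \<and>\<^sub>s dxi l)))"
    unfolding sd_sharp_def using sum_dxi_wedge_hessian[of "\<lambda>m k. partial m (A k) x"] by simp
  have 2: "Fform \<rho> j x \<and>\<^sub>s (conormal \<rho> j x \<rfloor> D_sharp p \<rho> a x) =
      hessian_form (\<lambda>k. h j k x) \<and>\<^sub>s dxiv (\<Sum>r\<in>UNIV. \<nu> j x $ r *\<^sub>R A r x)" if "j \<in> {1..p}" for j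
    using that x by (simp add: Fform_h conormal_\<nu> Da contract_hessian_form)
  \<comment> \<open>The coefficient of \<open>dx k \<and>\<^sub>s dxi m \<and>\<^sub>s dxi l\<close>
    in the difference of the two sides.\<close>
  define S where "S = (\<lambda>k m l. - (partial m (A k) x $ l) +
    (\<Sum>j=1..p. h j k x $ m * ((\<Sum>r\<in>UNIV. \<nu> j x $ r *\<^sub>R A r x) - w j) $ l))"
  have "D_sharp p \<rho> (D_sharp p \<rho> a) x - (\<Sum>j=1..p. hessian_form (\<lambda>k. h j k x) \<and>\<^sub>s dxiv (w j)) =
     sd_sharp (D_sharp p \<rho> a) x + (\<Sum>j=1..p. hessian_form (\<lambda>k. h j k x) \<and>\<^sub>s
       dxiv ((\<Sum>r\<in>UNIV. \<nu> j x $ r *\<^sub>R A r x) - w j))"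
    unfolding D_sharp_def[of p \<rho> "D_sharp p \<rho> a"]
    by (simp add: 2 linear_diff[OF bounded_linear.linear[OF bounded_linear_dxiv]] wedge_diff_right sum_subtractf)
  also have "\<dots> = (\<Sum>k\<in>UNIV. dx k \<and>\<^sub>s (\<Sum>m\<in>UNIV. \<Sum>l\<in>UNIV. S k m l *\<^sub>R (dxi m \<and>\<^sub>s dxi l)))"
  proof -
    have "(\<Sum>j=1..p. hessian_form (\<lambda>k. h j k x) \<and>\<^sub>s dxiv (v j)) = (\<Sum>k\<in>UNIV. dx k \<and>\<^sub>s
        (\<Sum>m\<in>UNIV. \<Sum>l\<in>UNIV. (\<Sum>j=1..p. h j k x $ m * v j $ l) *\<^sub>R (dxi m \<and>\<^sub>s dxi l)))" for v
    proof -
      have "(\<Sum>j=1..p. hessian_form (\<lambda>k. h j k x) \<and>\<^sub>s dxiv (v j)) = (\<Sum>k\<in>UNIV. dx k \<and>\<^sub>s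
        (\<Sum>j=1..p. \<Sum>m\<in>UNIV. \<Sum>l\<in>UNIV. (h j k x $ m * v j $ l) *\<^sub>R (dxi m \<and>\<^sub>s dxi l)))"
        unfolding hessian_form_wedge_dxiv wedge_sum_right[of _ _ "{1..p}"] by (rule sum.swap)
      moreover have "(\<Sum>j=1..p. \<Sum>m\<in>UNIV. \<Sum>l\<in>UNIV. (h j k x $ m * v j $ l) *\<^sub>R (dxi m \<and>\<^sub>s dxi l)) =
          (\<Sum>m\<in>UNIV. \<Sum>l\<in>UNIV. (\<Sum>j=1..p. h j k x $ m * v j $ l) *\<^sub>R (dxi m \<and>\<^sub>s dxi l))" for k
        unfolding scaleR_sum_left by (subst sum.swap, intro sum.cong refl, rule sum.swap)
      ultimately show ?thesis by (simp only:)
    qed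
    then show ?thesis unfolding 1 S_def
      by (simp only: scaleR_add_left sum.distrib wedge_add_right)
  qed
  also have "\<dots> = 0"
  proof -
    \<comment> \<open>Three groups, each symmetric in \<open>m\<close> and \<open>l\<close>: second
      derivatives of \<open>\<alpha>\<close>, third derivatives of \<open>\<rho>\<close>, and
      products of a derivative of \<open>c j\<close> with a Hessian entry.\<close>
    have S: "S k m l = partial m (partial l \<alpha>) x $ k - (\<Sum>j=1..p. c j x * partial m (h j k) x $ l)
        - (\<Sum>j=1..p. partial m (c j) x * h j k x $ l + h j k x $ m * partial l (c j) x)" for k m l
    proof -
      have "partial m (A k) x $ l = - (partial m (partial l \<alpha>) x $ k) +
        (\<Sum>j=1..p. partial m (c j) x * h j k x $ l + c j x * partial m (h j k) x $ l)"
      proof -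
        have dh: "(\<lambda>y. h j k y $ l) differentiable (at x)" and dc: "c j differentiable (at x)" if "j \<in> {1..p}" for j
          using that smooth_on_differentiable[OF smooth_on_nth[OF open_U smooth_h] x]
            smooth_on_differentiable[OF smooth_c x] by auto
        have dp: "partial l \<alpha> differentiable (at x)"
          by (rule smooth_on_differentiable[OF smooth_on_partial[OF \<alpha>(1)] x])
        have "partial m (A k) x $ l = partial m (\<lambda>y. A k y $ l) x" by (rule partial_nth[OF diff_A])
        also have "(\<lambda>y. A k y $ l) = (\<lambda>y. - (partial l \<alpha> y $ k) + (\<Sum>j=1..p. c j y * h j k y $ l))"
          by (simp add: A_def)
        also have "partial m \<dots> x = partial m (\<lambda>y. - (partial l \<alpha> y $ k)) x + partial m (\<lambda>y. \<Sum>j=1..p. c j y * h j k y $ l) x"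
          by (intro partial_add differentiable_sum ballI differentiable_linear[OF bounded_linear_minus[OF bounded_linear_vec_nth] dp]
              differentiable_mult dh dc finite_atLeastAtMost) 
        also have "partial m (\<lambda>y. - (partial l \<alpha> y $ k)) x = - (partial m (partial l \<alpha>) x $ k)"
          by (rule partial_linear[OF dp bounded_linear_minus[OF bounded_linear_vec_nth]])
        also have "partial m (\<lambda>y. \<Sum>j=1..p. c j y * h j k y $ l) x = (\<Sum>j=1..p. partial m (\<lambda>y. c j y * h j k y $ l) x)"
          by (intro partial_sum differentiable_mult dh dc)
        also have "\<dots> = (\<Sum>j=1..p. partial m (c j) x * h j k x $ l + c j x * partial m (h j k) x $ l)"
          using partial_bilinear[OF dc dh bounded_bilinear_mult]
            partial_nth[OF smooth_on_differentiable[OF smooth_h x]] by (intro sum.cong refl) simp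
        finally show ?thesis .
      qed
      \<comment> \<open>By the product rule, \<open>H j x (\<alpha> x)\<close> in \<open>w j\<close>
        completes \<open>\<nu> j x \<bullet> partial l \<alpha> x\<close> to the derivative of
        \<open>c j\<close>; the other terms of \<open>w j\<close> cancel against those of
        \<open>A\<close>.\<close>
      moreover have "((\<Sum>r\<in>UNIV. \<nu> j x $ r *\<^sub>R A r x) - w j) $ l = - partial l (c j) x" if "j \<in> {1..p}" for j
      proof -
        have "(\<Sum>r\<in>UNIV. \<nu> j x $ r *\<^sub>R A r x) $ l =
            (\<Sum>r\<in>UNIV. - (\<nu> j x $ r * partial l \<alpha> x $ r)) + (\<Sum>r\<in>UNIV. \<Sum>i=1..p. c i x * (\<nu> j x $ r * h i r x $ l))"
          by (simp add: A_def algebra_simps sum.distrib sum_distrib_left sum_subtractf sum_negf)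
        also have "(\<Sum>r\<in>UNIV. \<Sum>i=1..p. c i x * (\<nu> j x $ r * h i r x $ l)) = (\<Sum>i=1..p. c i x *\<^sub>R H i x (\<nu> j x)) $ l"
          by (subst sum.swap) (simp add: H_def sum_distrib_left)
        also have "(\<Sum>r\<in>UNIV. - (\<nu> j x $ r * partial l \<alpha> x $ r)) = - (\<nu> j x \<bullet> partial l \<alpha> x)"
          by (simp add: inner_vec_def sum_negf)
        finally have "((\<Sum>r\<in>UNIV. \<nu> j x $ r *\<^sub>R A r x) - w j) $ l = - (\<nu> j x \<bullet> partial l \<alpha> x) - H j x (\<alpha> x) $ l"
          by (simp add: w_def)
        also have "H j x (\<alpha> x) $ l = h j l x \<bullet> \<alpha> x"
          using h_symmetric[OF that x] by (simp add: H_def inner_vec_def mult.commute)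
        finally show ?thesis using partial_inner_\<nu>[OF that x \<alpha>(1)] by (simp add: c_def)
      qed
      ultimately show ?thesis
        by (simp add: S_def sum.distrib sum_negf)
    qed
    have "S k m l = S k l m" for k m l
    proof -
      have "partial m (partial l \<alpha>) x $ k = partial l (partial m \<alpha>) x $ k"
        using partial_commute_vec[OF open_U x \<alpha>(1)] by simp
      moreover have "(\<Sum>j=1..p. c j x * partial m (h j k) x $ l) = (\<Sum>j=1..p. c j x * partial l (h j k) x $ m)"
        using partial_h_symmetric[OF _ x] by (intro sum.cong refl) simp
      moreover have "(\<Sum>j=1..p. partial m (c j) x * h j k x $ l + h j k x $ m * partial l (c j) x) =
          (\<Sum>j=1..p. partial l (c j) x * h j k x $ m + h j k x $ l * partial m (c j) x)"
        by (intro sum.cong refl) (simp add: mult.commute)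
      ultimately show ?thesis unfolding S by simp
    qed
    then have "(\<Sum>m\<in>UNIV. \<Sum>l\<in>UNIV. S k m l *\<^sub>R (dxi m \<and>\<^sub>s dxi l)) = 0" for k
      by (rule dxi_wedge_dxi_symmetric_sum)
    then show ?thesis by simp
  qed
  finally show ?thesis by (simp add: w_def c_def)
qed

end


section \<open>Curvature\<close>

context defining_functions
begin

lemma level_set: "M \<inter> U = {y\<in>U. \<forall>j\<in>{1..p}. \<rho> j y = 0}"
  using odf unfolding orthonormal_defining_functions_def by auto

lemma orthonormal_\<nu>:
  assumes "x \<in> M \<inter> U" "i \<in> {1..p}" "j \<in> {1..p}"
  shows "\<nu> i x \<bullet> \<nu> j x = (if i = j then 1 else 0)"
proof -
  have "conormal \<rho> i x \<bullet> conormal \<rho> j x = (if i = j then 1 else 0)"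
    using odf assms unfolding orthonormal_defining_functions_def by blast
  moreover have "x \<in> U" using assms(1) by simp
  ultimately show ?thesis by (simp only: conormal_\<nu>[OF assms(2)] conormal_\<nu>[OF assms(3)] inner_dxv)
qed

sublocale orthonormal_level_set M U "{1..p}" \<rho>
proof
  show "(\<chi> k. partial k (\<rho> i) x) \<bullet> (\<chi> k. partial k (\<rho> j) x) = (if i = j then 1 else 0)"
    if "x \<in> M \<inter> U" "i \<in> {1..p}" "j \<in> {1..p}" for x i j
    using orthonormal_\<nu>[OF that] by (simp only: \<nu>_def)
qed (use open_U smooth_\<rho> level_set in auto)

lemma curvature_form_h:
  "x \<in> U \<Longrightarrow> curvature_form p \<rho> x =
    (\<Sum>j=1..p. (1/2) *\<^sub>R (hessian_form (\<lambda>k. h j k x) \<and>\<^sub>s hessian_form (\<lambda>k. h j k x)))"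
  unfolding curvature_form_def scaleR_sum_right by (intro sum.cong refl) (simp add: Fform_h)

lemma contract_curvature_form:
  "x \<in> U \<Longrightarrow> dxv v \<rfloor> curvature_form p \<rho> x = (\<Sum>j=1..p. hessian_form (\<lambda>k. h j k x) \<and>\<^sub>s dxiv (H j x v))"
  by (simp only: curvature_form_h contract_sum_right contract_hessian_square H_def)

lemma bidegree_curvature_form: "superform_of_bidegree U 2 2 (curvature_form p \<rho>)"
proof -
  have "homogeneous 2 2 (curvature_form p \<rho> x)" if "x \<in> U" for x
    unfolding curvature_form_h[OF that]
    by (intro homogeneous_sum homogeneous_scaleR homogeneous_hessian_square)
  then show ?thesis
    unfolding superform_of_bidegree_def using smooth_on_curvature_form[OF open_U smooth_\<rho>]
    by (auto simp: homogeneous_def)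
qed

lemma symmetric_curvature_form: "symmetric_superform U (curvature_form p \<rho>)"
  unfolding symmetric_superform_def
proof
  fix x assume x: "x \<in> U"
  show "Jop (curvature_form p \<rho> x) = curvature_form p \<rho> x"
    unfolding curvature_form_h[OF x] Jop_sum Jop_scaleR Jop_wedge
    by (intro sum.cong refl) (simp add: Jop_hessian_form h_symmetric x)
qed

section \<open>The density of the supercurrent and the pointwise identity on
  \<open>M\<close>\<close>

text \<open>The density of \<open>[M]\<^sub>s\<close> with respect to surface measure. Its sign
  \<open>c\<^sub>p\<close> squares to 1 in inner products where \<open>N\<close> occurs
  twice.\<close>

definition N :: "real^'n::{finite,linorder} \<Rightarrow> 'n::{finite,linorder} scovector" where
  "N x = (-1) ^ (p * (p - 1) div 2) *\<^sub>R (normal_form p \<rho> x \<and>\<^sub>s Jop (normal_form p \<rho> x))"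

lemma N_eq: "x \<in> U \<Longrightarrow> N x = (-1) ^ (p * (p - 1) div 2) *\<^sub>R normal_wedge (\<lambda>j. \<nu> j x) [1..<Suc p]"
proof -
  assume x: "x \<in> U"
  have "foldr (\<lambda>j b. conormal \<rho> j x \<and>\<^sub>s b) js (scalar 1) = wedges (\<lambda>j. \<nu> j x) js (scalar 1)"
    if "set js \<subseteq> {1..p}" for js
    using that by (induction js) (simp_all add: conormal_\<nu> x)
  from this[of "[1..<Suc p]"] show ?thesis
    by (simp add: N_def normal_form_def normal_wedge_def atLeastLessThanSuc_atLeastAtMost del: upt_Suc)
qed

lemma smooth_N: "smooth_on U N"
  unfolding N_def
  by (intro smooth_on_linear[OF open_U bounded_linear_scaleR_right]
      smooth_on_bilinear[OF open_U bounded_bilinear_wedge] smooth_on_linear[OF open_U bounded_linear_Jop]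
      smooth_on_normal_form open_U smooth_\<rho>)

lemma dxiv_N: "i \<in> {1..p} \<Longrightarrow> x \<in> U \<Longrightarrow> dxiv (\<nu> i x) \<and>\<^sub>s N x = 0"
  using dxiv_normal_wedge[of i "[1..<Suc p]" "\<lambda>j. \<nu> j x"]
  by (simp add: N_eq wedge_scaleR_right atLeastLessThanSuc_atLeastAtMost del: upt_Suc)

lemma tangential_component_N:
  assumes "x \<in> M \<inter> U"
  shows "(dxv c \<and>\<^sub>s N x) \<bullet> (dx k \<and>\<^sub>s N x) = (c - (\<Sum>j=1..p. (\<nu> j x \<bullet> c) *\<^sub>R \<nu> j x)) $ k"
proof -
  let ?js = "[1..<Suc p]"
  have "set ?js = {1..p}" by (simp add: atLeastLessThanSuc_atLeastAtMost del: upt_Suc)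
  then show ?thesis
    using tangential_component[of ?js "\<lambda>j. \<nu> j x" c k] orthonormal_\<nu>[OF assms] assms
    by (simp add: N_eq wedge_scaleR_right power_add[symmetric] del: upt_Suc)
qed

lemma linear_H: "linear (H j x)"
  unfolding H_def by (auto simp: scaleR_add_left sum.distrib scaleR_sum_right intro!: linearI)

text \<open>Differentiating \<open>n\<^sub>i \<bullet> n\<^sub>j = \<delta>\<^sub>i\<^sub>j\<close> along \<open>M\<close>.\<close>

lemma H_normal:
  assumes x: "x \<in> M \<inter> U" and i: "i \<in> {1..p}" and j: "j \<in> {1..p}"
  shows "dxiv (H j x (\<nu> i x) + H i x (\<nu> j x)) \<and>\<^sub>s N x = 0"
proof -
  define g where "g = (\<lambda>y. \<nu> i y \<bullet> \<nu> j y)"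
  have xU: "x \<in> U" using x by simp
  have "smooth_on U g" unfolding g_def
    by (intro smooth_on_bilinear[OF open_U bounded_bilinear_inner] smooth_\<nu> i j)
  moreover have "g y = (if i = j then 1 else 0)" if "y \<in> M \<inter> U" for y
    unfolding g_def by (rule orthonormal_\<nu>[OF that i j])
  ultimately have G: "(\<chi> l. partial l g x) = (\<Sum>s=1..p. (\<nu> s x \<bullet> (\<chi> l. partial l g x)) *\<^sub>R \<nu> s x)"
    unfolding \<nu>_def by (rule gradient_normal[OF x])
  have "dxiv (\<chi> l. partial l g x) \<and>\<^sub>s N x = dxiv (\<Sum>s=1..p. (\<nu> s x \<bullet> (\<chi> l. partial l g x)) *\<^sub>R \<nu> s x) \<and>\<^sub>s N x"
    by (rule arg_cong[OF G])
  also have "\<dots> = 0"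
    unfolding dxiv_sum dxiv_scaleR wedge_sum_left wedge_scaleR_left
    by (intro sum.neutral ballI) (simp only: dxiv_N[OF _ xU] scaleR_zero_right)
  also have "(\<chi> l. partial l g x) = H j x (\<nu> i x) + H i x (\<nu> j x)"
  proof -
    have "partial l g x = H i x (\<nu> j x) $ l + H j x (\<nu> i x) $ l" for l
      unfolding g_def partial_inner_\<nu>[OF i xU smooth_\<nu>[OF j]]
      using h_symmetric[OF i xU, of l] h_symmetric[OF j xU, of l]
      by (simp add: H_def inner_vec_def mult.commute flip: h_def)
    then show ?thesis by (simp add: vec_eq_iff)
  qed
  finally show ?thesis .
qed

text \<open>Here \<open>b\<close> is tangential at \<open>x\<close> but not otherwise tied to
  \<open>a\<close>, so the defect is kept as an explicit linear expression in
  \<open>(a x - b x) \<and>\<^sub>s N x\<close>. The normal part of \<open>a x - b x\<close> drops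
  out by \<open>H_normal\<close>; the tangential part is recovered by
  \<open>tangential_component_N\<close>.\<close>

lemma D_sharp_square_on_M:
  assumes x: "x \<in> M \<inter> U"
    and \<alpha>: "smooth_on U \<alpha>" "\<And>y. y \<in> U \<Longrightarrow> a y = dxv (\<alpha> y)"
    and \<beta>: "b x = dxv \<beta>" "\<And>j. j \<in> {1..p} \<Longrightarrow> \<nu> j x \<bullet> \<beta> = 0"
  shows "(D_sharp p \<rho> (D_sharp p \<rho> a) x - b x \<rfloor> curvature_form p \<rho> x) \<and>\<^sub>s N x =
    (\<Sum>k\<in>UNIV. (((a x - b x) \<and>\<^sub>s N x) \<bullet> (dx k \<and>\<^sub>s N x)) *\<^sub>R ((dx k \<rfloor> curvature_form p \<rho> x) \<and>\<^sub>s N x))"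
proof -
  have xU: "x \<in> U" using x by simp
  let ?F = "\<lambda>j. hessian_form (\<lambda>k. h j k x)"
  define c where "c = \<alpha> x - \<beta>"
  define t where "t = c - (\<Sum>i=1..p. (\<nu> i x \<bullet> c) *\<^sub>R \<nu> i x)"
  have ab: "a x - b x = dxv c" using \<alpha>(2)[OF xU] \<beta>(1) by (simp add: c_def dxv_diff)
  have nc: "\<nu> i x \<bullet> \<alpha> x = \<nu> i x \<bullet> c" if "i \<in> {1..p}" for i
    using \<beta>(2)[OF that] by (simp add: c_def inner_diff_right)
  have "H j x (\<alpha> x) + (\<Sum>i=1..p. (\<nu> i x \<bullet> \<alpha> x) *\<^sub>R H i x (\<nu> j x)) - H j x \<beta> =
      H j x t + (\<Sum>i=1..p. (\<nu> i x \<bullet> c) *\<^sub>R (H j x (\<nu> i x) + H i x (\<nu> j x)))" for j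
  proof -
    \<comment> \<open>The normal part of \<open>\<alpha> x\<close> joins the extra terms of
      \<open>D_sharp_square\<close> and symmetrises them in \<open>i\<close> and \<open>j\<close>,
      as \<open>H_normal\<close> requires.\<close>
    have "\<alpha> x = \<beta> + t + (\<Sum>i=1..p. (\<nu> i x \<bullet> c) *\<^sub>R \<nu> i x)" by (simp add: t_def c_def)
    then have "H j x (\<alpha> x) = H j x \<beta> + H j x t + (\<Sum>i=1..p. (\<nu> i x \<bullet> c) *\<^sub>R H j x (\<nu> i x))"
      by (simp add: linear_add[OF linear_H] linear_sum[OF linear_H] linear_scale[OF linear_H])
    then show ?thesis using nc by (simp add: scaleR_add_right sum.distrib)
  qed
  moreover have Dsq: "D_sharp p \<rho> (D_sharp p \<rho> a) x = (\<Sum>j=1..p. ?F j \<and>\<^sub>s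
      dxiv (H j x (\<alpha> x) + (\<Sum>i=1..p. (\<nu> i x \<bullet> \<alpha> x) *\<^sub>R H i x (\<nu> j x))))"
    by (rule D_sharp_square[OF \<alpha>(1) _ xU]) (rule \<alpha>(2))
  ultimately have E: "(D_sharp p \<rho> (D_sharp p \<rho> a) x - b x \<rfloor> curvature_form p \<rho> x) =
      (\<Sum>j=1..p. ?F j \<and>\<^sub>s dxiv (H j x t + (\<Sum>i=1..p. (\<nu> i x \<bullet> c) *\<^sub>R (H j x (\<nu> i x) + H i x (\<nu> j x)))))"
    unfolding Dsq \<beta>(1) contract_curvature_form[OF xU]
    by (simp only: sum_subtractf[symmetric] wedge_diff_right[symmetric]
        linear_diff[OF bounded_linear.linear[OF bounded_linear_dxiv], symmetric])
  have "(D_sharp p \<rho> (D_sharp p \<rho> a) x - b x \<rfloor> curvature_form p \<rho> x) \<and>\<^sub>s N x =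
      (\<Sum>j=1..p. ?F j \<and>\<^sub>s dxiv (H j x t) \<and>\<^sub>s N x)"
  proof -
    have "dxiv (H j x t + (\<Sum>i=1..p. (\<nu> i x \<bullet> c) *\<^sub>R (H j x (\<nu> i x) + H i x (\<nu> j x)))) \<and>\<^sub>s N x =
        dxiv (H j x t) \<and>\<^sub>s N x" if "j \<in> {1..p}" for j
    proof -
      have "dxiv (\<Sum>i=1..p. (\<nu> i x \<bullet> c) *\<^sub>R (H j x (\<nu> i x) + H i x (\<nu> j x))) \<and>\<^sub>s N x = 0"
        unfolding dxiv_sum dxiv_scaleR wedge_sum_left wedge_scaleR_left
        by (intro sum.neutral ballI) (simp only: H_normal[OF x _ that] scaleR_zero_right)
      then show ?thesis by (simp add: dxiv_add[of "H j x t"] wedge_add_left)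
    qed
    then show ?thesis unfolding E wedge_sum_left wedge_assoc by (intro sum.cong refl) simp
  qed
  also have "\<dots> = (dxv t \<rfloor> curvature_form p \<rho> x) \<and>\<^sub>s N x"
    by (simp only: contract_curvature_form[OF xU] wedge_sum_left wedge_assoc)
  also have "\<dots> = (\<Sum>k\<in>UNIV. t $ k *\<^sub>R ((dx k \<rfloor> curvature_form p \<rho> x) \<and>\<^sub>s N x))"
    by (simp only: dxv_def contract_sum_left contract_scaleR_left wedge_sum_left wedge_scaleR_left)
  finally show ?thesis unfolding ab tangential_component_N[OF x] t_def .
qed

section \<open>Integration against surface measure\<close>

abbreviation "\<mu> \<equiv> surface_measure (CARD('n) - p) M"

text \<open>\<open>g\<close> is arbitrary outside \<open>U\<close>, but the product is continuous
  everywhere, being zero off a compact subset of \<open>U\<close>, and surface measure is finite on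
  that set.\<close>

lemma integrable_test_function:
  assumes g: "continuous_on U g" and \<phi>: "test_function U \<phi>"
  shows "integrable \<mu> (\<lambda>x. g x * \<phi> x)"
proof -
  define C where "C = closure {x. \<phi> x \<noteq> 0}"
  have C: "compact C" "C \<subseteq> U" using \<phi> unfolding C_def test_function_def by auto
  have zero: "\<phi> x = 0" if "x \<notin> C" for x
    using that closure_subset[of "{x. \<phi> x \<noteq> 0}"] unfolding C_def by auto
  have "continuous_on U (\<lambda>x. g x * \<phi> x)"
    using \<phi> unfolding test_function_def
    by (intro continuous_on_mult g continuous_on_subset[OF smooth_on_continuous]) auto
  moreover have "continuous_on (- C) (\<lambda>x. g x * \<phi> x)"
    by (rule continuous_on_cong[THEN iffD1, OF refl _ continuous_on_const[of _ 0]]) (simp add: zero)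
  ultimately have "continuous_on (U \<union> - C) (\<lambda>x. g x * \<phi> x)"
    using open_U C(1) by (intro continuous_on_open_Un) (auto simp: compact_imp_closed open_Compl)
  moreover have "U \<union> - C = UNIV" using C(2) by auto
  ultimately have cont: "continuous_on UNIV (\<lambda>x. g x * \<phi> x)" by simp
  then have meas: "(\<lambda>x. g x * \<phi> x) \<in> borel_measurable \<mu>"
    using borel_measurable_continuous_onI measurable_cong_sets[OF sets_surface_measure refl] by blast
  have "bounded ((\<lambda>x. g x * \<phi> x) ` C)"
    by (intro compact_imp_bounded compact_continuous_image C continuous_on_subset[OF cont]) auto
  then obtain B where B: "\<And>x. x \<in> C \<Longrightarrow> norm (g x * \<phi> x) \<le> B" unfolding bounded_iff by auto
  have Cb: "C \<in> sets borel" using C(1) by (simp add: compact_imp_closed)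
  have "emeasure \<mu> C < top"
    using compact_finite_hausdorff[OF C] by (simp add: emeasure_surface_measure[OF Cb])
  then show ?thesis
    using Cb B zero by (intro integrableI_bounded_set[where A=C and B=B] meas) auto
qed

text \<open>Test functions must be smooth on the whole space while \<open>q\<close> is controlled on
  \<open>U\<close> only; the product is glued with zero off the support of
  \<open>\<phi>\<close>.\<close>

lemma test_function_mult:
  assumes q: "smooth_on U q" and \<phi>: "test_function U \<phi>"
  shows "test_function U (\<lambda>x. q x * \<phi> x)"
proof -
  define C where "C = closure {x. \<phi> x \<noteq> 0}"
  have C: "compact C" "C \<subseteq> U" using \<phi> unfolding C_def test_function_def by auto
  have zero: "\<phi> x = 0" if "x \<notin> C" for x
    using that closure_subset[of "{x. \<phi> x \<noteq> 0}"] unfolding C_def by auto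
  have "smooth_on U (\<lambda>x. q x * \<phi> x)"
    using \<phi> unfolding test_function_def
    by (intro smooth_on_bilinear[OF open_U bounded_bilinear_mult] q) (auto intro: smooth_on_subset)
  moreover have "open (- C)" using C(1) by (simp add: compact_imp_closed open_Compl)
  then have "smooth_on (- C) (\<lambda>x. q x * \<phi> x)"
    by (rule smooth_on_cong[OF _ _ smooth_on_const[of _ 0]]) (simp add: zero)
  ultimately have "smooth_on (U \<union> - C) (\<lambda>x. q x * \<phi> x)" by (simp add: smooth_on_Un)
  moreover have "U \<union> - C = UNIV" using C(2) by auto
  ultimately have "smooth_on UNIV (\<lambda>x. q x * \<phi> x)" by simp
  moreover have "closure {x. q x * \<phi> x \<noteq> 0} \<subseteq> C" unfolding C_def by (rule closure_mono) auto
  ultimately show ?thesis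
    unfolding test_function_def
    using compact_Int_closed[OF C(1) closed_closure, of "{x. q x * \<phi> x \<noteq> 0}"] C(2)
    by (auto simp: Int_absorb1)
qed

lemma wedge_star_measure:
  "wedge_current a (star_measure \<mu>) P \<phi> = (\<integral>x. a x $ P * \<phi> x \<partial>\<mu>)"
proof -
  obtain A B where P: "P = (A, B)" by fastforce
  have "wedge_current a (star_measure \<mu>) P \<phi> = (\<Sum>I\<in>Pow A. \<Sum>J\<in>Pow B.
      if J = B then (if I = A then \<integral>x. a x $ (A, B) * \<phi> x \<partial>\<mu> else 0) else 0)"
    unfolding wedge_current_def P
    by (intro sum.cong refl) (auto simp: star_measure_def swap_sign_def)
  also have "\<dots> = (\<Sum>I\<in>Pow A. if I = A then \<integral>x. a x $ (A, B) * \<phi> x \<partial>\<mu> else 0)"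
    by (intro sum.cong refl) (simp add: finite_subset)
  finally show ?thesis by (simp add: P)
qed

text \<open>The terms of the wedge product may be collected under one integral because each is
  integrable.\<close>

lemma wedge_Ms_current:
  assumes a: "smooth_on U a" and \<phi>: "test_function U \<phi>"
  shows "wedge_current a (Ms_current p M \<rho>) P \<phi> = (\<integral>x. (a x \<and>\<^sub>s N x) $ P * \<phi> x \<partial>\<mu>)"
proof -
  obtain A B where P: "P = (A, B)" by fastforce
  have int: "integrable \<mu> (\<lambda>x. N x $ Q * (a x $ R * \<phi> x))" for Q R
  proof -
    have "continuous_on U (\<lambda>x. N x $ Q * a x $ R)"
      by (intro continuous_on_mult smooth_on_continuous smooth_on_nth open_U smooth_N a)
    from integrable_test_function[OF this \<phi>] show ?thesis by (simp add: mult.assoc)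
  qed
  have "wedge_current a (Ms_current p M \<rho>) P \<phi> = (\<Sum>I\<in>Pow A. \<Sum>J\<in>Pow B.
      \<integral>x. swap_sign I J (A - I) (B - J) * (N x $ (A - I, B - J) * (a x $ (I, J) * \<phi> x)) \<partial>\<mu>)"
    unfolding wedge_current_def[of a] Ms_current_def N_def[symmetric] wedge_star_measure P by simp
  also have "\<dots> = (\<integral>x. (\<Sum>I\<in>Pow A. \<Sum>J\<in>Pow B.
      swap_sign I J (A - I) (B - J) * (N x $ (A - I, B - J) * (a x $ (I, J) * \<phi> x))) \<partial>\<mu>)"
    using int by (subst Bochner_Integration.integral_sum, simp)+ simp
  also have "\<dots> = (\<integral>x. (a x \<and>\<^sub>s N x) $ P * \<phi> x \<partial>\<mu>)"
    unfolding P wedge_nth sum_distrib_right by (simp only: mult_ac)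
  finally show ?thesis .
qed

lemma D_sharp_square_eq_on_Ms:
  assumes a: "superform_of_bidegree U 1 0 a" and b: "superform_of_bidegree U 1 0 b"
    and can: "canonical_extension p M U \<rho> a b"
  shows "eq_on_Ms p M U \<rho> (D_sharp p \<rho> (D_sharp p \<rho> a)) (\<lambda>x. b x \<rfloor> curvature_form p \<rho> x)"
  unfolding eq_on_Ms_def eq_current_on_def
proof (intro allI impI)
  fix P \<phi> assume \<phi>: "test_function U \<phi>"
  define \<alpha> where "\<alpha> = (\<lambda>x. \<chi> k. a x $ ({k}, {}))"
  define \<beta> where "\<beta> = (\<lambda>x. \<chi> k. b x $ ({k}, {}))"
  have sa: "smooth_on U a" and sb: "smooth_on U b" using a b unfolding superform_of_bidegree_def by auto
  have s\<alpha>: "smooth_on U \<alpha>" unfolding \<alpha>_def by (intro smooth_on_vec smooth_on_nth open_U sa)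
  have a_eq: "a x = dxv (\<alpha> x)" and b_eq: "b x = dxv (\<beta> x)" if "x \<in> U" for x
    using a b that unfolding superform_of_bidegree_def \<alpha>_def \<beta>_def
    by (auto intro!: homogeneous_1_0 simp: homogeneous_def)
  have \<beta>_orth: "\<nu> j x \<bullet> \<beta> x = 0" if "x \<in> M \<inter> U" "j \<in> {1..p}" for x j
  proof -
    have "conormal \<rho> j x \<rfloor> b x = 0" using can that unfolding canonical_extension_def by blast
    then have "(scalar (\<nu> j x \<bullet> \<beta> x) :: 'n scovector) = 0" using that by (simp add: conormal_\<nu> b_eq contract_dxv)
    then show ?thesis by (simp add: scalar_def axis_eq_0_iff)
  qed
  let ?D = "D_sharp p \<rho> (D_sharp p \<rho> a)" and ?R = "\<lambda>x. b x \<rfloor> curvature_form p \<rho> x"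
  have sD: "smooth_on U ?D" by (intro smooth_on_D_sharp open_U smooth_\<rho> sa)
  have sR: "smooth_on U ?R"
    by (intro smooth_on_bilinear[OF open_U bounded_bilinear_contract] sb smooth_on_curvature_form open_U smooth_\<rho>)
  have swN: "smooth_on U (\<lambda>x. f x \<and>\<^sub>s N x)" if "smooth_on U f" for f
    by (intro smooth_on_bilinear[OF open_U bounded_bilinear_wedge] that smooth_N)
  have int: "integrable \<mu> (\<lambda>x. (f x \<and>\<^sub>s N x) $ Q * \<psi> x)" if "smooth_on U f" "test_function U \<psi>" for f Q \<psi>
    by (intro integrable_test_function smooth_on_continuous smooth_on_nth open_U swN that)
  \<comment> \<open>By \<open>D_sharp_square_on_M\<close>, coordinate \<open>P\<close> of the defect
    is the sum over \<open>Q\<close> of coordinate \<open>Q\<close> of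
    \<open>(a x - b x) \<and>\<^sub>s N x\<close> times \<open>q Q x\<close>.\<close>
  define q where "q = (\<lambda>Q x. \<Sum>k\<in>UNIV. (dx k \<and>\<^sub>s N x) $ Q * ((dx k \<rfloor> curvature_form p \<rho> x) \<and>\<^sub>s N x) $ P)"
  have sq: "smooth_on U (q Q)" for Q
    unfolding q_def
    by (intro smooth_on_sum smooth_on_bilinear[OF open_U bounded_bilinear_mult] smooth_on_nth open_U swN
        smooth_on_const smooth_on_bilinear[OF open_U bounded_bilinear_contract] smooth_on_curvature_form smooth_\<rho>)
  have test: "test_function U (\<lambda>x. q Q x * \<phi> x)" for Q by (rule test_function_mult[OF sq \<phi>])
  \<comment> \<open>The hypothesis on \<open>b\<close> as a current is used here, with the smooth
    factor \<open>q Q\<close> absorbed into the test function.\<close>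
  have diff0: "(\<integral>x. ((a x - b x) \<and>\<^sub>s N x) $ Q * (q Q x * \<phi> x) \<partial>\<mu>) = 0" for Q
  proof -
    have "wedge_current b (Ms_current p M \<rho>) Q (\<lambda>x. q Q x * \<phi> x) =
        wedge_current a (Ms_current p M \<rho>) Q (\<lambda>x. q Q x * \<phi> x)"
      using can test unfolding canonical_extension_def eq_on_Ms_def eq_current_on_def by blast
    then have "(\<integral>x. (b x \<and>\<^sub>s N x) $ Q * (q Q x * \<phi> x) \<partial>\<mu>) = (\<integral>x. (a x \<and>\<^sub>s N x) $ Q * (q Q x * \<phi> x) \<partial>\<mu>)"
      by (simp add: wedge_Ms_current[OF _ test] sa sb)
    then show ?thesis
      using Bochner_Integration.integral_diff[OF int[OF sa test, of Q Q] int[OF sb test, of Q Q]]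
      by (simp add: wedge_diff_left left_diff_distrib)
  qed
  have on_M: "(?D x \<and>\<^sub>s N x) $ P * \<phi> x - (?R x \<and>\<^sub>s N x) $ P * \<phi> x =
      (\<Sum>Q\<in>UNIV. ((a x - b x) \<and>\<^sub>s N x) $ Q * (q Q x * \<phi> x))" if x: "x \<in> M \<inter> U" for x
  proof -
    have "(?D x - ?R x) \<and>\<^sub>s N x = (\<Sum>k\<in>UNIV.
        (((a x - b x) \<and>\<^sub>s N x) \<bullet> (dx k \<and>\<^sub>s N x)) *\<^sub>R ((dx k \<rfloor> curvature_form p \<rho> x) \<and>\<^sub>s N x))"
    proof (rule D_sharp_square_on_M[where b=b and \<beta>="\<beta> x", OF x s\<alpha>])
      show "a y = dxv (\<alpha> y)" if "y \<in> U" for y by (rule a_eq[OF that])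
      show "b x = dxv (\<beta> x)" using x by (simp add: b_eq)
    qed (rule \<beta>_orth[OF x])
    then have "((?D x - ?R x) \<and>\<^sub>s N x) $ P =
        (\<Sum>k\<in>UNIV. (((a x - b x) \<and>\<^sub>s N x) \<bullet> (dx k \<and>\<^sub>s N x)) * ((dx k \<rfloor> curvature_form p \<rho> x) \<and>\<^sub>s N x) $ P)"
      by simp
    also have "\<dots> = (\<Sum>Q\<in>UNIV. ((a x - b x) \<and>\<^sub>s N x) $ Q * q Q x)"
      unfolding q_def inner_vec_def sum_distrib_left sum_distrib_right inner_real_def
      by (subst sum.swap) (simp add: mult_ac)
    finally show ?thesis
      by (simp add: wedge_diff_left left_diff_distrib[symmetric] sum_distrib_right mult.assoc)
  qed
  \<comment> \<open>The pointwise identity holds on \<open>M\<close> only, so \<open>U - M\<close>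
    has to be a null set; it is open, hence Borel, because \<open>M\<close> is closed in
    \<open>U\<close>.\<close>
  have null: "AE x in \<mu>. x \<in> M \<inter> U \<or> x \<notin> U"
  proof (rule AE_I')
    have "openin (top_of_set U) (U - M \<inter> U)" using closedin_level_set by (simp add: closedin_def)
    then have "open (U - M)" using openin_open_trans[OF _ open_U] by (simp add: Diff_Int)
    then have "U - M \<in> sets borel" by simp
    moreover have "(U - M) \<inter> M = {}" by auto
    ultimately show "U - M \<in> null_sets \<mu>"
      by (simp add: null_sets_def emeasure_surface_measure hausdorff_empty)
    show "{x \<in> space \<mu>. \<not> (x \<in> M \<inter> U \<or> x \<notin> U)} \<subseteq> U - M" by auto
  qed
  have int_ab: "integrable \<mu> (\<lambda>x. ((a x - b x) \<and>\<^sub>s N x) $ Q * (q Q x * \<phi> x))" for Q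
    using Bochner_Integration.integrable_diff[OF int[OF sa test, of Q Q] int[OF sb test, of Q Q]]
    by (simp add: wedge_diff_left left_diff_distrib)
  have "(\<integral>x. (?D x \<and>\<^sub>s N x) $ P * \<phi> x \<partial>\<mu>) - (\<integral>x. (?R x \<and>\<^sub>s N x) $ P * \<phi> x \<partial>\<mu>) =
      (\<integral>x. (?D x \<and>\<^sub>s N x) $ P * \<phi> x - (?R x \<and>\<^sub>s N x) $ P * \<phi> x \<partial>\<mu>)"
    by (rule Bochner_Integration.integral_diff[symmetric]) (rule int[OF _ \<phi>] sD sR)+
  also have "\<dots> = (\<integral>x. (\<Sum>Q\<in>UNIV. ((a x - b x) \<and>\<^sub>s N x) $ Q * (q Q x * \<phi> x)) \<partial>\<mu>)"
  proof (rule integral_cong_AE)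
    show "AE x in \<mu>. (?D x \<and>\<^sub>s N x) $ P * \<phi> x - (?R x \<and>\<^sub>s N x) $ P * \<phi> x =
        (\<Sum>Q\<in>UNIV. ((a x - b x) \<and>\<^sub>s N x) $ Q * (q Q x * \<phi> x))"
      using null
    proof (rule AE_mp, intro AE_I2 impI)
      fix x assume x: "x \<in> M \<inter> U \<or> x \<notin> U"
      have "\<phi> x = 0" if "x \<notin> U"
        using that \<phi> closure_subset[of "{x. \<phi> x \<noteq> 0}"] unfolding test_function_def by auto
      then show "(?D x \<and>\<^sub>s N x) $ P * \<phi> x - (?R x \<and>\<^sub>s N x) $ P * \<phi> x =
          (\<Sum>Q\<in>UNIV. ((a x - b x) \<and>\<^sub>s N x) $ Q * (q Q x * \<phi> x))"
        using x on_M by auto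
    qed
    show "(\<lambda>x. (?D x \<and>\<^sub>s N x) $ P * \<phi> x - (?R x \<and>\<^sub>s N x) $ P * \<phi> x) \<in> borel_measurable \<mu>"
      by (intro borel_measurable_integrable Bochner_Integration.integrable_diff int \<phi> sD sR)
    show "(\<lambda>x. \<Sum>Q\<in>UNIV. ((a x - b x) \<and>\<^sub>s N x) $ Q * (q Q x * \<phi> x)) \<in> borel_measurable \<mu>"
      by (intro borel_measurable_integrable Bochner_Integration.integrable_sum int_ab)
  qed
  also have "\<dots> = 0"
    by (subst Bochner_Integration.integral_sum) (simp_all add: int_ab diff0)
  finally show "wedge_current ?D (Ms_current p M \<rho>) P \<phi> = wedge_current ?R (Ms_current p M \<rho>) P \<phi>"
    by (simp add: wedge_Ms_current[OF _ \<phi>] sD sR)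
qed

end

theorem proposition9p1:
  fixes M U :: "(real^'n::{finite,linorder}) set"
    and \<rho> :: "nat \<Rightarrow> real^'n::{finite,linorder} \<Rightarrow> real"
    and p :: nat
  assumes "smooth_submanifold p M"
    and "orthonormal_defining_functions p M U \<rho>"
  shows "superform_of_bidegree U 2 2 (curvature_form p \<rho>) \<and>
         symmetric_superform U (curvature_form p \<rho>) \<and>
         (\<forall>a b. superform_of_bidegree U 1 0 a \<and> superform_of_bidegree U 1 0 b \<and>
            canonical_extension p M U \<rho> a b \<longrightarrow>
            eq_on_Ms p M U \<rho> (D_sharp p \<rho> (D_sharp p \<rho> a)) (\<lambda>x. b x \<rfloor> curvature_form p \<rho> x))"
proof -
  interpret defining_functions M U p \<rho> by unfold_locales (rule assms(2))
  show ?thesis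
    using bidegree_curvature_form symmetric_curvature_form D_sharp_square_eq_on_Ms by blast
qed

end
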